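(* Assume that the size $\sigma$ of the alphabet of constants $\Sigma$ is a constant. Restricted to inputs in which $\alpha$ is a regular pattern (each variable occurs only once in $\alpha$), both problems $\mathtt{MatchSimon}(\alpha,w,k)$ and $\mathtt{MatchStrictSimon}(\alpha,w,k)$ are in $\mathsf P$.
   Context: Let $\Sigma=\{1,\ldots,\sigma\}$, $\sigma\ge 2$, be a finite alphabet of constants (terminals) and $\mathcal X$ a possibly infinite set of variables with $\Sigma\cap\mathcal X=\emptyset$. A pattern is a word $\alpha\in(\Sigma\cup\mathcal X)^*$. A substitution is a morphism $h:(\Sigma\cup\mathcal X)^*\to\Sigma^*$ with $h(a)=a$ for all $a\in\Sigma$; each variable is mapped to an arbitrary, possibly empty, word over $\Sigma$. A word $u$ is a subsequence of $w$ if $u$ is obtained from $w$ by deleting some (possibly no) letters. For $k\in\mathbb N_0$, two words $w_1,w_2\in\Sigma^*$ are Simon $k$-congruent, $w_1\sim_k w_2$, if they have the same set of subsequences of length at most $k$. Problem $\mathtt{MatchSimon}(\alpha,w,k)$. Input: a pattern $\alpha$, a word $w\in\Sigma^*$ with $|w|=n$, and a number $k\in\{1,\ldots,n\}$. Question: is there a substitution $h$ with $h(\alpha)\sim_k w$? Problem $\mathtt{MatchStrictSimon}(\alpha,w,k)$. Input: a pattern $\alpha$, a word $w\in\Sigma^*$ with $|w|=n$, and a number $k\in\{1,\ldots,n\}$. Question: is there a substitution $h$ with $h(\alpha)\sim_k w$ and $h(\alpha)\not\sim_{k+1} w$? The size $\sigma$ of $\Sigma$ is a constant (not part of the input), and it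 is in general assumed that every letter of $\Sigma$ occurs in $\alpha$ or in $w$. *)

theory Defs
  imports Main "HOL-Library.Sublist"
begin

text \<open>
  The terminals are the numbers from 1 to \<open>\<sigma>\<close>, the variables are indexed by all natural numbers.
  The two constructors keep terminals and variables disjoint.
\<close>

datatype symbol = Const nat | Var nat

definition terminals :: "nat \<Rightarrow> nat set" where
  "terminals \<sigma> = {1..\<sigma>}"

definition symbols :: "nat \<Rightarrow> symbol set" where
  "symbols \<sigma> = Const ` terminals \<sigma> \<union> range Var"

definition substitution :: "nat \<Rightarrow> (symbol list \<Rightarrow> nat list) \<Rightarrow> bool" where
  "substitution \<sigma> h \<longleftrightarrow>
     (\<forall>u \<in> lists (symbols \<sigma>). h u \<in> lists (terminals \<sigma>)) \<and>
     (\<forall>u \<in> lists (symbols \<sigma>). \<forall>v \<in> lists (symbols \<sigma>). h (u @ v) = h u @ h v) \<and>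
     (\<forall>a \<in> terminals \<sigma>. h [Const a] = [a])"

definition regular_pattern :: "symbol list \<Rightarrow> bool" where
  "regular_pattern \<alpha> \<longleftrightarrow> (\<forall>x. count_list \<alpha> (Var x) \<le> 1)"

definition simon_congruent :: "nat \<Rightarrow> nat list \<Rightarrow> nat list \<Rightarrow> bool" where
  "simon_congruent k u v \<longleftrightarrow>
     {x. subseq x u \<and> length x \<le> k} = {x. subseq x v \<and> length x \<le> k}"

type_synonym inst = "symbol list \<times> nat list \<times> nat"

definition inputs :: "nat \<Rightarrow> inst set" where
  "inputs \<sigma> = {(\<alpha>, w, k). \<alpha> \<in> lists (symbols \<sigma>) \<and> w \<in> lists (terminals \<sigma>) \<and> k \<in> {1..length w}}"

definition regular_inputs :: "nat \<Rightarrow> inst set" where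
  "regular_inputs \<sigma> = {(\<alpha>, w, k) \<in> inputs \<sigma>. regular_pattern \<alpha>}"

definition MatchSimon :: "nat \<Rightarrow> inst set" where
  "MatchSimon \<sigma> = {(\<alpha>, w, k) \<in> inputs \<sigma>.
     \<exists>h. substitution \<sigma> h \<and> simon_congruent k (h \<alpha>) w}"

definition MatchStrictSimon :: "nat \<Rightarrow> inst set" where
  "MatchStrictSimon \<sigma> = {(\<alpha>, w, k) \<in> inputs \<sigma>.
     \<exists>h. substitution \<sigma> h \<and> simon_congruent k (h \<alpha>) w \<and> \<not> simon_congruent (k + 1) (h \<alpha>) w}"

text \<open>
  Every list item is preceded by \<open>True\<close> and the list is closed by \<open>False\<close>, so that all encodings
  below are prefix-free. Numbers are written in binary, least significant bit first and without
  leading zeros.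
\<close>

definition enc_list :: "('a \<Rightarrow> bool list) \<Rightarrow> 'a list \<Rightarrow> bool list" where
  "enc_list f xs = concat (map (\<lambda>x. True # f x) xs) @ [False]"

fun bits :: "nat \<Rightarrow> bool list" where
  "bits n = (if n = 0 then [] else odd n # bits (n div 2))"

declare bits.simps [simp del]

definition enc_nat :: "nat \<Rightarrow> bool list" where
  "enc_nat n = enc_list (\<lambda>b. [b]) (bits n)"

fun enc_symbol :: "symbol \<Rightarrow> bool list" where
  "enc_symbol (Const a) = False # enc_nat a"
| "enc_symbol (Var x) = True # enc_nat x"

fun enc_inst :: "inst \<Rightarrow> bool list" where
  "enc_inst (\<alpha>, w, k) = enc_list enc_symbol \<alpha> @ enc_list enc_nat w @ enc_nat k"

lemma enc_list_simps [simp]: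
  "enc_list f [] = [False]"
  "enc_list f (x # xs) = True # f x @ enc_list f xs"
  by (simp_all add: enc_list_def)

lemma enc_list_append_inject:
  assumes inject: "\<And>x y r s. f x @ r = f y @ s \<Longrightarrow> x = y \<and> r = s"
  shows "enc_list f xs @ r = enc_list f ys @ s \<longleftrightarrow> xs = ys \<and> r = s"
proof (induction xs arbitrary: ys)
  case Nil
  show ?case by (cases ys) simp_all
next
  case (Cons x xs)
  show ?case
  proof (cases ys)
    case Nil
    then show ?thesis by simp
  next
    case ys: (Cons y ys')
    have "f x @ enc_list f xs @ r = f y @ enc_list f ys' @ s \<longleftrightarrow>
        x = y \<and> enc_list f xs @ r = enc_list f ys' @ s"
      using inject[of x "enc_list f xs @ r" y "enc_list f ys' @ s"] by (rule iffI) simp_all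
    then show ?thesis by (simp add: ys Cons.IH)
  qed
qed

lemma bits_inject: "bits m = bits n \<Longrightarrow> m = n"
proof (induction m arbitrary: n rule: less_induct)
  case (less m)
  show ?case
  proof (cases "m = 0 \<or> n = 0")
    case True
    then show ?thesis using less.prems
      by (auto simp: bits.simps[of m] bits.simps[of n] split: if_splits)
  next
    case False
    then have "odd m = odd n" "bits (m div 2) = bits (n div 2)"
      using less.prems by (simp_all add: bits.simps[of m] bits.simps[of n])
    moreover from this have "m div 2 = n div 2"
      using less.IH[of "m div 2"] False by simp
    ultimately show ?thesis
      by (metis bit_eq_rec)
  qed
qed

lemma enc_nat_append_inject: "enc_nat m @ r = enc_nat n @ s \<longleftrightarrow> m = n \<and> r = s"
  unfolding enc_nat_def by (subst enc_list_append_inject) (auto dest: bits_inject)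

lemma enc_symbol_append_inject: "enc_symbol x @ r = enc_symbol y @ s \<longleftrightarrow> x = y \<and> r = s"
  by (cases x; cases y) (auto simp: enc_nat_append_inject)

lemma inj_enc_inst: "inj enc_inst"
proof (rule injI)
  fix x y :: inst
  assume eq: "enc_inst x = enc_inst y"
  obtain \<alpha> w k where x: "x = (\<alpha>, w, k)" by (cases x)
  obtain \<beta> v l where y: "y = (\<beta>, v, l)" by (cases y)
  have 1: "\<alpha> = \<beta>" and 2: "enc_list enc_nat w @ enc_nat k = enc_list enc_nat v @ enc_nat l"
    using eq enc_list_append_inject[of enc_symbol \<alpha> _ \<beta>] enc_symbol_append_inject
    unfolding x y by simp_all
  then have 3: "w = v" and 4: "enc_nat k = enc_nat l"
    using enc_list_append_inject[of enc_nat w _ v] enc_nat_append_inject by simp_all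
  from 4 have "k = l"
    using enc_nat_append_inject[of k "[]" l "[]"] by simp
  with 1 3 show "x = y" unfolding x y by simp
qed

text \<open>
  Tape symbols and states are the natural numbers below given bounds; symbol 0 is the blank, and
  1 and 2 are the input symbols for \<open>False\<close> and \<open>True\<close>. A tape is infinite in both directions and
  is given by its contents and its head position. The input is on the first tape, starting under
  the head; the other tapes are blank.
\<close>

datatype move = Move_Left | Stay | Move_Right

type_synonym tape = "(int \<Rightarrow> nat) \<times> int"
type_synonym config = "nat \<times> tape list"

record tm =
  num_tapes :: nat
  num_symbols :: nat
  num_states :: nat
  start_state :: nat
  accept_state :: nat
  reject_state :: nat
  transition :: "nat \<Rightarrow> nat list \<Rightarrow> nat \<times> (nat \<times> move) list"

definition wf_tm :: "tm \<Rightarrow> bool" where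
  "wf_tm M \<longleftrightarrow>
     num_tapes M \<ge> 1 \<and> num_symbols M \<ge> 3 \<and>
     start_state M < num_states M \<and> accept_state M < num_states M \<and>
     reject_state M < num_states M \<and> accept_state M \<noteq> reject_state M \<and>
     (\<forall>q < num_states M. \<forall>xs. length xs = num_tapes M \<and> set xs \<subseteq> {..<num_symbols M} \<longrightarrow>
        (case transition M q xs of (q', acts) \<Rightarrow>
           q' < num_states M \<and> length acts = num_tapes M \<and>
           fst ` set acts \<subseteq> {..<num_symbols M}))"

fun head_shift :: "move \<Rightarrow> int" where
  "head_shift Move_Left = -1"
| "head_shift Stay = 0"
| "head_shift Move_Right = 1"

fun read_tape :: "tape \<Rightarrow> nat" where
  "read_tape (c, p) = c p"

fun act_tape :: "tape \<Rightarrow> nat \<times> move \<Rightarrow> tape" where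
  "act_tape (c, p) (x, m) = (c(p := x), p + head_shift m)"

text \<open>The machine halts in its accepting and rejecting states, which are fixed by a step.\<close>

fun tm_step :: "tm \<Rightarrow> config \<Rightarrow> config" where
  "tm_step M (q, ts) =
     (if q = accept_state M \<or> q = reject_state M then (q, ts)
      else case transition M q (map read_tape ts) of
        (q', acts) \<Rightarrow> (q', map2 act_tape ts acts))"

definition blank_tape :: tape where
  "blank_tape = (\<lambda>_. 0, 0)"

definition input_tape :: "bool list \<Rightarrow> tape" where
  "input_tape x =
     (\<lambda>i. if 0 \<le> i \<and> i < int (length x) then (if x ! nat i then 2 else 1) else 0, 0)"

definition init_config :: "tm \<Rightarrow> bool list \<Rightarrow> config" where
  "init_config M x = (start_state M, input_tape x # replicate (num_tapes M - 1) blank_tape)"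

definition decides_in_time :: "tm \<Rightarrow> bool list set \<Rightarrow> (nat \<Rightarrow> nat) \<Rightarrow> bool" where
  "decides_in_time M L T \<longleftrightarrow>
     (\<forall>x. fst ((tm_step M ^^ T (length x)) (init_config M x)) =
        (if x \<in> L then accept_state M else reject_state M))"

definition class_P :: "bool list set set" where
  "class_P = {L. \<exists>M c d. wf_tm M \<and> decides_in_time M L (\<lambda>n. c * n ^ d + c)}"

end

theory Submission
  imports Defs
begin

text \<open>
  Call \<open>u\<close> and \<open>v\<close> in agreement for the letter \<open>a\<close> up to depth \<open>r\<close> if they have the same
  subsequences of length at most \<open>r\<close> that start with \<open>a\<close>. Whether \<open>u \<sim>\<^sub>k w\<close> can be tested by reading
  \<open>u\<close> from left to right with one constraint per letter \<open>a\<close>, namely that the unread part of \<open>u\<close>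
  agrees for \<open>a\<close> up to depth \<open>r\<^sub>a\<close> with the suffix of \<open>w\<close> at position \<open>j\<^sub>a\<close>; at the beginning,
  \<open>j\<^sub>a = 0\<close> and \<open>r\<^sub>a = k\<close>. Reading \<open>b\<close> replaces the constraint of \<open>b\<close> by constraints of depth
  \<open>r\<^sub>b - 1\<close> at the position \<open>j\<close> behind the next \<open>b\<close> of \<open>w\<close>, for all letters. Since agreement is
  transitive, of the two constraints that a letter now has, the deeper one implies the other one as soon
  as the two suffixes of \<open>w\<close> agree up to the smaller depth. As there are finitely many
  letters, the constraints take polynomially many values. For the strict problem, a subsequence that
  separates \<open>u\<close> from \<open>w\<close> is guessed along the way, which takes one more pair. A regular pattern
  denotes a regular language, so a match exists iff an accepting configuration is reachable while the
  pattern is traversed.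

  Reachability, agreement of suffixes of \<open>w\<close>, and the decoding of the input are the least fixed
  point of a system of positive first-order formulas over the positions of the input. Such a fixed point
  is computed in polynomial time by nested loops over all tuples of positions, the relations being
  stored in tables. A pointer is a head on a copy of the input.
\<close>

section \<open>Structured programs for Turing machines\<close>

text \<open>There are too many subsequences of length at most k to list them, but
  \<open>a # y\<close> embeds into \<open>u\<close> iff \<open>y\<close> embeds behind the first
  \<open>a\<close> of \<open>u\<close>. So reading a letter uses up only the constraint of that
  letter. The test that lets one constraint replace another compares two suffixes of
  \<open>w\<close> and does not mention \<open>u\<close>. It is also necessary: if the rest of
  \<open>u\<close> satisfies both constraints, it mediates between the two suffixes, so dropping one
  constraint loses no match. Since every variable occurs once, nothing has to be remembered about a
  variable that has been left. The tuples have 2 \<sigma> + 3 entries, an exponent that is constant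
  only because \<sigma> is. The languages consist of encoded instances, so malformed input and
  patterns with a repeated variable must be rejected, too. Without negation, the absence of a
  letter, the difference of two numerals and the failure of agreement all need descriptions of their
  own. That k is written in binary is harmless, as k \<le> |w| makes it a position of the
  input.\<close>

datatype instr =
    Do "(nat \<Rightarrow> nat) \<Rightarrow> nat \<Rightarrow> nat \<times> move" nat
  | Branch "(nat \<Rightarrow> nat) \<Rightarrow> bool" nat nat

definition reads :: "nat \<Rightarrow> (nat \<Rightarrow> tape) \<Rightarrow> nat \<Rightarrow> nat" where
  "reads K s = (\<lambda>i. if i < K then read_tape (s i) else 0)"

text \<open>Instruction addresses serve as states; the two addresses behind the code accept and
  reject. The fourth tape symbol, 3, is reserved for the left end marker. The case outside the code
  only has to be well-formed, because the machine halts there.\<close>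

definition machine :: "nat \<Rightarrow> instr list \<Rightarrow> tm" where
  "machine K code = \<lparr>num_tapes = K, num_symbols = 4, num_states = length code + 2,
     start_state = 0, accept_state = length code, reject_state = length code + 1,
     transition = (\<lambda>q xs. let rs = (\<lambda>i. if i < K then xs ! i else 0) in
       if q < length code then
         case code ! q of
           Do f q' \<Rightarrow> (q', map (f rs) [0..<K])
         | Branch b p p' \<Rightarrow> (if b rs then p else p', map (\<lambda>x. (x, Stay)) xs)
       else (0, map (\<lambda>x. (x, Stay)) xs))\<rparr>"

lemma machine_simps:
  "num_tapes (machine K code) = K" "num_symbols (machine K code) = 4"
  "num_states (machine K code) = length code + 2" "start_state (machine K code) = 0"
  "accept_state (machine K code) = length code" "reject_state (machine K code) = length code + 1"
  by (simp_all add: machine_def)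

fun wf_instr :: "nat \<Rightarrow> instr \<Rightarrow> bool" where
  "wf_instr n (Do f q) \<longleftrightarrow> q < n \<and> (\<forall>rs. (\<forall>i. rs i < 4) \<longrightarrow> (\<forall>i. fst (f rs i) < 4))"
| "wf_instr n (Branch b p q) \<longleftrightarrow> p < n \<and> q < n"

lemma wf_machine:
  assumes "K > 0" and "\<And>i. i \<in> set code \<Longrightarrow> wf_instr (length code + 2) i"
  shows "wf_tm (machine K code)"
proof -
  have "q' < length code + 2 \<and> length acts = K \<and> fst ` set acts \<subseteq> {..<4}"
    if len: "length xs = K" and xs: "set xs \<subseteq> {..<4}" and q: "q < length code + 2"
      and tr: "transition (machine K code) q xs = (q', acts)" for q xs q' acts
  proof (cases "q < length code")
    case False
    then show ?thesis using tr xs len by (auto simp: machine_def Let_def)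
  next
    case True
    let ?rs = "\<lambda>i. if i < K then xs ! i else 0"
    have rs: "\<forall>i. ?rs i < 4"
      using xs len nth_mem by fastforce
    have wf: "wf_instr (length code + 2) (code ! q)"
      using True assms(2) by simp
    show ?thesis
    proof (cases "code ! q")
      case (Do f p)
      have "fst (f ?rs i) < 4" for i using wf rs Do by simp
      then have "fst ` set (map (f ?rs) [0..<K]) \<subseteq> {..<4}" by auto
      moreover have "q' = p" "acts = map (f ?rs) [0..<K]"
        using tr Do True by (simp_all add: machine_def Let_def)
      ultimately show ?thesis using wf Do by simp
    next
      case (Branch b p p')
      then show ?thesis using tr wf xs len True by (auto simp: machine_def Let_def)
    qed
  qed
  then have "case transition (machine K code) q xs of (q', acts) \<Rightarrow>
      q' < length code + 2 \<and> length acts = K \<and> fst ` set acts \<subseteq> {..<4}"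
    if "length xs = K" "set xs \<subseteq> {..<4}" "q < length code + 2" for q xs
    using that by (cases "transition (machine K code) q xs") simp
  then show ?thesis
    using assms(1) unfolding wf_tm_def machine_simps by simp
qed

lemma act_tape_stay [simp]: "act_tape t (read_tape t, Stay) = t"
  by (cases t) simp

lemma step_machine:
  assumes "q < length code"
  shows "tm_step (machine K code) (q, map s [0..<K]) =
    (case code ! q of
       Do f q' \<Rightarrow> (q', map (\<lambda>i. act_tape (s i) (f (reads K s) i)) [0..<K])
     | Branch b p p' \<Rightarrow> (if b (reads K s) then p else p', map s [0..<K]))"
proof -
  have rs: "(\<lambda>i. if i < K then map (\<lambda>j. read_tape (s j)) [0..<K] ! i else 0) = reads K s"
    unfolding reads_def by (rule ext) simp
  have eq: "map2 act_tape (map s [0..<K]) (map (\<lambda>i. g i) [0..<K]) =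
      map (\<lambda>i. act_tape (s i) (g i)) [0..<K]" for g
    by (rule nth_equalityI) simp_all
  show ?thesis
    using assms rs eq[of "\<lambda>i. (read_tape (s i), Stay)"]
    by (auto simp: machine_def Let_def o_def eq split: instr.split)
qed

lemma halted:
  assumes "q = accept_state M \<or> q = reject_state M"
  shows "(tm_step M ^^ n) (q, ts) = (q, ts)"
  using assms by (induction n) (auto simp: tm_step.simps)

declare tm_step.simps [simp del]

text \<open>Halting states are fixed by a step, so a run that halts early still shows its verdict at
  the exact time \<open>T (length x)\<close>.\<close>

lemma decides_in_timeI:
  assumes "\<And>x. \<exists>n ts. n \<le> T (length x) \<and>
    (tm_step M ^^ n) (init_config M x) = (if x \<in> L then accept_state M else reject_state M, ts)"
  shows "decides_in_time M L T"
  unfolding decides_in_time_def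
proof
  fix x
  obtain n ts where n: "n \<le> T (length x)"
    and *: "(tm_step M ^^ n) (init_config M x) =
      (if x \<in> L then accept_state M else reject_state M, ts)"
    using assms by blast
  have "(tm_step M ^^ T (length x)) (init_config M x) =
      (tm_step M ^^ (T (length x) - n)) ((tm_step M ^^ n) (init_config M x))"
    using n by (metis comp_apply funpow_add le_add_diff_inverse2)
  also have "\<dots> = (if x \<in> L then accept_state M else reject_state M, ts)"
    unfolding * by (rule halted) auto
  finally show "fst ((tm_step M ^^ T (length x)) (init_config M x)) =
      (if x \<in> L then accept_state M else reject_state M)" by simp
qed

section \<open>A while language on one-sided tapes\<close>

datatype prog =
    Skip
  | Right nat
  | Left nat
  | Mark nat
  | Seq prog prog
  | Cond nat nat "nat \<Rightarrow> nat \<Rightarrow> bool" prog prog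
  | While nat nat "nat \<Rightarrow> nat \<Rightarrow> bool" prog

text \<open>
  The state of a program consists of the contents and the head positions of tapes that are
  infinite to the right only. Cell 0 carries the marker 3, which no program can leave to the left or
  overwrite.
\<close>

type_synonym state = "(nat \<Rightarrow> nat \<Rightarrow> nat) \<times> (nat \<Rightarrow> nat)"

text \<open>Times are exact numbers of machine steps of the compiled code. A then-branch pays for
  the test and the jump over the else-branch, an else-branch for the test alone, and a loop round
  for the test and the jump back.\<close>

inductive exec :: "prog \<Rightarrow> state \<Rightarrow> nat \<Rightarrow> state \<Rightarrow> bool" where
  Skip: "exec Skip s 0 s"
| Right: "exec (Right i) (c, p) 1 (c, p(i := Suc (p i)))"
| Left: "exec (Left i) (c, p) 1 (c, if c i (p i) = 3 then p else p(i := p i - 1))"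
| Mark: "exec (Mark i) (c, p) 1 (if c i (p i) = 3 then c else c(i := (c i)(p i := 1)), p)"
| Seq: "exec c1 s t s' \<Longrightarrow> exec c2 s' t' s'' \<Longrightarrow> exec (Seq c1 c2) s (t + t') s''"
| CondT: "b (c i (p i)) (c j (p j)) \<Longrightarrow> exec c1 (c, p) t s' \<Longrightarrow> exec (Cond i j b c1 c2) (c, p) (t + 2) s'"
| CondF: "\<not> b (c i (p i)) (c j (p j)) \<Longrightarrow> exec c2 (c, p) t s' \<Longrightarrow> exec (Cond i j b c1 c2) (c, p) (t + 1) s'"
| WhileF: "\<not> b (c i (p i)) (c j (p j)) \<Longrightarrow> exec (While i j b c1) (c, p) 1 (c, p)"
| WhileT: "b (c i (p i)) (c j (p j)) \<Longrightarrow> exec c1 (c, p) t s' \<Longrightarrow> exec (While i j b c1) s' t' s'' \<Longrightarrow>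
    exec (While i j b c1) (c, p) (t + t' + 2) s''"

fun wf_prog :: "nat \<Rightarrow> prog \<Rightarrow> bool" where
  "wf_prog K Skip \<longleftrightarrow> True"
| "wf_prog K (Right i) \<longleftrightarrow> i < K"
| "wf_prog K (Left i) \<longleftrightarrow> i < K"
| "wf_prog K (Mark i) \<longleftrightarrow> i < K"
| "wf_prog K (Seq c1 c2) \<longleftrightarrow> wf_prog K c1 \<and> wf_prog K c2"
| "wf_prog K (Cond i j b c1 c2) \<longleftrightarrow> i < K \<and> j < K \<and> wf_prog K c1 \<and> wf_prog K c2"
| "wf_prog K (While i j b c) \<longleftrightarrow> i < K \<and> j < K \<and> wf_prog K c"

section \<open>Compilation into machine code\<close>

fun psize :: "prog \<Rightarrow> nat" where
  "psize Skip = 0"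
| "psize (Right i) = 1"
| "psize (Left i) = 1"
| "psize (Mark i) = 1"
| "psize (Seq c1 c2) = psize c1 + psize c2"
| "psize (Cond i j b c1 c2) = psize c1 + psize c2 + 2"
| "psize (While i j b c) = psize c + 2"

text \<open>Addresses are absolute: the code starts at \<open>a\<close>, and control leaves it at
  \<open>a + psize c\<close>. A \<open>Branch\<close> with a constant condition is an unconditional
  jump.\<close>

fun compile :: "nat \<Rightarrow> prog \<Rightarrow> instr list" where
  "compile a Skip = []"
| "compile a (Right i) =
    [Do (\<lambda>rs j. (rs j, if j = i then Move_Right else Stay)) (a + 1)]"
| "compile a (Left i) =
    [Do (\<lambda>rs j. (rs j, if j = i \<and> rs i \<noteq> 3 then Move_Left else Stay)) (a + 1)]"
| "compile a (Mark i) =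
    [Do (\<lambda>rs j. (if j = i \<and> rs i \<noteq> 3 then 1 else rs j, Stay)) (a + 1)]"
| "compile a (Seq c1 c2) = compile a c1 @ compile (a + psize c1) c2"
| "compile a (Cond i j b c1 c2) =
    Branch (\<lambda>rs. b (rs i) (rs j)) (a + 1) (a + 2 + psize c1) # compile (a + 1) c1 @
    Branch (\<lambda>_. True) (a + 2 + psize c1 + psize c2) 0 # compile (a + 2 + psize c1) c2"
| "compile a (While i j b c) =
    Branch (\<lambda>rs. b (rs i) (rs j)) (a + 1) (a + 2 + psize c) # compile (a + 1) c @
    [Branch (\<lambda>_. True) a 0]"

lemma length_compile [simp]: "length (compile a c) = psize c"
  by (induction c arbitrary: a) simp_all

lemma wf_compile:
  "i \<in> set (compile a c) \<Longrightarrow> wf_prog K c \<Longrightarrow> a + psize c < n \<Longrightarrow> wf_instr n i"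
proof (induction c arbitrary: a)
  case (Seq c1 c2)
  then show ?case using Seq.IH(1)[of a] Seq.IH(2)[of "a + psize c1"] by auto
next
  case (Cond i j b c1 c2)
  then show ?case using Cond.IH(1)[of "a + 1"] Cond.IH(2)[of "a + 2 + psize c1"] by auto
next
  case (While i j b c)
  then show ?case using While.IH[of "a + 1"] by auto
qed auto

text \<open>Cell \<open>v\<close> lies at tape position \<open>v - 1\<close>: the machine finds its
  input at position 0, so the marker goes to position -1.\<close>

definition conc :: "state \<Rightarrow> nat \<Rightarrow> tape" where
  "conc s i = (\<lambda>z. if z < -1 then 0 else fst s i (nat (z + 1)), int (snd s i) - 1)"

lemma reads_conc: "i < K \<Longrightarrow> reads K (conc (c, p)) i = c i (p i)"
  by (simp add: reads_def conc_def)

lemma conc_right: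
  "i < K \<Longrightarrow> map (\<lambda>j. act_tape (conc (c, p) j)
      (reads K (conc (c, p)) j, if j = i then Move_Right else Stay)) [0..<K] =
    map (conc (c, p(i := Suc (p i)))) [0..<K]"
  by (auto simp: reads_conc) (auto simp: conc_def fun_eq_iff)

lemma conc_left:
  assumes "c i 0 = 3" "i < K"
  shows "map (\<lambda>j. act_tape (conc (c, p) j)
      (reads K (conc (c, p)) j, if j = i \<and> reads K (conc (c, p)) i \<noteq> 3 then Move_Left else Stay)) [0..<K] =
    map (conc (c, if c i (p i) = 3 then p else p(i := p i - 1))) [0..<K]"
proof -
  \<comment> \<open>The marker keeps the head from leaving cell 0, where the subtraction on naturals
    and the move to the left would differ.\<close>
  have "p i > 0" if "c i (p i) \<noteq> 3" using that assms(1) by (cases "p i") auto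
  then show ?thesis
    using assms(2) by (auto simp: reads_conc) (auto simp: conc_def fun_eq_iff)
qed

lemma conc_mark:
  assumes "i < K"
  shows "map (\<lambda>j. act_tape (conc (c, p) j)
      (if j = i \<and> reads K (conc (c, p)) i \<noteq> 3 then 1 else reads K (conc (c, p)) j, Stay)) [0..<K] =
    map (conc (if c i (p i) = 3 then c else c(i := (c i)(p i := 1)), p)) [0..<K]"
  using assms by (auto simp: reads_conc) (auto simp: conc_def fun_eq_iff)

definition marked :: "state \<Rightarrow> bool" where
  "marked s \<longleftrightarrow> (\<forall>i. fst s i 0 = 3)"

lemma exec_marked: "exec c s t s' \<Longrightarrow> marked s \<Longrightarrow> marked s'"
proof (induction rule: exec.induct)
  case (Mark i c p)
  then show ?case by (auto simp: marked_def)
qed (auto simp: marked_def)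

lemma funpow_steps:
  "(f ^^ m) x = y \<Longrightarrow> (f ^^ n) y = z \<Longrightarrow> (f ^^ (m + n)) x = z"
  by (metis add.commute comp_apply funpow_add)

text \<open>By induction on the run rather than on the program, because of loops. The surrounding
  code is arbitrary, so that the hypothesis applies to parts of the program at their own
  addresses.\<close>

lemma compile_correct:
  assumes "exec c s t s'" "marked s" "wf_prog K c" "code = pre @ compile (length pre) c @ post"
  shows "(tm_step (machine K code) ^^ t) (length pre, map (conc s) [0..<K]) =
    (length pre + psize c, map (conc s') [0..<K])"
  using assms
proof (induction arbitrary: pre post rule: exec.induct)
  case (Skip s)
  then show ?case by simp
next
  case (Right i c p)
  then show ?case
    using step_machine[of "length pre" code K "conc (c, p)"] conc_right[of i K c p]
    by (simp add: nth_append)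
next
  case (Left i c p)
  then show ?case
    using step_machine[of "length pre" code K "conc (c, p)"] conc_left[of c i K p]
    by (simp add: nth_append marked_def)
next
  case (Mark i c p)
  then show ?case
    using step_machine[of "length pre" code K "conc (c, p)"] conc_mark[of i K c p]
    by (simp add: nth_append)
next
  case (Seq c1 s t s' c2 t' s'')
  have 1: "(tm_step (machine K code) ^^ t) (length pre, map (conc s) [0..<K]) =
      (length pre + psize c1, map (conc s') [0..<K])"
    using Seq.prems by (intro Seq.IH(1)[where post = "compile (length pre + psize c1) c2 @ post"]) auto
  have 2: "(tm_step (machine K code) ^^ t') (length (pre @ compile (length pre) c1), map (conc s') [0..<K]) =
      (length (pre @ compile (length pre) c1) + psize c2, map (conc s'') [0..<K])"
    using Seq.prems exec_marked[OF Seq.hyps(1)] by (intro Seq.IH(2)[where post = post]) auto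
  show ?case using funpow_steps[OF 1] 2 by (simp add: add.assoc)
next
  case (CondT b c i p j c1 t s' c2)
  have 0: "(tm_step (machine K code) ^^ 1) (length pre, map (conc (c, p)) [0..<K]) =
      (length pre + 1, map (conc (c, p)) [0..<K])"
    using CondT step_machine[of "length pre" code K "conc (c, p)"]
    by (simp add: nth_append reads_conc)
  let ?pre = "pre @ [Branch (\<lambda>rs. b (rs i) (rs j)) (length pre + 1) (length pre + 2 + psize c1)]"
  have 1: "(tm_step (machine K code) ^^ t) (length ?pre, map (conc (c, p)) [0..<K]) =
      (length ?pre + psize c1, map (conc s') [0..<K])"
    using CondT.prems by (intro CondT.IH[where post = "Branch (\<lambda>_. True) (length pre + 2 + psize c1 + psize c2) 0 #
       compile (length pre + 2 + psize c1) c2 @ post"]) auto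
  have 2: "(tm_step (machine K code) ^^ 1) (length pre + 1 + psize c1, map (conc s') [0..<K]) =
      (length pre + 2 + psize c1 + psize c2, map (conc s') [0..<K])"
    using CondT step_machine[of "length pre + 1 + psize c1" code K "conc s'"]
    by (simp add: nth_append)
  have "(tm_step (machine K code) ^^ (1 + (t + 1))) (length pre, map (conc (c, p)) [0..<K]) =
      (length pre + 2 + psize c1 + psize c2, map (conc s') [0..<K])"
    using 0 1 2 by (intro funpow_steps[OF 0] funpow_steps[of t]) (auto simp: add.assoc)
  then show ?case by (simp add: add_ac)
next
  case (CondF b c i p j c2 t s' c1)
  have 0: "(tm_step (machine K code) ^^ 1) (length pre, map (conc (c, p)) [0..<K]) =
      (length pre + 2 + psize c1, map (conc (c, p)) [0..<K])"
    using CondF step_machine[of "length pre" code K "conc (c, p)"]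
    by (simp add: nth_append reads_conc)
  let ?pre = "pre @ Branch (\<lambda>rs. b (rs i) (rs j)) (length pre + 1) (length pre + 2 + psize c1) #
      compile (length pre + 1) c1 @ [Branch (\<lambda>_. True) (length pre + 2 + psize c1 + psize c2) 0]"
  have 1: "(tm_step (machine K code) ^^ t) (length ?pre, map (conc (c, p)) [0..<K]) =
      (length ?pre + psize c2, map (conc s') [0..<K])"
    using CondF.prems by (intro CondF.IH[where post = post]) auto
  have "(tm_step (machine K code) ^^ (1 + t)) (length pre, map (conc (c, p)) [0..<K]) =
      (length ?pre + psize c2, map (conc s') [0..<K])"
    using 1 by (intro funpow_steps[OF 0]) (auto simp: add.assoc)
  then show ?case by (simp add: add_ac)
next
  case (WhileF b c i p j c1)
  then show ?case
    using step_machine[of "length pre" code K "conc (c, p)"]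
    by (simp add: nth_append reads_conc add_ac)
next
  case (WhileT b c i p j c1 t s' t' s'')
  have 0: "(tm_step (machine K code) ^^ 1) (length pre, map (conc (c, p)) [0..<K]) =
      (length pre + 1, map (conc (c, p)) [0..<K])"
    using WhileT step_machine[of "length pre" code K "conc (c, p)"]
    by (simp add: nth_append reads_conc)
  let ?pre = "pre @ [Branch (\<lambda>rs. b (rs i) (rs j)) (length pre + 1) (length pre + 2 + psize c1)]"
  have 1: "(tm_step (machine K code) ^^ t) (length ?pre, map (conc (c, p)) [0..<K]) =
      (length ?pre + psize c1, map (conc s') [0..<K])"
    using WhileT.prems by (intro WhileT.IH(1)[where post = "Branch (\<lambda>_. True) (length pre) 0 # post"]) auto
  \<comment> \<open>The jump returns to the test, where the rest of the run starts over with the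
    same code.\<close>
  have 2: "(tm_step (machine K code) ^^ 1) (length pre + 1 + psize c1, map (conc s') [0..<K]) =
      (length pre, map (conc s') [0..<K])"
    using WhileT step_machine[of "length pre + 1 + psize c1" code K "conc s'"]
    by (simp add: nth_append)
  have 3: "(tm_step (machine K code) ^^ t') (length pre, map (conc s') [0..<K]) =
      (length pre + psize (While i j b c1), map (conc s'') [0..<K])"
    using WhileT.prems exec_marked[OF WhileT.hyps(2)] by (intro WhileT.IH(2)[where post = post]) auto
  have "(tm_step (machine K code) ^^ (1 + (t + (1 + t')))) (length pre, map (conc (c, p)) [0..<K]) =
      (length pre + psize (While i j b c1), map (conc s'') [0..<K])"
    using 0 1 2 3 by (intro funpow_steps[OF 0] funpow_steps[of t] funpow_steps[of 1]) (auto simp: add.assoc)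
  then show ?case by (simp add: add_ac)
qed

section \<open>Preparing the tapes and deciding a language\<close>

definition cell :: "bool list \<Rightarrow> nat \<Rightarrow> nat" where
  "cell x v = (if v = 0 then 3 else if v \<le> length x then (if x ! (v - 1) then 2 else 1) else 0)"

definition init_state :: "(nat \<Rightarrow> bool) \<Rightarrow> bool list \<Rightarrow> state" where
  "init_state tab x = (\<lambda>i v. if tab i \<and> v > 0 then 0 else cell x v, \<lambda>_. 0)"

text \<open>Instructions 0 and 1 put the marker to the left of the input on every tape, 2 and 3 copy
  the input from tape 0 to the pointer tapes, 4 and 5 return to the marker. All heads move together,
  so tape 0 alone controls both loops.\<close>

definition preamble :: "(nat \<Rightarrow> bool) \<Rightarrow> instr list" where
  "preamble tab =
    [Do (\<lambda>rs j. (rs j, Move_Left)) 1,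
     Do (\<lambda>_ _. (3, Move_Right)) 2,
     Branch (\<lambda>rs. rs 0 = 0) 4 3,
     Do (\<lambda>rs j. (if tab j then rs j else rs 0, Move_Right)) 2,
     Do (\<lambda>rs j. (rs j, Move_Left)) 5,
     Branch (\<lambda>rs. rs 0 = 3) 6 4]"

lemma preamble_correct:
  assumes "code = preamble tab @ post" "K > 0" "\<not> tab 0"
  shows "(tm_step (machine K code) ^^ (4 * length x + 5)) (init_config (machine K code) x) =
    (6, map (conc (init_state tab x)) [0..<K])"
proof -
  let ?M = "machine K code" and ?N = "length x"
  \<comment> \<open>Contents once \<open>v\<close> symbols have been copied; tape 0 carries the
    whole input from the start.\<close>
  define a :: "nat \<Rightarrow> nat \<Rightarrow> int \<Rightarrow> nat" where "a v i z =
    (if z < -1 then 0 else if z = -1 then 3 else if z < int v then if tab i then 0 else cell x (nat (z + 1))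
     else if i = 0 then cell x (nat (z + 1)) else 0)" for v i z
  have len: "length (preamble tab) = 6" by (simp add: preamble_def)
  have step: "tm_step ?M (q, map s [0..<K]) =
    (case preamble tab ! q of
       Do f q' \<Rightarrow> (q', map (\<lambda>i. act_tape (s i) (f (reads K s) i)) [0..<K])
     | Branch b p p' \<Rightarrow> (if b (reads K s) then p else p', map s [0..<K]))" if "q < 6" for q s
    using step_machine[of q code K s] that len by (simp add: assms(1) nth_append)
  have init: "init_config ?M x = (0, map (\<lambda>i. if i = 0 then input_tape x else blank_tape) [0..<K])"
    using assms(2) unfolding init_config_def
    by (auto simp: machine_def nth_Cons intro!: nth_equalityI split: nat.split)
  have "(tm_step ?M ^^ 2) (init_config ?M x) = (2, map (\<lambda>i. (a 0 i, 0)) [0..<K])"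
    unfolding init
    by (auto simp: numeral_2_eq_2 step preamble_def reads_def input_tape_def blank_tape_def a_def cell_def fun_eq_iff nat_add_distrib)
  moreover have "(tm_step ?M ^^ (2 * v)) (2, map (\<lambda>i. (a 0 i, 0)) [0..<K]) =
      (2, map (\<lambda>i. (a v i, int v)) [0..<K])" if "v \<le> ?N" for v
    using that
  proof (induction v)
    case 0
    then show ?case by simp
  next
    case (Suc v)
    have rd: "reads K (\<lambda>i. (a v i, int v)) i = (if i = 0 then cell x (Suc v) else 0)" if "i < K" for i
      using that by (simp add: reads_def a_def nat_add_distrib)
    have nz: "cell x (Suc v) \<noteq> 0" using Suc.prems by (simp add: cell_def)
    have "tm_step ?M (tm_step ?M (2, map (\<lambda>i. (a v i, int v)) [0..<K])) =
        (2, map (\<lambda>i. (a (Suc v) i, int (Suc v))) [0..<K])"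
      using assms(2,3) nz
      by (auto simp: step preamble_def rd) (auto simp: a_def fun_eq_iff nat_add_distrib)
    then show ?case using Suc by simp
  qed
  ultimately have 1: "(tm_step ?M ^^ (2 + 2 * ?N)) (init_config ?M x) =
      (2, map (\<lambda>i. (a ?N i, int ?N)) [0..<K])"
    by (intro funpow_steps[of 2]) auto
  have "tm_step ?M (2, map (\<lambda>i. (a ?N i, int ?N)) [0..<K]) = (4, map (\<lambda>i. (a ?N i, int ?N)) [0..<K])"
    using assms(2) by (simp add: step preamble_def reads_def a_def cell_def)
  then have 2: "(tm_step ?M ^^ (2 + 2 * ?N + 1)) (init_config ?M x) =
      (4, map (\<lambda>i. (a ?N i, int ?N)) [0..<K])"
    by (intro funpow_steps[OF 1]) auto
  have 3: "(tm_step ?M ^^ (2 * Suc v)) (4, map (\<lambda>i. (a ?N i, int v)) [0..<K]) =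
      (6, map (\<lambda>i. (a ?N i, -1)) [0..<K])" if "v \<le> ?N" for v
    using that
  proof (induction v)
    case 0
    have "tm_step ?M (tm_step ?M (4, map (\<lambda>i. (a ?N i, int 0)) [0..<K])) =
        (6, map (\<lambda>i. (a ?N i, -1)) [0..<K])"
      using assms(2) by (simp add: step preamble_def reads_def) (simp add: a_def)
    then show ?case by (simp add: numeral_2_eq_2)
  next
    case (Suc v)
    have "a ?N 0 (int v) \<noteq> 3" using assms(3) by (auto simp: a_def cell_def)
    then have "tm_step ?M (tm_step ?M (4, map (\<lambda>i. (a ?N i, int (Suc v))) [0..<K])) =
        (4, map (\<lambda>i. (a ?N i, int v)) [0..<K])"
      using assms(2) by (simp add: step preamble_def reads_def)
    then have "(tm_step ?M ^^ 2) (4, map (\<lambda>i. (a ?N i, int (Suc v))) [0..<K]) =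
        (4, map (\<lambda>i. (a ?N i, int v)) [0..<K])"
      by (simp add: numeral_2_eq_2)
    from funpow_steps[OF this Suc.IH] Suc.prems show ?case by simp
  qed
  have a: "(\<lambda>i. (a ?N i, -1)) = conc (init_state tab x)"
    using assms(3) by (auto simp: fun_eq_iff a_def conc_def init_state_def cell_def)
  have "2 + 2 * ?N + 1 + 2 * Suc ?N = 4 * ?N + 5" by simp
  with funpow_steps[OF 2 3[of ?N]] show ?thesis unfolding a by (simp only:)
qed

text \<open>\<open>class_P\<close> asks for the form \<open>c * n ^ d + c\<close>. For n > 0 it is
  reached by n + 2 \<le> 3 n, and the additive constant covers n = 0. The part
  \<open>4 * n + 6\<close> pays for the preamble and the final branch.\<close>

lemma poly_bound:
  fixes C n :: nat
  shows "4 * n + 6 + C * (n + 2) ^ C \<le> ((C + 6) * 3 ^ (C + 1)) * n ^ (C + 1) + (C + 6) * 3 ^ (C + 1)"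
proof -
  have "n + 2 \<le> (n + 2) ^ (C + 1)" by (rule self_le_power) auto
  moreover have "C * (n + 2) ^ C \<le> C * (n + 2) ^ (C + 1)"
    by (intro mult_le_mono2 power_increasing) auto
  ultimately have "4 * n + 6 + C * (n + 2) ^ C \<le> 6 * (n + 2) ^ (C + 1) + C * (n + 2) ^ (C + 1)"
    by linarith
  then have "4 * n + 6 + C * (n + 2) ^ C \<le> (C + 6) * (n + 2) ^ (C + 1)"
    by (simp only: add_mult_distrib add.commute)
  also have "(n + 2) ^ (C + 1) \<le> 3 ^ (C + 1) * n ^ (C + 1) + 3 ^ (C + 1)"
  proof (cases "n = 0")
    case True
    have "(0 + 2::nat) ^ (C + 1) \<le> 3 ^ (C + 1)" by (rule power_mono) auto
    then show ?thesis unfolding True by (rule trans_le_add2)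
  next
    case False
    have "(n + 2) ^ (C + 1) \<le> (3 * n) ^ (C + 1)" using False by (intro power_mono) auto
    then show ?thesis by (simp only: power_mult_distrib trans_le_add1)
  qed
  then have "(C + 6) * (n + 2) ^ (C + 1) \<le> (C + 6) * (3 ^ (C + 1) * n ^ (C + 1) + 3 ^ (C + 1))"
    by (rule mult_le_mono2)
  finally show ?thesis by (simp add: algebra_simps)
qed

text \<open>The program leaves its verdict as the symbol under head \<open>j\<close>, and a single
  branch turns it into a halting state.\<close>

theorem class_P_if_exec:
  assumes wf: "wf_prog K c" and j: "j < K" and tab: "\<not> tab 0"
    and ex: "\<And>x. \<exists>t s. t \<le> C * (length x + 2) ^ C \<and> exec c (init_state tab x) t s \<and>
      (fst s j (snd s j) = 1 \<longleftrightarrow> x \<in> L)"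
  shows "L \<in> class_P"
proof -
  \<comment> \<open>Six instructions of the preamble, the body and the final branch:
    \<open>E\<close> is the accepting state and \<open>E + 1\<close> the rejecting one.\<close>
  define E where "E = psize c + 7"
  define code where "code = preamble tab @ compile 6 c @ [Branch (\<lambda>rs. rs j = 1) E (E + 1)]"
  let ?M = "machine K code"
  have lenp: "length (preamble tab) = 6" by (simp add: preamble_def)
  have len: "length code = E" by (simp add: code_def E_def lenp)
  have wfM: "wf_tm ?M"
  proof (rule wf_machine)
    fix i assume "i \<in> set code"
    then show "wf_instr (length code + 2) i"
      unfolding len using wf_compile[OF _ wf, of i 6 "E + 2"]
      by (auto simp: code_def E_def preamble_def)
  qed (use j in simp)
  have "decides_in_time ?M L (\<lambda>n. ((C + 6) * 3 ^ (C + 1)) * n ^ (C + 1) + (C + 6) * 3 ^ (C + 1))"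
  proof (rule decides_in_timeI)
    fix x
    obtain t s where t: "t \<le> C * (length x + 2) ^ C" and e: "exec c (init_state tab x) t s"
      and acc: "fst s j (snd s j) = 1 \<longleftrightarrow> x \<in> L"
      using ex by blast
    have 1: "(tm_step ?M ^^ (4 * length x + 5)) (init_config ?M x) =
        (6, map (conc (init_state tab x)) [0..<K])"
      using j tab by (intro preamble_correct[OF code_def]) auto
    have "marked (init_state tab x)" by (auto simp: marked_def init_state_def cell_def)
    from compile_correct[OF e this wf, of code "preamble tab"]
    have 2: "(tm_step ?M ^^ t) (6, map (conc (init_state tab x)) [0..<K]) =
        (6 + psize c, map (conc s) [0..<K])"
      by (simp add: lenp code_def)
    have "reads K (conc s) j = fst s j (snd s j)" using reads_conc[OF j, of "fst s" "snd s"] by simp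
    then have 3: "(tm_step ?M ^^ 1) (6 + psize c, map (conc s) [0..<K]) =
        (if x \<in> L then E else E + 1, map (conc s) [0..<K])"
      using step_machine[of "6 + psize c" code K "conc s"] acc
      by (simp add: len E_def code_def nth_append lenp)
    have "(tm_step ?M ^^ (4 * length x + 5 + (t + 1))) (init_config ?M x) =
        (if x \<in> L then E else E + 1, map (conc s) [0..<K])"
      by (rule funpow_steps[OF 1 funpow_steps[OF 2 3]])
    moreover have "4 * length x + 5 + (t + 1) \<le>
        ((C + 6) * 3 ^ (C + 1)) * length x ^ (C + 1) + (C + 6) * 3 ^ (C + 1)"
      using poly_bound[of "length x" C] t by linarith
    ultimately show "\<exists>n ts. n \<le> ((C + 6) * 3 ^ (C + 1)) * length x ^ (C + 1) + (C + 6) * 3 ^ (C + 1) \<and>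
        (tm_step ?M ^^ n) (init_config ?M x) = (if x \<in> L then accept_state ?M else reject_state ?M, ts)"
      using len by (auto simp: machine_def)
  qed
  with wfM show ?thesis unfolding class_P_def by blast
qed

declare split_paired_Ex [simp del] split_paired_All [simp del]

lemma wf_prog_mono: "wf_prog K c \<Longrightarrow> K \<le> K' \<Longrightarrow> wf_prog K' c"
  by (induction c) auto

text \<open>Tapes are allocated by arithmetic on indices while programs are built. Their number is
  fixed only at the end; it depends on the program, not on the input.\<close>

lemma ex_wf_prog: "\<exists>K>k. wf_prog K c"
proof (induction c)
  case Skip
  then show ?case by auto
next
  case (Right i)
  have "wf_prog (Suc (max k i)) (Right i)" by simp
  then show ?case by (metis less_Suc_eq_le max.cobounded1)
next
  case (Left i)
  have "wf_prog (Suc (max k i)) (Left i)" by simp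
  then show ?case by (metis less_Suc_eq_le max.cobounded1)
next
  case (Mark i)
  have "wf_prog (Suc (max k i)) (Mark i)" by simp
  then show ?case by (metis less_Suc_eq_le max.cobounded1)
next
  case (Seq c1 c2)
  then obtain K1 K2 where "K1 > k" "wf_prog K1 c1" "wf_prog K2 c2" by blast
  then show ?case
    by (intro exI[of _ "max K1 K2"]) (auto intro: wf_prog_mono)
next
  case (Cond i j b c1 c2)
  then obtain K1 K2 where "K1 > k" "wf_prog K1 c1" "wf_prog K2 c2" by blast
  then show ?case
    by (intro exI[of _ "max (max K1 K2) (Suc (max i j))"]) (auto intro: wf_prog_mono)
next
  case (While i j b c)
  then obtain K1 where "K1 > k" "wf_prog K1 c" by blast
  then show ?case
    by (intro exI[of _ "max K1 (Suc (max i j))"]) (auto intro: wf_prog_mono)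
qed

section \<open>Programs with polynomial running time\<close>

definition runs :: "prog \<Rightarrow> state \<Rightarrow> nat \<Rightarrow> state \<Rightarrow> bool" where
  "runs c s T s' \<longleftrightarrow> (\<exists>t\<le>T. exec c s t s')"

lemma runs_mono: "runs c s T s' \<Longrightarrow> T \<le> T' \<Longrightarrow> runs c s T' s'"
  unfolding runs_def by (meson le_trans)

lemma runs_Skip: "runs Skip s T s"
  unfolding runs_def by (auto intro: exec.Skip)

lemma runs_Right: "runs (Right i) (c, p) 1 (c, p(i := Suc (p i)))"
  unfolding runs_def using exec.Right by blast

lemma runs_Left: "c i (p i) \<noteq> 3 \<Longrightarrow> runs (Left i) (c, p) 1 (c, p(i := p i - 1))"
  unfolding runs_def using exec.Left[of i c p] by auto

lemma runs_Mark: "c i (p i) \<noteq> 3 \<Longrightarrow> runs (Mark i) (c, p) 1 (c(i := (c i)(p i := 1)), p)"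
  unfolding runs_def using exec.Mark[of i c p] by auto

lemma runs_Seq: "runs c1 s a s' \<Longrightarrow> runs c2 s' b s'' \<Longrightarrow> runs (Seq c1 c2) s (a + b) s''"
  unfolding runs_def by (meson exec.Seq add_mono)

definition test :: "nat \<Rightarrow> nat \<Rightarrow> (nat \<Rightarrow> nat \<Rightarrow> bool) \<Rightarrow> state \<Rightarrow> bool" where
  "test i j b s \<longleftrightarrow> b (fst s i (snd s i)) (fst s j (snd s j))"

lemma test_Pair [simp]: "test i j b (c, p) \<longleftrightarrow> b (c i (p i)) (c j (p j))"
  by (simp add: test_def)

lemma runs_Cond:
  "(test i j b s \<Longrightarrow> runs c1 s T s') \<Longrightarrow> (\<not> test i j b s \<Longrightarrow> runs c2 s T s') \<Longrightarrow>
    runs (Cond i j b c1 c2) s (T + 2) s'"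
proof (cases s)
  case (Pair d p)
  assume *: "test i j b s \<Longrightarrow> runs c1 s T s'" "\<not> test i j b s \<Longrightarrow> runs c2 s T s'"
  show ?thesis
  proof (cases "test i j b s")
    case True
    then obtain t where "t \<le> T" "exec c1 s t s'" using * unfolding runs_def by blast
    then have "exec (Cond i j b c1 c2) s (t + 2) s'" "t + 2 \<le> T + 2"
      using True Pair by (auto intro: exec.CondT simp del: add_2_eq_Suc')
    then show ?thesis unfolding runs_def by blast
  next
    case False
    then obtain t where "t \<le> T" "exec c2 s t s'" using * unfolding runs_def by blast
    then have "exec (Cond i j b c1 c2) s (t + 1) s'" "t + 1 \<le> T + 2"
      using False Pair exec.CondF[of b d i p j c2 t s' c1] by auto
    then show ?thesis unfolding runs_def by blast
  qed
qed

text \<open>The invariant prescribes the number of rounds, so termination needs no argument of its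
  own. The 2 pays for the test and the jump of a round, the last 1 for the failing test.\<close>

lemma runs_While:
  assumes "J 0 s"
    and step: "\<And>k s. k < n \<Longrightarrow> J k s \<Longrightarrow> test i j b s \<and> (\<exists>s'. runs c s T s' \<and> J (Suc k) s')"
    and stop: "\<And>s. J n s \<Longrightarrow> \<not> test i j b s"
  shows "\<exists>s'. runs (While i j b c) s (n * (T + 2) + 1) s' \<and> J n s'"
proof -
  have "\<exists>s'. runs (While i j b c) s (m * (T + 2) + 1) s' \<and> J n s'" if "J (n - m) s" "m \<le> n" for m s
    using that
  proof (induction m arbitrary: s)
    case 0
    then have "\<not> test i j b s" using stop by simp
    then have "exec (While i j b c) s 1 s"
      using exec.WhileF[of b "fst s" i "snd s" j c] by (simp add: test_def)
    then have "runs (While i j b c) s (0 * (T + 2) + 1) s" unfolding runs_def by auto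
    moreover have "J n s" using 0 by simp
    ultimately show ?case by blast
  next
    case (Suc m)
    then obtain s1 where b: "test i j b s" and r1: "runs c s T s1" and "J (Suc (n - Suc m)) s1"
      using step[of "n - Suc m" s] by auto
    then have "J (n - m) s1" using Suc.prems by (simp add: Suc_diff_Suc)
    from Suc.IH[OF this] Suc.prems obtain s2
      where r2: "runs (While i j b c) s1 (m * (T + 2) + 1) s2" and J: "J n s2" by auto
    from r1 r2 obtain t1 t2 where t: "t1 \<le> T" "exec c s t1 s1" "t2 \<le> m * (T + 2) + 1"
        "exec (While i j b c) s1 t2 s2"
      unfolding runs_def by auto
    then have "exec (While i j b c) s (t1 + t2 + 2) s2"
      using b exec.WhileT[of b "fst s" i "snd s" j c t1 s1 t2 s2] by (simp add: test_def)
    moreover have "t1 + t2 + 2 \<le> Suc m * (T + 2) + 1" using t by simp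
    ultimately show ?case using J unfolding runs_def by blast
  qed
  from this[of n s] assms(1) show ?thesis by simp
qed

lemma runs_While_det:
  assumes "\<And>k. k < n \<Longrightarrow> test i j b (st k) \<and> runs c (st k) T (st (Suc k))" "\<not> test i j b (st n)"
  shows "runs (While i j b c) (st 0) (n * (T + 2) + 1) (st n)"
  using runs_While[of "\<lambda>k s. s = st k" "st 0" n i j b c T] assms by blast

section \<open>Polynomial bounds and total correctness\<close>

definition poly_bounded :: "(nat \<Rightarrow> nat) \<Rightarrow> bool" where
  "poly_bounded T \<longleftrightarrow> (\<exists>C. \<forall>n. T n \<le> C * (n + 2) ^ C)"

text \<open>The base n + 2 exceeds 1 even for n = 0, so powers grow with the exponent and a single
  constant can serve as factor and exponent.\<close>

lemma poly_boundedI: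
  assumes "\<And>n. T n \<le> C * (n + 2) ^ d"
  shows "poly_bounded T"
  unfolding poly_bounded_def
proof (intro exI allI)
  fix n
  have "T n \<le> C * (n + 2) ^ d" by fact
  also have "\<dots> \<le> (C + d) * (n + 2) ^ (C + d)"
    by (intro mult_le_mono power_increasing) auto
  finally show "T n \<le> (C + d) * (n + 2) ^ (C + d)" .
qed

lemma poly_bounded_const: "poly_bounded (\<lambda>_. k)"
  by (rule poly_boundedI[of _ k 0]) simp

lemma poly_bounded_linear: "poly_bounded (\<lambda>n. n + k)"
  by (rule poly_boundedI[of _ "k + 1" 1]) simp

lemma poly_bounded_add:
  assumes "poly_bounded S" "poly_bounded T"
  shows "poly_bounded (\<lambda>n. S n + T n)"
proof -
  obtain C D where C: "\<And>n. S n \<le> C * (n + 2) ^ C" and D: "\<And>n. T n \<le> D * (n + 2) ^ D"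
    using assms unfolding poly_bounded_def by blast
  show ?thesis
  proof (rule poly_boundedI)
    fix n
    have "C * (n + 2) ^ C \<le> C * (n + 2) ^ (C + D)" "D * (n + 2) ^ D \<le> D * (n + 2) ^ (C + D)"
      by (intro mult_le_mono2 power_increasing; simp)+
    then show "S n + T n \<le> (C + D) * (n + 2) ^ (C + D)"
      using C[of n] D[of n] unfolding add_mult_distrib by linarith
  qed
qed

lemma poly_bounded_mult:
  assumes "poly_bounded S" "poly_bounded T"
  shows "poly_bounded (\<lambda>n. S n * T n)"
proof -
  obtain C D where C: "\<And>n. S n \<le> C * (n + 2) ^ C" and D: "\<And>n. T n \<le> D * (n + 2) ^ D"
    using assms unfolding poly_bounded_def by blast
  show ?thesis
  proof (rule poly_boundedI)
    fix n
    have "S n * T n \<le> (C * (n + 2) ^ C) * (D * (n + 2) ^ D)" by (intro mult_le_mono C D)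
    then show "S n * T n \<le> (C * D) * (n + 2) ^ (C + D)" by (simp add: power_add mult_ac)
  qed
qed

lemma poly_bounded_power: "poly_bounded T \<Longrightarrow> poly_bounded (\<lambda>n. T n ^ k)"
  by (induction k) (auto intro: poly_bounded_const poly_bounded_mult)

lemmas poly_bounded_intros =
  poly_bounded_const poly_bounded_linear poly_bounded_add poly_bounded_mult poly_bounded_power

text \<open>The bound \<open>T\<close> is chosen before the input and the state, which makes it
  uniform. The input \<open>x\<close> stays fixed while the state changes, since it determines the
  length of all loops.\<close>

definition does ::
  "(bool list \<Rightarrow> state \<Rightarrow> bool) \<Rightarrow> prog \<Rightarrow> (bool list \<Rightarrow> state \<Rightarrow> state \<Rightarrow> bool) \<Rightarrow> bool" where
  "does P c Q \<longleftrightarrow> (\<exists>T. poly_bounded T \<and>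
     (\<forall>x s. P x s \<longrightarrow> (\<exists>s'. runs c s (T (length x)) s' \<and> Q x s s')))"

lemma doesI:
  assumes "poly_bounded T" "\<And>x s. P x s \<Longrightarrow> \<exists>s'. runs c s (T (length x)) s' \<and> Q x s s'"
  shows "does P c Q"
  using assms unfolding does_def by blast

lemma does_weaken:
  assumes "does P c Q" "\<And>x s. P' x s \<Longrightarrow> P x s" "\<And>x s s'. P' x s \<Longrightarrow> Q x s s' \<Longrightarrow> Q' x s s'"
  shows "does P' c Q'"
  using assms unfolding does_def by meson

lemma does_Skip: "(\<And>x s. P x s \<Longrightarrow> Q x s s) \<Longrightarrow> does P Skip Q"
  by (rule doesI[OF poly_bounded_const[of 0]]) (use runs_Skip in blast)

lemma does_Seq:
  assumes "does P c1 Q1" "does P2 c2 Q2"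
    and "\<And>x s s'. P x s \<Longrightarrow> Q1 x s s' \<Longrightarrow> P2 x s'"
    and "\<And>x s s' s''. P x s \<Longrightarrow> Q1 x s s' \<Longrightarrow> Q2 x s' s'' \<Longrightarrow> Q x s s''"
  shows "does P (Seq c1 c2) Q"
proof -
  obtain T1 where T1: "poly_bounded T1"
    "\<And>x s. P x s \<Longrightarrow> \<exists>s'. runs c1 s (T1 (length x)) s' \<and> Q1 x s s'"
    using assms(1) unfolding does_def by blast
  obtain T2 where T2: "poly_bounded T2"
    "\<And>x s. P2 x s \<Longrightarrow> \<exists>s'. runs c2 s (T2 (length x)) s' \<and> Q2 x s s'"
    using assms(2) unfolding does_def by blast
  show ?thesis
    by (rule doesI[OF poly_bounded_add[OF T1(1) T2(1)]])
       (meson T1(2) T2(2) assms(3,4) runs_Seq)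
qed

lemma does_Cond:
  assumes "does (\<lambda>x s. P x s \<and> test i j b s) c1 Q" "does (\<lambda>x s. P x s \<and> \<not> test i j b s) c2 Q"
  shows "does P (Cond i j b c1 c2) Q"
proof -
  obtain T1 where T1: "poly_bounded T1"
    "\<And>x s. P x s \<and> test i j b s \<Longrightarrow> \<exists>s'. runs c1 s (T1 (length x)) s' \<and> Q x s s'"
    using assms(1) unfolding does_def by blast
  obtain T2 where T2: "poly_bounded T2"
    "\<And>x s. P x s \<and> \<not> test i j b s \<Longrightarrow> \<exists>s'. runs c2 s (T2 (length x)) s' \<and> Q x s s'"
    using assms(2) unfolding does_def by blast
  show ?thesis
  proof (rule doesI)
    show "poly_bounded (\<lambda>n. T1 n + T2 n + 2)" by (intro poly_bounded_intros T1 T2)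
    fix x s assume P: "P x s"
    show "\<exists>s'. runs (Cond i j b c1 c2) s (T1 (length x) + T2 (length x) + 2) s' \<and> Q x s s'"
    proof (cases "test i j b s")
      case True
      then obtain s' where s': "runs c1 s (T1 (length x)) s'" "Q x s s'" using T1 P by blast
      then have "runs (Cond i j b c1 c2) s (T1 (length x) + T2 (length x) + 2) s'"
        using True by (intro runs_Cond) (auto intro: runs_mono)
      with s' show ?thesis by blast
    next
      case False
      then obtain s' where s': "runs c2 s (T2 (length x)) s'" "Q x s s'" using T2 P by blast
      then have "runs (Cond i j b c1 c2) s (T1 (length x) + T2 (length x) + 2) s'"
        using False by (intro runs_Cond) (auto intro: runs_mono)
      with s' show ?thesis by blast
    qed
  qed
qed

section \<open>Loops over all positions of the input\<close>

lemma cell_eq_3 [simp]: "cell x v = 3 \<longleftrightarrow> v = 0"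
  by (simp add: cell_def)

lemma cell_eq_0 [simp]: "cell x v = 0 \<longleftrightarrow> v > length x"
  by (simp add: cell_def)

text \<open>Marker and first blank delimit the loop, so the body meets exactly
  \<open>length x + 2\<close> positions. Larger polynomial numbers of repetitions are nests of such
  loops.\<close>

definition For :: "nat \<Rightarrow> prog \<Rightarrow> prog" where
  "For i c = Seq c (Seq (While i i (\<lambda>a _. a \<noteq> 0) (Seq (Right i) c)) (While i i (\<lambda>a _. a \<noteq> 3) (Left i)))"

definition setp :: "nat \<Rightarrow> nat \<Rightarrow> state \<Rightarrow> state" where
  "setp i v s = (fst s, (snd s)(i := v))"

lemma runs_rewind:
  assumes "\<And>v. c i v = 3 \<longleftrightarrow> v = 0"
  shows "runs (While i i (\<lambda>a _. a \<noteq> 3) (Left i)) (c, p) (p i * 3 + 1) (c, p(i := 0))"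
proof -
  have "runs (While i i (\<lambda>a _. a \<noteq> 3) (Left i)) (c, p) (Suc (p i + (p i + p i))) (c, p(i := 0))"
    using runs_While_det[of "p i" i i "\<lambda>a _. a \<noteq> 3" "\<lambda>k. (c, p(i := p i - k))" "Left i" 1]
      assms runs_Left[of c i "p(i := p i - k)" for k] by simp
  then show ?thesis by (rule runs_mono) simp
qed

text \<open>The invariant \<open>J x s0 v s\<close> describes the state before round
  \<open>v\<close> with head \<open>i\<close> put back to 0. It need not mention the loop head, and
  so it can often be an equation between \<open>s\<close> and \<open>s0\<close>.\<close>

lemma does_For:
  assumes body: "does P c Q"
    and start: "\<And>x s. P0 x s \<Longrightarrow> fst s i = cell x \<and> snd s i = 0 \<and> J x s 0 s"
    and step: "\<And>x s0 v s s'. P0 x s0 \<Longrightarrow> J x s0 v s \<Longrightarrow> fst s i = cell x \<Longrightarrow> snd s i = 0 \<Longrightarrow>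
      v < length x + 2 \<Longrightarrow> P x (setp i v s) \<and>
      (Q x (setp i v s) s' \<longrightarrow> fst s' i = cell x \<and> snd s' i = v \<and> J x s0 (Suc v) (setp i 0 s'))"
  shows "does P0 (For i c) (\<lambda>x s s'. fst s' i = cell x \<and> snd s' i = 0 \<and> J x s (length x + 2) s')"
proof -
  obtain T where T: "poly_bounded T"
    "\<And>x s. P x s \<Longrightarrow> \<exists>s'. runs c s (T (length x)) s' \<and> Q x s s'"
    using body unfolding does_def by blast
  show ?thesis
  proof (rule doesI)
    show "poly_bounded (\<lambda>n. T n + (((n + 1) * (1 + T n + 2) + 1) + ((n + 1) * 3 + 1)))"
      by (intro poly_bounded_intros T)
    fix x s0 assume P0: "P0 x s0"
    let ?n = "length x + 1" and ?T = "T (length x)"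
    \<comment> \<open>The state after round \<open>k\<close>, while the head still stands on
      \<open>k\<close>; hence the index \<open>Suc k\<close> of the round to come.\<close>
    define J' where "J' k s \<longleftrightarrow> fst s i = cell x \<and> snd s i = k \<and> J x s0 (Suc k) (setp i 0 s)" for k s
    have body': "\<exists>s'. runs c s ?T s' \<and> J' v s'"
      if "J x s0 v (setp i 0 s)" "fst s i = cell x" "snd s i = v" "v < length x + 2" for v s
    proof -
      have s: "setp i v (setp i 0 s) = s" using that by (auto simp: setp_def)
      have P: "P x s" using step[OF P0 that(1)] that by (simp add: s) (simp add: setp_def)
      then obtain s' where s': "runs c s ?T s'" "Q x s s'" using T by blast
      then have "J' v s'" using step[OF P0 that(1), of s'] that unfolding J'_def
        by (simp add: s) (simp add: setp_def)
      with s' show ?thesis by blast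
    qed
    have "setp i 0 s0 = s0" using start[OF P0] by (auto simp: setp_def prod_eq_iff)
    then obtain s1 where 1: "runs c s0 ?T s1" "J' 0 s1"
      using body'[of 0 s0] start[OF P0] by auto
    have "\<exists>s'. runs (While i i (\<lambda>a _. a \<noteq> 0) (Seq (Right i) c)) s1 (?n * (1 + ?T + 2) + 1) s' \<and> J' ?n s'"
    proof (rule runs_While)
      fix k s assume k: "k < ?n" and J: "J' k s"
      have "\<exists>s'. runs c (setp i (Suc k) s) ?T s' \<and> J' (Suc k) s'"
        using J k by (intro body') (auto simp: J'_def setp_def)
      moreover have "runs (Right i) s 1 (setp i (Suc k) s)"
        using J runs_Right[of i "fst s" "snd s"] by (simp add: J'_def setp_def)
      ultimately have "\<exists>s'. runs (Seq (Right i) c) s (1 + ?T) s' \<and> J' (Suc k) s'"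
        using runs_Seq by blast
      moreover have "cell x k > 0" using k cell_eq_0[of x k] by linarith
      then have "test i i (\<lambda>a _. a \<noteq> 0) s"
        using J by (simp add: J'_def test_def)
      ultimately show "test i i (\<lambda>a _. a \<noteq> 0) s \<and> (\<exists>s'. runs (Seq (Right i) c) s (1 + ?T) s' \<and> J' (Suc k) s')"
        by blast
    qed (use 1 in \<open>auto simp: J'_def test_def\<close>)
    then obtain s2 where 2: "runs (While i i (\<lambda>a _. a \<noteq> 0) (Seq (Right i) c)) s1 (?n * (1 + ?T + 2) + 1) s2" "J' ?n s2"
      by blast
    have "runs (While i i (\<lambda>a _. a \<noteq> 3) (Left i)) s2 (?n * 3 + 1) (setp i 0 s2)"
      using runs_rewind[of "fst s2" i "snd s2"] 2(2) by (simp add: J'_def setp_def)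
    from runs_Seq[OF 1(1) runs_Seq[OF 2(1) this]]
    show "\<exists>s'. runs (For i c) s0 (?T + ((?n * (1 + ?T + 2) + 1) + (?n * 3 + 1))) s' \<and>
        fst s' i = cell x \<and> snd s' i = 0 \<and> J x s0 (length x + 2) s'"
      unfolding For_def using 2(2) by (intro exI[of _ "setp i 0 s2"]) (auto simp: J'_def setp_def)
  qed
qed

section \<open>Moving and comparing heads\<close>

fun rights :: "nat \<Rightarrow> nat \<Rightarrow> prog" where
  "rights 0 i = Skip"
| "rights (Suc n) i = Seq (Right i) (rights n i)"

fun lefts :: "nat \<Rightarrow> nat \<Rightarrow> prog" where
  "lefts 0 i = Skip"
| "lefts (Suc n) i = Seq (Left i) (lefts n i)"

lemma runs_rights: "runs (rights n i) (c, p) n (c, p(i := p i + n))"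
proof (induction n arbitrary: p)
  case 0
  then show ?case using runs_Skip by simp
next
  case (Suc n)
  from runs_Seq[OF runs_Right[of i c p] Suc] show ?case by (simp cong: if_cong)
qed

lemma runs_lefts:
  assumes "\<And>v. c i v = 3 \<longleftrightarrow> v = 0"
  shows "p i \<ge> n \<Longrightarrow> runs (lefts n i) (c, p) n (c, p(i := p i - n))"
proof (induction n arbitrary: p)
  case 0
  then show ?case using runs_Skip by simp
next
  case (Suc n)
  have "runs (Left i) (c, p) 1 (c, p(i := p i - 1))" using Suc.prems assms by (intro runs_Left) auto
  from runs_Seq[OF this Suc.IH] Suc.prems show ?case by (simp cong: if_cong)
qed

text \<open>
  The tapes \<open>i\<close> and \<open>j\<close> are compared by walking both heads to the left in parallel, counting the
  steps on tape \<open>z\<close> in order to restore them.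
\<close>

definition compare :: "nat \<Rightarrow> nat \<Rightarrow> nat \<Rightarrow> nat \<Rightarrow> nat \<Rightarrow> (nat \<Rightarrow> nat \<Rightarrow> bool) \<Rightarrow> prog" where
  "compare i n j z f b =
    Seq (rights n i)
    (Seq (While i j (\<lambda>a b. a \<noteq> 3 \<and> b \<noteq> 3) (Seq (Left i) (Seq (Left j) (Right z))))
    (Seq (Cond i j b (Right f) Skip)
    (Seq (While z z (\<lambda>a _. a \<noteq> 3) (Seq (Left z) (Seq (Right i) (Right j))))
      (lefts n i))))"

lemma runs_compare:
  assumes d: "distinct [i, j, z, f]" and m: "\<And>w v. w \<in> {i, j, z} \<Longrightarrow> c w v = 3 \<longleftrightarrow> v = 0"
    and z: "p z = 0"
  shows "runs (compare i n j z f b) (c, p) (2 * n + 10 * p j + 5)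
    (c, p(f := if b (c i (p i + n - p j)) (c j (p j - (p i + n))) then Suc (p f) else p f))"
proof -
  define u v k where "u = p i + n" and "v = p j" and "k = min u v"
  define f' where "f' = (if b (c i (u - v)) (c j (v - u)) then Suc (p f) else p f)"
  have k: "u - k = u - v" "v - k = v - u" "k \<le> v" "k \<le> u" by (auto simp: k_def)
  have 1: "runs (rights n i) (c, p) n (c, p(i := u))"
    unfolding u_def by (rule runs_rights)
  define st where "st l = (c, p(i := u - l, j := v - l, z := l))" for l
  have "runs (While i j (\<lambda>a b. a \<noteq> 3 \<and> b \<noteq> 3) (Seq (Left i) (Seq (Left j) (Right z)))) (st 0)
      (k * (1 + (1 + 1) + 2) + 1) (st k)"
  proof (rule runs_While_det)
    fix l assume l: "l < k"
    let ?p = "p(i := u - l, j := v - l, z := l)"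
    have a: "runs (Left i) (c, ?p) 1 (c, ?p(i := ?p i - 1))"
      using l d m k_def by (intro runs_Left) auto
    have b: "runs (Left j) (c, ?p(i := ?p i - 1)) 1 (c, (?p(i := ?p i - 1))(j := (?p(i := ?p i - 1)) j - 1))"
      using l d m k_def by (intro runs_Left) auto
    have "(c, (?p(i := ?p i - 1, j := (?p(i := ?p i - 1)) j - 1))
        (z := Suc ((?p(i := ?p i - 1, j := (?p(i := ?p i - 1)) j - 1)) z))) = st (Suc l)"
      using d by (auto simp: st_def fun_eq_iff)
    then have "runs (Seq (Left i) (Seq (Left j) (Right z))) (st l) (1 + (1 + 1)) (st (Suc l))"
      using runs_Seq[OF a runs_Seq[OF b runs_Right[of z]]] unfolding st_def[of l] by simp
    moreover have "test i j (\<lambda>a b. a \<noteq> 3 \<and> b \<noteq> 3) (st l)"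
      using l d m by (auto simp: st_def k_def)
    ultimately show "test i j (\<lambda>a b. a \<noteq> 3 \<and> b \<noteq> 3) (st l) \<and>
        runs (Seq (Left i) (Seq (Left j) (Right z))) (st l) (1 + (1 + 1)) (st (Suc l))" by blast
  qed (use d m in \<open>auto simp: st_def k_def\<close>)
  moreover have "st 0 = (c, p(i := u))" using d z by (auto simp: st_def v_def fun_eq_iff)
  ultimately have 2: "runs (While i j (\<lambda>a b. a \<noteq> 3 \<and> b \<noteq> 3) (Seq (Left i) (Seq (Left j) (Right z))))
      (c, p(i := u)) (k * (1 + (1 + 1) + 2) + 1) (st k)" by simp
  have 3: "runs (Cond i j b (Right f) Skip) (st k) (1 + 2) (setp f f' (st k))"
  proof (rule runs_Cond)
    assume "test i j b (st k)"
    then have "setp f f' (st k) = (c, (snd (st k))(f := Suc (snd (st k) f)))"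
      using d k by (auto simp: st_def setp_def f'_def)
    then show "runs (Right f) (st k) 1 (setp f f' (st k))"
      using runs_Right[of f c "snd (st k)"] by (simp add: st_def)
  next
    assume "\<not> test i j b (st k)"
    then have "setp f f' (st k) = st k"
      using d k by (auto simp: st_def setp_def f'_def)
    then show "runs Skip (st k) 1 (setp f f' (st k))"
      using runs_mono[OF runs_Skip[of "st k"], of 1] by simp
  qed
  define st' where "st' l = (c, p(i := u - (k - l), j := v - (k - l), z := k - l, f := f'))" for l
  have "runs (While z z (\<lambda>a _. a \<noteq> 3) (Seq (Left z) (Seq (Right i) (Right j)))) (st' 0)
      (k * (1 + (1 + 1) + 2) + 1) (st' k)"
  proof (rule runs_While_det)
    fix l assume l: "l < k"
    let ?p = "p(i := u - (k - l), j := v - (k - l), z := k - l, f := f')"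
    have a: "runs (Left z) (c, ?p) 1 (c, ?p(z := ?p z - 1))"
      using l d m by (intro runs_Left) auto
    let ?q = "?p(z := ?p z - 1)"
    have "runs (Right i) (c, ?q) 1 (c, ?q(i := Suc (u - (k - l))))"
      using runs_Right[of i c ?q] d by (simp del: fun_upd_apply add: fun_upd_same fun_upd_other)
    moreover have "runs (Right j) (c, ?q(i := Suc (u - (k - l)))) 1
        (c, ?q(i := Suc (u - (k - l)), j := Suc (v - (k - l))))"
      using runs_Right[of j c "?q(i := Suc (u - (k - l)))"] d
      by (simp del: fun_upd_apply add: fun_upd_same fun_upd_other)
    ultimately have b: "runs (Seq (Right i) (Right j)) (c, ?q) (1 + 1)
        (c, ?q(i := Suc (u - (k - l)), j := Suc (v - (k - l))))"
      by (rule runs_Seq)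
    have "Suc (u - (k - l)) = u - (k - Suc l)" "Suc (v - (k - l)) = v - (k - Suc l)"
      using l k by auto
    then have "(c, ((?p(z := ?p z - 1))(i := Suc (u - (k - l))))(j := Suc (v - (k - l)))) = st' (Suc l)"
      using d by (auto simp: st'_def fun_eq_iff)
    then have "runs (Seq (Left z) (Seq (Right i) (Right j))) (st' l) (1 + (1 + 1)) (st' (Suc l))"
      using runs_Seq[OF a b] unfolding st'_def[of l] by simp
    moreover have "test z z (\<lambda>a _. a \<noteq> 3) (st' l)"
      using l d m by (auto simp: st'_def)
    ultimately show "test z z (\<lambda>a _. a \<noteq> 3) (st' l) \<and>
        runs (Seq (Left z) (Seq (Right i) (Right j))) (st' l) (1 + (1 + 1)) (st' (Suc l))" by blast
  qed (use d m in \<open>auto simp: st'_def\<close>)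
  moreover have "st' 0 = setp f f' (st k)" using d by (auto simp: st_def st'_def setp_def)
  moreover have "st' k = (c, p(f := f', i := u))"
    using d z by (auto simp: st'_def v_def fun_eq_iff)
  ultimately have 4: "runs (While z z (\<lambda>a _. a \<noteq> 3) (Seq (Left z) (Seq (Right i) (Right j))))
      (setp f f' (st k)) (k * (1 + (1 + 1) + 2) + 1) (c, p(f := f', i := u))" by simp
  have "runs (lefts n i) (c, p(f := f', i := u)) n (c, (p(f := f', i := u))(i := (p(f := f', i := u)) i - n))"
    using m by (intro runs_lefts) (auto simp: u_def)
  moreover have "(p(f := f', i := u))(i := (p(f := f', i := u)) i - n) = p(f := f')"
    using d by (auto simp: u_def fun_eq_iff)
  ultimately have 5: "runs (lefts n i) (c, p(f := f', i := u)) n (c, p(f := f'))" by simp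
  have "runs (compare i n j z f b) (c, p) (n + (k * (1 + (1 + 1) + 2) + 1 + (1 + 2 + (k * (1 + (1 + 1) + 2) + 1 + n)))) (c, p(f := f'))"
    unfolding compare_def by (intro runs_Seq[OF 1] runs_Seq[OF 2] runs_Seq[OF 3] runs_Seq[OF 4] 5)
  moreover have "n + (k * (1 + (1 + 1) + 2) + 1 + (1 + 2 + (k * (1 + (1 + 1) + 2) + 1 + n))) \<le> 2 * n + 10 * p j + 5"
    using k(3) by (simp add: v_def)
  ultimately show ?thesis
    unfolding f'_def u_def v_def by (rule runs_mono)
qed

text \<open>There is no negation, so that every system of formulas has a least fixed point.\<close>

datatype fm =
    Chr nat nat nat
  | Off nat nat nat
  | Lt nat nat
  | Rel nat "nat list"
  | And fm fm
  | Or fm fm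
  | Ex nat fm

text \<open>Quantified variables take the positions that \<open>For\<close> visits; offsets may
  point beyond them, where all cells are blank. Numbers are represented by positions, so
  \<open>Chr i 0 3\<close> says that variable \<open>i\<close> is 0.\<close>

fun sat :: "bool list \<Rightarrow> (nat \<times> nat list) set \<Rightarrow> (nat \<Rightarrow> nat) \<Rightarrow> fm \<Rightarrow> bool" where
  "sat x S e (Chr i n s) \<longleftrightarrow> cell x (e i + n) = s"
| "sat x S e (Off i n j) \<longleftrightarrow> e j = e i + n"
| "sat x S e (Lt i j) \<longleftrightarrow> e i < e j"
| "sat x S e (Rel r vs) \<longleftrightarrow> (r, map e vs) \<in> S"
| "sat x S e (And \<phi> \<psi>) \<longleftrightarrow> sat x S e \<phi> \<and> sat x S e \<psi>"
| "sat x S e (Or \<phi> \<psi>) \<longleftrightarrow> sat x S e \<phi> \<or> sat x S e \<psi>"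
| "sat x S e (Ex i \<phi>) \<longleftrightarrow> (\<exists>v<length x + 2. sat x S (e(i := v)) \<phi>)"

lemma sat_mono: "sat x S e \<phi> \<Longrightarrow> S \<subseteq> S' \<Longrightarrow> sat x S' e \<phi>"
  by (induction \<phi> arbitrary: e) auto

section \<open>Addresses of tuples in the tables\<close>

fun index :: "nat \<Rightarrow> nat list \<Rightarrow> nat" where
  "index B [] = 0"
| "index B (v # vs) = v * B ^ length vs + index B vs"

lemma index_less: "set vs \<subseteq> {..<B} \<Longrightarrow> index B vs < B ^ length vs"
proof (induction vs)
  case (Cons v vs)
  then have "v * B ^ length vs + index B vs < v * B ^ length vs + B ^ length vs" by simp
  also have "\<dots> = Suc v * B ^ length vs" by simp
  also have "\<dots> \<le> B * B ^ length vs" using Cons.prems by (intro mult_le_mono1) auto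
  finally show ?case by simp
qed simp

text \<open>Ensures that distinct tuples have distinct cells. In positional notation the leading
  digit is recovered by division.\<close>

lemma index_inject:
  "length us = length vs \<Longrightarrow> set us \<subseteq> {..<B} \<Longrightarrow> set vs \<subseteq> {..<B} \<Longrightarrow> index B us = index B vs \<Longrightarrow> us = vs"
proof (induction us vs rule: list_induct2)
  case (Cons u us v vs)
  have u: "index B us < B ^ length vs" and v: "index B vs < B ^ length vs"
    using index_less[of us B] index_less[of vs B] Cons by auto
  have "index B (u # us) div B ^ length vs = u" "index B (v # vs) div B ^ length vs = v"
    using u v Cons.hyps gr_implies_not0[OF u] by auto
  then have "u = v" using Cons.prems by simp
  with Cons show ?case by simp
qed simp

declare add_2_eq_Suc' [simp del]

section \<open>Least fixed points of positive formulas\<close>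

text \<open>When the effect is a function of the state, sequencing is composition of functions and a
  correctness proof ends in simplifying the resulting state.\<close>

definition det :: "(bool list \<Rightarrow> state \<Rightarrow> bool) \<Rightarrow> prog \<Rightarrow> (bool list \<Rightarrow> state \<Rightarrow> state) \<Rightarrow> bool" where
  "det P c F \<longleftrightarrow> does P c (\<lambda>x s s'. s' = F x s)"

lemma detI:
  assumes "poly_bounded T" "\<And>x s. P x s \<Longrightarrow> runs c s (T (length x)) (F x s)"
  shows "det P c F"
  unfolding det_def using assms by (intro doesI[of T]) auto

lemma det_conv:
  assumes "det P c F" "\<And>x s. P' x s \<Longrightarrow> P x s" "\<And>x s. P' x s \<Longrightarrow> F x s = F' x s"
  shows "det P' c F'"
  using assms unfolding det_def by (auto elim!: does_weaken)

lemma det_Skip: "det P Skip (\<lambda>x s. s)"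
  unfolding det_def by (rule does_Skip) simp

lemma det_Seq:
  assumes "det P c1 F" "det Q c2 G" "\<And>x s. P x s \<Longrightarrow> Q x (F x s)"
  shows "det P (Seq c1 c2) (\<lambda>x s. G x (F x s))"
  using assms unfolding det_def by (auto elim!: does_Seq)

lemma det_Cond:
  assumes "det (\<lambda>x s. P x s \<and> test i j b s) c1 F" "det (\<lambda>x s. P x s \<and> \<not> test i j b s) c2 G"
  shows "det P (Cond i j b c1 c2) (\<lambda>x s. if test i j b s then F x s else G x s)"
  unfolding det_def
proof (rule does_Cond)
  show "does (\<lambda>x s. P x s \<and> test i j b s) c1 (\<lambda>x s s'. s' = (if test i j b s then F x s else G x s))"
    by (rule does_weaken[OF assms(1)[unfolded det_def]]) auto
  show "does (\<lambda>x s. P x s \<and> \<not> test i j b s) c2 (\<lambda>x s s'. s' = (if test i j b s then F x s else G x s))"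
    by (rule does_weaken[OF assms(2)[unfolded det_def]]) auto
qed

lemma fst_setp [simp]: "fst (setp i v s) = fst s"
  by (simp add: setp_def)

lemma snd_setp [simp]: "snd (setp i v s) = (snd s)(i := v)"
  by (simp add: setp_def)

lemma setp_eq_iff: "setp i v s = setp j w t \<longleftrightarrow> fst s = fst t \<and> (snd s)(i := v) = (snd t)(j := w)"
  by (simp add: setp_def)

lemma setp_idem [simp]: "snd s i = v \<Longrightarrow> setp i v s = s"
  by (auto simp: setp_def)

lemma setp_setp [simp]: "setp i v (setp i w s) = setp i v s"
  by (simp add: setp_def)

lemma det_Right: "det P (Right i) (\<lambda>x s. setp i (Suc (snd s i)) s)"
  by (rule detI[OF poly_bounded_const[of 1]]) (metis runs_Right setp_def prod.collapse)

lemma det_rights: "det P (rights n i) (\<lambda>x s. setp i (snd s i + n) s)"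
  by (rule detI[OF poly_bounded_const[of n]]) (metis runs_rights setp_def prod.collapse)

section \<open>Addressing the tables and evaluating formulas\<close>

definition home :: "nat \<Rightarrow> prog" where
  "home r = While r r (\<lambda>a _. a \<noteq> 3) (Left r)"

text \<open>A power of the number of positions is counted out by nested loops whose innermost body
  is one step of head \<open>r\<close>.\<close>

fun sweep :: "nat \<Rightarrow> nat \<Rightarrow> nat \<Rightarrow> prog" where
  "sweep r 0 e = Right r"
| "sweep r (Suc n) e = For e (sweep r n (Suc e))"

text \<open>Interprets the symbols at which \<open>compare\<close> stops: the head that reaches the
  marker alone had the smaller position.\<close>

definition lessb :: "nat \<Rightarrow> nat \<Rightarrow> bool" where
  "lessb a b \<longleftrightarrow> a = 3 \<and> b \<noteq> 3"

definition eqb :: "nat \<Rightarrow> nat \<Rightarrow> bool" where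
  "eqb a b \<longleftrightarrow> a = 3 \<and> b = 3"

text \<open>As many positions lie below a digit as its value says, so one sweep for each of them
  adds the digit times its weight to head \<open>r\<close>. Tape \<open>e\<close> runs the loop,
  \<open>e + 1\<close> is the flag and \<open>e + 2\<close> the counter of the comparison.\<close>

fun advance :: "nat \<Rightarrow> nat list \<Rightarrow> nat \<Rightarrow> prog" where
  "advance r [] e = Skip"
| "advance r (v # vs) e =
    Seq (For e (Seq (compare e 0 v (e + 2) (e + 1) lessb)
      (Cond (e + 1) (e + 1) (\<lambda>a _. a \<noteq> 3) (Seq (lefts 1 (e + 1)) (sweep r (length vs) (e + 2))) Skip)))
    (advance r vs e)"

text \<open>The extra step skips the marker in cell 0 of the table.\<close>

definition goto :: "nat \<Rightarrow> nat list \<Rightarrow> nat \<Rightarrow> prog" where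
  "goto r vs e = Seq (Right r) (advance r vs e)"

text \<open>Truth is reported by moving head \<open>d\<close> from 0 to 1; \<rho> assigns tapes to
  variables. As \<open>compare\<close> needs different tapes, two variables on one tape are treated
  separately. For \<open>Ex\<close>, the candidate runs on tape \<open>d + 1\<close>, the body
  reports on \<open>d + 2\<close>, and the inner test of \<open>d\<close> keeps several witnesses
  from moving \<open>d\<close> more than once.\<close>

fun ev :: "fm \<Rightarrow> (nat \<Rightarrow> nat) \<Rightarrow> nat \<Rightarrow> prog" where
  "ev (Chr i n s) \<rho> d = Seq (rights n (\<rho> i)) (Seq (Cond (\<rho> i) (\<rho> i) (\<lambda>a _. a = s) (Right d) Skip) (lefts n (\<rho> i)))"
| "ev (Off i n j) \<rho> d = (if \<rho> i = \<rho> j then if n = 0 then Right d else Skip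
     else compare (\<rho> i) n (\<rho> j) (d + 1) d eqb)"
| "ev (Lt i j) \<rho> d = (if \<rho> i = \<rho> j then Skip else compare (\<rho> i) 0 (\<rho> j) (d + 1) d lessb)"
| "ev (Rel r vs) \<rho> d = Seq (goto (Suc r) (map \<rho> vs) (d + 1))
     (Seq (Cond (Suc r) (Suc r) (\<lambda>a _. a = 1) (Right d) Skip) (home (Suc r)))"
| "ev (And \<phi> \<psi>) \<rho> d = Seq (ev \<phi> \<rho> d) (Cond d d (\<lambda>a _. a \<noteq> 3) (Seq (lefts 1 d) (ev \<psi> \<rho> d)) Skip)"
| "ev (Or \<phi> \<psi>) \<rho> d = Seq (ev \<phi> \<rho> d) (Cond d d (\<lambda>a _. a \<noteq> 3) Skip (ev \<psi> \<rho> d))"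
| "ev (Ex i \<phi>) \<rho> d = For (d + 1) (Seq (ev \<phi> (\<rho>(i := d + 1)) (d + 2))
     (Cond (d + 2) (d + 2) (\<lambda>a _. a \<noteq> 3) (Seq (lefts 1 (d + 2)) (Cond d d (\<lambda>a _. a \<noteq> 3) Skip (Right d))) Skip))"

fun wff :: "nat \<Rightarrow> (nat \<Rightarrow> nat) \<Rightarrow> fm \<Rightarrow> bool" where
  "wff R ar (Rel r vs) \<longleftrightarrow> r < R \<and> length vs = ar r"
| "wff R ar (And \<phi> \<psi>) \<longleftrightarrow> wff R ar \<phi> \<and> wff R ar \<psi>"
| "wff R ar (Or \<phi> \<psi>) \<longleftrightarrow> wff R ar \<phi> \<and> wff R ar \<psi>"
| "wff R ar (Ex i \<phi>) \<longleftrightarrow> wff R ar \<phi>"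
| "wff R ar _ \<longleftrightarrow> True"

text \<open>
  Tape \<open>Suc r\<close> holds the table of relation \<open>r\<close>; every other tape is a copy of the input and serves
  as a pointer. The pointers from \<open>d\<close> on are free for use as auxiliary variables.
\<close>

locale fixpoint_system =
  fixes R :: nat and ar :: "nat \<Rightarrow> nat" and \<phi> :: "nat \<Rightarrow> fm"
  assumes goal: "R > 0" "ar 0 = 0"
    and wff: "\<And>r. r < R \<Longrightarrow> wff R ar (\<phi> r)"
begin

definition tab :: "nat \<Rightarrow> bool" where
  "tab i \<longleftrightarrow> 1 \<le> i \<and> i \<le> R"

definition contents :: "bool list \<Rightarrow> (nat \<Rightarrow> nat \<Rightarrow> nat) \<Rightarrow> bool" where
  "contents x c \<longleftrightarrow> (\<forall>i. if tab i then c i 0 = 3 \<and> (\<forall>v>0. c i v \<noteq> 3) else c i = cell x)"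

definition bounded :: "bool list \<Rightarrow> (nat \<Rightarrow> nat) \<Rightarrow> bool" where
  "bounded x p \<longleftrightarrow> (\<forall>i. if tab i then p i = 0 else p i < length x + 2)"

definition good :: "bool list \<Rightarrow> state \<Rightarrow> bool" where
  "good x s \<longleftrightarrow> contents x (fst s) \<and> bounded x (snd s)"

definition zero :: "nat \<Rightarrow> (nat \<Rightarrow> nat) \<Rightarrow> bool" where
  "zero d p \<longleftrightarrow> (\<forall>i\<ge>d. p i = 0)"

lemma contents_eq_3: "contents x c \<Longrightarrow> c i v = 3 \<longleftrightarrow> v = 0"
  unfolding contents_def by (metis cell_eq_3 gr0I)

lemma contents_cell: "contents x c \<Longrightarrow> \<not> tab i \<Longrightarrow> c i = cell x"
  unfolding contents_def by metis

lemma zeroD: "zero d p \<Longrightarrow> d \<le> i \<Longrightarrow> p i = 0"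
  by (simp add: zero_def)

lemma zero_upd [simp]: "i < d \<Longrightarrow> zero d (p(i := v)) \<longleftrightarrow> zero d p"
  by (auto simp: zero_def)

lemma zero_upd_0 [simp]: "zero d p \<Longrightarrow> zero d (p(i := 0))"
  by (auto simp: zero_def)

lemma zero_mono: "zero d p \<Longrightarrow> d \<le> e \<Longrightarrow> zero e p"
  by (auto simp: zero_def)

lemma bounded_upd [simp]: "bounded x p \<Longrightarrow> \<not> tab i \<Longrightarrow> v < length x + 2 \<Longrightarrow> bounded x (p(i := v))"
  by (auto simp: bounded_def)

lemma det_lefts:
  "det (\<lambda>x s. contents x (fst s) \<and> n \<le> snd s i) (lefts n i) (\<lambda>x s. setp i (snd s i - n) s)"
  by (rule detI[OF poly_bounded_const[of n]])
     (metis runs_lefts setp_def prod.collapse contents_eq_3)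

text \<open>Rewinding costs as much as the distance, so the precondition carries a polynomial bound
  on the head position.\<close>

lemma det_home:
  "det (\<lambda>x s. contents x (fst s) \<and> snd s r \<le> (length x + 2) ^ k) (home r) (\<lambda>x s. setp r 0 s)"
proof (rule detI)
  show "poly_bounded (\<lambda>n. (n + 2) ^ k * 3 + 1)" by (intro poly_bounded_intros)
  fix x s assume *: "contents x (fst s) \<and> snd s r \<le> (length x + 2) ^ k"
  then have "runs (home r) s (snd s r * 3 + 1) (setp r 0 s)"
    using runs_rewind[of "fst s" r "snd s"] contents_eq_3 unfolding home_def by (auto simp: setp_def)
  then show "runs (home r) s ((length x + 2) ^ k * 3 + 1) (setp r 0 s)"
    by (rule runs_mono) (use * in simp)
qed

lemma det_compare:
  assumes "distinct [i, j, z, f]"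
  shows "det (\<lambda>x s. contents x (fst s) \<and> snd s z = 0 \<and> snd s j < length x + 2) (compare i n j z f b)
    (\<lambda>x s. setp f (if b (fst s i (snd s i + n - snd s j)) (fst s j (snd s j - (snd s i + n)))
       then Suc (snd s f) else snd s f) s)"
proof (rule detI)
  show "poly_bounded (\<lambda>m. 2 * n + 10 * (m + 2) + 5)" by (intro poly_bounded_intros)
  fix x s assume *: "contents x (fst s) \<and> snd s z = 0 \<and> snd s j < length x + 2"
  then have m: "fst s w v = 3 \<longleftrightarrow> v = 0" for w v using contents_eq_3 by blast
  have "runs (compare i n j z f b) (fst s, snd s) (2 * n + 10 * (snd s j) + 5)
      (fst s, (snd s)(f := if b (fst s i (snd s i + n - snd s j)) (fst s j (snd s j - (snd s i + n)))
        then Suc (snd s f) else snd s f))"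
    using * m by (intro runs_compare[OF assms]) auto
  from runs_mono[OF this, of "2 * n + 10 * (length x + 2) + 5"] *
  show "runs (compare i n j z f b) s (2 * n + 10 * (length x + 2) + 5)
     (setp f (if b (fst s i (snd s i + n - snd s j)) (fst s j (snd s j - (snd s i + n)))
       then Suc (snd s f) else snd s f) s)"
    by (simp add: setp_def)
qed

lemma det_less:
  assumes "distinct [i, j, z, f]"
  shows "det (\<lambda>x s. contents x (fst s) \<and> snd s z = 0 \<and> snd s j < length x + 2) (compare i 0 j z f lessb)
    (\<lambda>x s. setp f (if snd s i < snd s j then Suc (snd s f) else snd s f) s)"
  by (rule det_conv[OF det_compare[OF assms, of 0 lessb]])
     (auto simp: lessb_def contents_eq_3)

lemma det_off:
  assumes "distinct [i, j, z, f]"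
  shows "det (\<lambda>x s. contents x (fst s) \<and> snd s z = 0 \<and> snd s j < length x + 2) (compare i n j z f eqb)
    (\<lambda>x s. setp f (if snd s j = snd s i + n then Suc (snd s f) else snd s f) s)"
  by (rule det_conv[OF det_compare[OF assms, of n eqb]])
     (auto simp: eqb_def contents_eq_3)

lemma det_sweep:
  assumes "tab r" "R < e"
  shows "det (\<lambda>x s. contents x (fst s) \<and> zero e (snd s)) (sweep r n e)
    (\<lambda>x s. setp r (snd s r + (length x + 2) ^ n) s)"
  using assms(2)
proof (induction n arbitrary: e)
  case 0
  show ?case by (simp add: det_conv[OF det_Right])
next
  case (Suc n)
  have IH: "does (\<lambda>x s. contents x (fst s) \<and> zero (Suc e) (snd s)) (sweep r n (Suc e))
      (\<lambda>x s s'. s' = setp r (snd s r + (length x + 2) ^ n) s)"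
    using Suc.IH[of "Suc e"] Suc.prems by (simp add: det_def)
  have e: "r < e" "\<not> tab e" using assms(1) Suc.prems by (auto simp: tab_def)
  have "does (\<lambda>x s. contents x (fst s) \<and> zero e (snd s)) (For e (sweep r n (Suc e)))
      (\<lambda>x s s'. fst s' e = cell x \<and> snd s' e = 0 \<and>
        s' = setp r (snd s r + (length x + 2) * (length x + 2) ^ n) s)"
    by (rule does_For[OF IH, where J = "\<lambda>x s0 v s. s = setp r (snd s0 r + v * (length x + 2) ^ n) s0"])
       (use e in \<open>auto simp: zeroD contents_cell setp_eq_iff fun_eq_iff intro: zero_mono\<close>)
  then show ?case unfolding det_def sweep.simps by (rule does_weaken) auto
qed

lemma det_advance:
  assumes "tab r" "R < e"
  shows "\<forall>v\<in>set vs. \<not> tab v \<and> v < e \<Longrightarrow>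
    det (\<lambda>x s. contents x (fst s) \<and> zero e (snd s) \<and> (\<forall>v\<in>set vs. snd s v < length x + 2)) (advance r vs e)
    (\<lambda>x s. setp r (snd s r + index (length x + 2) (map (snd s) vs)) s)"
proof (induction vs)
  case Nil
  show ?case by (simp add: det_conv[OF det_Skip])
next
  case (Cons v vs)
  have e: "r < e" "\<not> tab e" "v < e" "\<not> tab v" "r \<noteq> v" "\<forall>v\<in>set vs. v \<noteq> r"
    using assms Cons.prems by (auto simp: tab_def)
  let ?B = "\<lambda>x. length x + 2"
  let ?P = "\<lambda>x s. contents x (fst s) \<and> zero (Suc e) (snd s) \<and> snd s v < length x + 2"
  have "det (\<lambda>x s. contents x (fst s) \<and> zero (e + 2) (snd s) \<and> snd s (e + 1) = 1)
      (Seq (lefts 1 (e + 1)) (sweep r (length vs) (e + 2)))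
      (\<lambda>x s. setp r (snd (setp (e + 1) (snd s (e + 1) - 1) s) r + (length x + 2) ^ length vs)
        (setp (e + 1) (snd s (e + 1) - 1) s))"
    using assms(2) by (intro det_Seq[OF det_conv[OF det_lefts] det_sweep[OF assms(1)]]) auto
  then have 1: "det (\<lambda>x s. contents x (fst s) \<and> zero (e + 2) (snd s) \<and> snd s (e + 1) = 1)
      (Seq (lefts 1 (e + 1)) (sweep r (length vs) (e + 2)))
      (\<lambda>x s. setp r (snd s r + (length x + 2) ^ length vs) (setp (e + 1) 0 s))"
    by (rule det_conv) (use e in auto)
  have "det ?P (Seq (compare e 0 v (e + 2) (e + 1) lessb)
      (Cond (e + 1) (e + 1) (\<lambda>a _. a \<noteq> 3) (Seq (lefts 1 (e + 1)) (sweep r (length vs) (e + 2))) Skip))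
    (\<lambda>x s. (\<lambda>x s. if test (e + 1) (e + 1) (\<lambda>a _. a \<noteq> 3) s
        then setp r (snd s r + (length x + 2) ^ length vs) (setp (e + 1) 0 s) else s) x
      (setp (e + 1) (if snd s e < snd s v then Suc (snd s (e + 1)) else snd s (e + 1)) s))"
    by (rule det_Seq[where Q = "\<lambda>x s. contents x (fst s) \<and> zero (e + 2) (snd s) \<and> snd s (e + 1) \<le> 1",
          OF det_conv[OF det_less] det_Cond[OF det_conv[OF 1] det_Skip]])
       (use e in \<open>auto simp: zeroD test_def contents_eq_3 intro: zero_mono\<close>)
  then have body: "does ?P (Seq (compare e 0 v (e + 2) (e + 1) lessb)
      (Cond (e + 1) (e + 1) (\<lambda>a _. a \<noteq> 3) (Seq (lefts 1 (e + 1)) (sweep r (length vs) (e + 2))) Skip))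
    (\<lambda>x s s'. s' = (if snd s e < snd s v then setp r (snd s r + (length x + 2) ^ length vs) s else s))"
    unfolding det_def[symmetric]
    by (rule det_conv) (use e in \<open>auto simp: zeroD test_def contents_eq_3\<close>)
  \<comment> \<open>After \<open>u\<close> rounds, \<open>min u (snd s0 v)\<close> of them have met
    a position below the digit.\<close>
  have "does (\<lambda>x s. contents x (fst s) \<and> zero e (snd s) \<and> snd s v < length x + 2)
     (For e (Seq (compare e 0 v (e + 2) (e + 1) lessb)
      (Cond (e + 1) (e + 1) (\<lambda>a _. a \<noteq> 3) (Seq (lefts 1 (e + 1)) (sweep r (length vs) (e + 2))) Skip)))
     (\<lambda>x s s'. fst s' e = cell x \<and> snd s' e = 0 \<and>
        s' = setp r (snd s r + min (length x + 2) (snd s v) * (length x + 2) ^ length vs) s)"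
    by (rule does_For[OF body, where J = "\<lambda>x s0 u s. s = setp r (snd s0 r + min u (snd s0 v) * (length x + 2) ^ length vs) s0"])
       (use e in \<open>auto simp: zeroD contents_cell setp_eq_iff fun_eq_iff min_def intro: zero_mono\<close>)
  then have 2: "det (\<lambda>x s. contents x (fst s) \<and> zero e (snd s) \<and> snd s v < length x + 2)
     (For e (Seq (compare e 0 v (e + 2) (e + 1) lessb)
      (Cond (e + 1) (e + 1) (\<lambda>a _. a \<noteq> 3) (Seq (lefts 1 (e + 1)) (sweep r (length vs) (e + 2))) Skip)))
     (\<lambda>x s. setp r (snd s r + snd s v * (length x + 2) ^ length vs) s)"
    unfolding det_def by (rule does_weaken) auto
  have map: "map (p(r := u)) vs = map p vs" for p :: "nat \<Rightarrow> nat" and u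
    using e by auto
  show ?case
    unfolding advance.simps
    by (rule det_conv[OF det_Seq[where P = "\<lambda>x s. contents x (fst s) \<and> zero e (snd s) \<and> snd s v < length x + 2 \<and>
          (\<forall>v\<in>set vs. snd s v < length x + 2)", OF det_conv[OF 2] Cons.IH]])
       (use Cons.prems e in \<open>auto simp: map add.assoc\<close>)
qed

end

lemma det_pre: "det P c F \<Longrightarrow> (\<And>x s. P' x s \<Longrightarrow> P x s) \<Longrightarrow> det P' c F"
  by (erule det_conv) auto

context fixpoint_system begin

lemma zero_upd_same [simp]: "zero d (p(d := v)) \<longleftrightarrow> v = 0 \<and> zero (Suc d) p"
proof
  assume *: "zero d (p(d := v))"
  show "v = 0 \<and> zero (Suc d) p"
    using * unfolding zero_def by (metis Suc_leD fun_upd_apply le_refl not_less_eq_eq)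
next
  assume "v = 0 \<and> zero (Suc d) p"
  then show "zero d (p(d := v))"
    unfolding zero_def by (metis fun_upd_apply le_neq_implies_less Suc_leI)
qed

lemma zero_from_Suc: "zero (Suc d) p \<Longrightarrow> p d = 0 \<Longrightarrow> zero d p"
  unfolding zero_def by (metis le_neq_implies_less Suc_leI)

lemma zero_SucI: "zero d p \<Longrightarrow> zero (Suc d) p"
  by (auto simp: zero_def)

lemma good_setp [simp]: "good x s \<Longrightarrow> \<not> tab i \<Longrightarrow> v < length x + 2 \<Longrightarrow> good x (setp i v s)"
  by (auto simp: good_def)

lemma goodD: "good x s \<Longrightarrow> contents x (fst s)" "good x s \<Longrightarrow> \<not> tab i \<Longrightarrow> snd s i < length x + 2"
    "good x s \<Longrightarrow> tab i \<Longrightarrow> snd s i = 0"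
  by (auto simp: good_def bounded_def)

lemma goodD': "good x (c, p) \<Longrightarrow> contents x c" "good x (c, p) \<Longrightarrow> \<not> tab i \<Longrightarrow> p i < length x + 2"
    "good x (c, p) \<Longrightarrow> tab i \<Longrightarrow> p i = 0"
  by (auto simp: good_def bounded_def)

lemma good_eq_3: "good x (c, p) \<Longrightarrow> c i v = 3 \<longleftrightarrow> v = 0"
  using contents_eq_3[of x c i v] by (simp add: good_def)

definition interp :: "bool list \<Rightarrow> (nat \<Rightarrow> nat \<Rightarrow> nat) \<Rightarrow> (nat \<times> nat list) set" where
  "interp x c = {(r, vs). r < R \<and> length vs = ar r \<and> set vs \<subseteq> {..<length x + 2} \<and>
     c (Suc r) (Suc (index (length x + 2) vs)) = 1}"

lemma det_goto:
  assumes "tab r" "R < e" "\<forall>v\<in>set vs. \<not> tab v \<and> v < e"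
  shows "det (\<lambda>x s. contents x (fst s) \<and> zero e (snd s) \<and> (\<forall>v\<in>set vs. snd s v < length x + 2)) (goto r vs e)
    (\<lambda>x s. setp r (Suc (snd s r + index (length x + 2) (map (snd s) vs))) s)"
proof -
  have r: "r < e" "\<forall>v\<in>set vs. v \<noteq> r"
    using assms by (auto simp: tab_def)
  then have map: "map (p(r := u)) vs = map p vs" for p :: "nat \<Rightarrow> nat" and u
    by auto
  show ?thesis
    unfolding goto_def
    by (rule det_conv[OF det_Seq[where P = "\<lambda>x s. contents x (fst s) \<and> zero e (snd s) \<and>
          (\<forall>v\<in>set vs. snd s v < length x + 2)", OF det_pre[OF det_Right] det_advance[OF assms]]])
       (use r in \<open>auto simp: map\<close>)
qed

text \<open>All heads but \<open>d\<close> end where they started, so evaluations can be nested.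
  Both \<rho> and \<open>d\<close> vary in the induction, since a quantifier puts its variable on
  tape \<open>d + 1\<close> and evaluates its body from \<open>d + 2\<close> on.\<close>

lemma det_ev:
  assumes "wff R ar \<psi>" "R < d" "\<forall>i. \<rho> i < d \<and> \<not> tab (\<rho> i)"
  shows "det (\<lambda>x s. good x s \<and> zero d (snd s)) (ev \<psi> \<rho> d)
    (\<lambda>x s. setp d (if sat x (interp x (fst s)) (snd s \<circ> \<rho>) \<psi> then 1 else 0) s)"
  using assms
proof (induction \<psi> arbitrary: \<rho> d)
  case (Chr i n a)
  have d: "\<rho> i \<noteq> d" "\<not> tab (\<rho> i)" using Chr.prems by (auto simp: less_imp_neq)
  have c: "c (\<rho> i) = cell x" if "good x (c, p)" for x c p
    using that d by (auto simp: good_def contents_cell)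
  show ?case unfolding ev.simps
    by (rule det_conv[OF det_Seq[where P = "\<lambda>x s. good x s \<and> zero d (snd s)" and
          Q = "\<lambda>x s. contents x (fst s) \<and> n \<le> snd s (\<rho> i)", OF det_pre[OF det_rights]
          det_Seq[where Q = "\<lambda>x s. contents x (fst s) \<and> n \<le> snd s (\<rho> i)",
            OF det_Cond[OF det_Right det_Skip] det_lefts]]])
       (use d in \<open>auto simp: goodD zeroD setp_def c fun_eq_iff\<close>)
next
  case (Off i n j)
  have d: "\<rho> i \<noteq> d" "\<rho> j \<noteq> d" "\<rho> i \<noteq> Suc d" "\<rho> j \<noteq> Suc d" "\<not> tab (\<rho> j)"
    using Off.prems less_imp_neq less_SucI by blast+
  show ?case
  proof (cases "\<rho> i = \<rho> j")
    case True
    show ?thesis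
      by (cases "n = 0") (use True in \<open>auto simp: zeroD intro: det_conv[OF det_Right] det_conv[OF det_Skip]\<close>)
  next
    case False
    then show ?thesis
      unfolding ev.simps by (simp, intro det_conv[OF det_off])
        (use d in \<open>auto simp: goodD zeroD\<close>)
  qed
next
  case (Lt i j)
  have d: "\<rho> i \<noteq> d" "\<rho> j \<noteq> d" "\<rho> i \<noteq> Suc d" "\<rho> j \<noteq> Suc d" "\<not> tab (\<rho> j)"
    using Lt.prems less_imp_neq less_SucI by blast+
  show ?case
  proof (cases "\<rho> i = \<rho> j")
    case True
    then show ?thesis by (auto simp: zeroD intro: det_conv[OF det_Skip])
  next
    case False
    then show ?thesis
      unfolding ev.simps by (simp, intro det_conv[OF det_less])
        (use d in \<open>auto simp: goodD zeroD\<close>)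
  qed
next
  case (Rel r vs)
  have r: "tab (Suc r)" "d \<noteq> Suc r" "r < R" "length vs = ar r" "\<not> tab d" using Rel.prems by (auto simp: tab_def)
  have vs: "\<forall>v\<in>set (map \<rho> vs). \<not> tab v \<and> v < d + 1" using Rel.prems by (simp add: less_SucI)
  have map: "map (snd s) (map \<rho> vs) = map (snd s \<circ> \<rho>) vs" for s :: state by simp
  have sub: "set (map (snd s \<circ> \<rho>) vs) \<subseteq> {..<length x + 2}" if "good x s" for x s
    using that Rel.prems by (auto simp: goodD)
  \<comment> \<open>The address is polynomially bounded, which pays for the way back.\<close>
  have ix: "Suc (index (length x + 2) (map (snd s \<circ> \<rho>) vs)) \<le> (length x + 2) ^ ar r" if "good x s" for x s
    using index_less[OF sub[OF that]] r by simp
  have in_interp: "c (Suc r) (Suc (index (length x + 2) (map (p \<circ> \<rho>) vs))) = Suc 0 \<longleftrightarrow>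
      (r, map (\<lambda>a. p (\<rho> a)) vs) \<in> interp x c" if "good x (c, p)" for x c p
    using sub[OF that] r by (simp add: interp_def o_def)
  show ?case unfolding ev.simps
    by (rule det_conv[OF det_Seq[where P = "\<lambda>x s. good x s \<and> zero d (snd s)" and
          Q = "\<lambda>x s. contents x (fst s) \<and> snd s (Suc r) \<le> (length x + 2) ^ ar r",
          OF det_pre[OF det_goto]
          det_Seq[where Q = "\<lambda>x s. contents x (fst s) \<and> snd s (Suc r) \<le> (length x + 2) ^ ar r",
            OF det_Cond[OF det_Right det_Skip] det_home[where k = "ar r"]]]])
       (use r vs Rel.prems(2) ix in \<open>auto simp: goodD' zeroD in_interp zero_SucI fun_eq_iff setp_def\<close>)
next
  case (And \<psi>1 \<psi>2)
  have d: "\<not> tab d" using And.prems by (auto simp: tab_def)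
  have \<rho>: "\<rho> i \<noteq> d" for i
    using And.prems(3) less_imp_neq by blast
  let ?Q = "\<lambda>x s. good x s \<and> zero (Suc d) (snd s) \<and> snd s d \<le> 1"
  have 1: "det (\<lambda>x s. good x s \<and> zero d (snd s)) (ev \<psi>1 \<rho> d)
    (\<lambda>x s. setp d (if sat x (interp x (fst s)) (snd s \<circ> \<rho>) \<psi>1 then 1 else 0) s)"
    using And.prems by (intro And.IH) auto
  have 2: "det (\<lambda>x s. good x s \<and> zero d (snd s)) (ev \<psi>2 \<rho> d)
    (\<lambda>x s. setp d (if sat x (interp x (fst s)) (snd s \<circ> \<rho>) \<psi>2 then 1 else 0) s)"
    using And.prems by (intro And.IH) auto
  show ?case unfolding ev.simps
    by (rule det_conv[OF det_Seq[where P = "\<lambda>x s. good x s \<and> zero d (snd s)" and Q = ?Q,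
          OF 1 det_Cond[where P = ?Q, OF det_Seq[OF det_pre[OF det_lefts] 2] det_Skip]]])
       (use d in \<open>auto simp: \<rho> o_def goodD' good_eq_3 zeroD zero_SucI test_def\<close>)
next
  case (Or \<psi>1 \<psi>2)
  have d: "\<not> tab d" using Or.prems by (auto simp: tab_def)
  have \<rho>: "\<rho> i \<noteq> d" for i
    using Or.prems(3) less_imp_neq by blast
  let ?Q = "\<lambda>x s. good x s \<and> zero (Suc d) (snd s) \<and> snd s d \<le> 1"
  have 1: "det (\<lambda>x s. good x s \<and> zero d (snd s)) (ev \<psi>1 \<rho> d)
    (\<lambda>x s. setp d (if sat x (interp x (fst s)) (snd s \<circ> \<rho>) \<psi>1 then 1 else 0) s)"
    using Or.prems by (intro Or.IH) auto
  have 2: "det (\<lambda>x s. ?Q x s \<and> \<not> test d d (\<lambda>a _. a \<noteq> 3) s) (ev \<psi>2 \<rho> d)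
    (\<lambda>x s. setp d (if sat x (interp x (fst s)) (snd s \<circ> \<rho>) \<psi>2 then 1 else 0) s)"
  proof (rule det_pre)
    show "det (\<lambda>x s. good x s \<and> zero d (snd s)) (ev \<psi>2 \<rho> d)
      (\<lambda>x s. setp d (if sat x (interp x (fst s)) (snd s \<circ> \<rho>) \<psi>2 then 1 else 0) s)"
      using Or.prems by (intro Or.IH) auto
  qed (auto simp: test_def good_eq_3 intro: zero_from_Suc)
  show ?case unfolding ev.simps
    by (rule det_conv[OF det_Seq[where P = "\<lambda>x s. good x s \<and> zero d (snd s)" and Q = ?Q,
          OF 1 det_Cond[where P = ?Q, OF det_Skip 2]]])
       (use d in \<open>auto simp: \<rho> o_def goodD' good_eq_3 zeroD zero_SucI test_def\<close>)
next
  case (Ex i \<psi>)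
  let ?\<rho> = "\<rho>(i := d + 1)"
  let ?sat = "\<lambda>x s v. sat x (interp x (fst s)) ((snd s \<circ> \<rho>)(i := v)) \<psi>"
  have d: "\<not> tab d" "\<not> tab (d + 1)" "\<not> tab (d + 2)" using Ex.prems by (auto simp: tab_def)
  have 1: "det (\<lambda>x s. good x s \<and> zero (d + 2) (snd s)) (ev \<psi> ?\<rho> (d + 2))
    (\<lambda>x s. setp (d + 2) (if sat x (interp x (fst s)) (snd s \<circ> ?\<rho>) \<psi> then 1 else 0) s)"
    using Ex.prems d by (intro Ex.IH) (auto simp: trans_less_add1)
  have z: "zero (d + 2) p \<Longrightarrow> zero (3 + d) p" "zero d p \<Longrightarrow> zero (d + 2) p" for p
    by (auto simp: zero_def)
  let ?Q = "\<lambda>x s. good x s \<and> zero (Suc (d + 2)) (snd s) \<and> snd s (d + 2) \<le> 1"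
  have 2: "det (\<lambda>x s. good x s \<and> zero (d + 2) (snd s))
      (Seq (ev \<psi> ?\<rho> (d + 2)) (Cond (d + 2) (d + 2) (\<lambda>a _. a \<noteq> 3)
        (Seq (lefts 1 (d + 2)) (Cond d d (\<lambda>a _. a \<noteq> 3) Skip (Right d))) Skip))
      (\<lambda>x s. if sat x (interp x (fst s)) (snd s \<circ> ?\<rho>) \<psi> then setp d (if snd s d = 0 then 1 else snd s d) s else s)"
    by (rule det_conv[OF det_Seq[where P = "\<lambda>x s. good x s \<and> zero (d + 2) (snd s)" and Q = ?Q,
          OF 1 det_Cond[where P = ?Q, OF det_Seq[where Q = "\<lambda>x s. good x s", OF det_pre[OF det_lefts]
              det_Cond[OF det_Skip det_Right]] det_Skip]]])
       (use d in \<open>auto simp: o_def goodD' good_eq_3 zeroD test_def z\<close>)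
  have \<rho>: "p(d := v, Suc d := u) \<circ> \<rho>(i := Suc d) = (p \<circ> \<rho>)(i := u)" for p :: "nat \<Rightarrow> nat" and u v
  proof -
    have "\<rho> j \<noteq> d" "\<rho> j \<noteq> Suc d" for j
      using Ex.prems(3) less_imp_neq less_SucI by blast+
    then show ?thesis by (auto simp: fun_eq_iff)
  qed
  have "does (\<lambda>x s. good x s \<and> zero d (snd s)) (ev (Ex i \<psi>) \<rho> d)
      (\<lambda>x s s'. fst s' (d + 1) = cell x \<and> snd s' (d + 1) = 0 \<and>
        s' = setp d (if \<exists>v<length x + 2. ?sat x s v then 1 else 0) s)"
    unfolding ev.simps
  proof (rule does_For[OF 2[unfolded det_def], where
          J = "\<lambda>x s0 u s. s = setp d (if \<exists>v<u. ?sat x s0 v then 1 else 0) s0"])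
    fix x s assume "good x s \<and> zero d (snd s)"
    then show "fst s (d + 1) = cell x \<and> snd s (d + 1) = 0 \<and>
        s = setp d (if \<exists>v<0. ?sat x s v then 1 else 0) s"
      using d by (auto simp: zeroD goodD contents_cell)
  next
    fix x s0 v s s'
    assume s0: "good x s0 \<and> zero d (snd s0)" and s: "s = setp d (if \<exists>u<v. ?sat x s0 u then 1 else 0) s0"
      and v: "v < length x + 2"
    have "good x (setp (d + 1) v s)" unfolding s using s0 d v by auto
    moreover have "zero (d + 2) (snd (setp (d + 1) v s))" unfolding s using s0 z by simp
    moreover have "fst s' (d + 1) = cell x \<and> snd s' (d + 1) = v \<and>
        setp (d + 1) 0 s' = setp d (if \<exists>u<Suc v. ?sat x s0 u then 1 else 0) s0"
      if "s' = (if sat x (interp x (fst (setp (d + 1) v s))) (snd (setp (d + 1) v s) \<circ> ?\<rho>) \<psi>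
        then setp d (if snd (setp (d + 1) v s) d = 0 then 1 else snd (setp (d + 1) v s) d) (setp (d + 1) v s)
        else setp (d + 1) v s)"
    proof -
      have "snd s0 (d + 1) = 0" "fst s0 (d + 1) = cell x"
        using s0 d by (auto simp: zeroD goodD contents_cell)
      then show ?thesis
        using that unfolding s by (auto simp: \<rho> less_Suc_eq setp_eq_iff fun_eq_iff)
    qed
    ultimately show "(good x (setp (d + 1) v s) \<and> zero (d + 2) (snd (setp (d + 1) v s))) \<and>
      (s' = (if sat x (interp x (fst (setp (d + 1) v s))) (snd (setp (d + 1) v s) \<circ> ?\<rho>) \<psi>
        then setp d (if snd (setp (d + 1) v s) d = 0 then 1 else snd (setp (d + 1) v s) d) (setp (d + 1) v s)
        else setp (d + 1) v s) \<longrightarrow> fst s' (d + 1) = cell x \<and> snd s' (d + 1) = v \<and>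
        setp (d + 1) 0 s' = setp d (if \<exists>u<Suc v. ?sat x s0 u then 1 else 0) s0)"
      by blast
  qed
  then show ?case unfolding det_def sat.simps by (rule does_weaken) auto
qed

end

section \<open>Saturating the tables up to the least fixed point\<close>

fun nest :: "nat \<Rightarrow> nat \<Rightarrow> prog \<Rightarrow> prog" where
  "nest d 0 c = c"
| "nest d (Suc n) c = For d (nest (Suc d) n c)"

context fixpoint_system begin

text \<open>Missing variables are 0, matching a spare head that rests on the marker.\<close>

definition env :: "nat list \<Rightarrow> nat \<Rightarrow> nat" where
  "env vs i = (if i < length vs then vs ! i else 0)"

definition consequences :: "bool list \<Rightarrow> (nat \<times> nat list) set \<Rightarrow> (nat \<times> nat list) set" where
  "consequences x S = {(r, vs). r < R \<and> length vs = ar r \<and> set vs \<subseteq> {..<length x + 2} \<and>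
     sat x S (env vs) (\<phi> r)}"

definition meaning :: "bool list \<Rightarrow> (nat \<times> nat list) set" where
  "meaning x = lfp (consequences x)"

lemma mono_consequences: "mono (consequences x)"
  by (rule monoI) (auto simp: consequences_def intro: sat_mono)

lemma meaning_unfold: "meaning x = consequences x (meaning x)"
  unfolding meaning_def by (rule lfp_unfold[OF mono_consequences])

lemma interp_insert:
  assumes "r < R" "length vs = ar r" "set vs \<subseteq> {..<length x + 2}"
  shows "interp x (c(Suc r := (c (Suc r))(Suc (index (length x + 2) vs) := 1))) = insert (r, vs) (interp x c)"
  using assms index_inject[of _ vs "length x + 2"] by (auto simp: interp_def split: if_splits)

definition tuples :: "bool list \<Rightarrow> (nat \<times> nat list) set" where
  "tuples x = (SIGMA r:{..<R}. {vs. set vs \<subseteq> {..<length x + 2} \<and> length vs = ar r})"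

text \<open>An exponent for which \<open>(length x + 2) ^ H\<close> rounds suffice: the summand
  \<open>R\<close> absorbs the number of relations, and the sum bounds every single arity.\<close>

definition H :: nat where
  "H = R + (\<Sum>r<R. ar r)"

lemma finite_tuples: "finite (tuples x)"
  unfolding tuples_def by (intro finite_SigmaI finite_lists_length_eq) auto

lemma card_tuples: "card (tuples x) \<le> (length x + 2) ^ H"
proof -
  let ?B = "length x + 2" and ?h = "\<Sum>r<R. ar r"
  have "card (tuples x) = (\<Sum>r<R. ?B ^ ar r)"
    unfolding tuples_def by (subst card_SigmaI) (auto simp: finite_lists_length_eq card_lists_length_eq)
  also have "\<dots> \<le> (\<Sum>r<R. ?B ^ ?h)"
    by (intro sum_mono power_increasing member_le_sum) auto
  also have "\<dots> = R * ?B ^ ?h" by simp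
  also have "R \<le> ?B ^ R"
    using less_exp[of R] power_mono[of 2 "?B" R] by linarith
  then have "R * ?B ^ ?h \<le> ?B ^ R * ?B ^ ?h" by (rule mult_le_mono1)
  also have "\<dots> = ?B ^ H" by (simp add: H_def power_add)
  finally show ?thesis .
qed

lemma interp_subset: "interp x c \<subseteq> tuples x"
  by (auto simp: interp_def tuples_def)

lemma consequences_subset: "consequences x S \<subseteq> tuples x"
  by (auto simp: consequences_def tuples_def)

lemma meaning_subset: "meaning x \<subseteq> tuples x"
  using meaning_unfold consequences_subset by metis

text \<open>Invariant of a computation that only adds facts: none is lost, and none outside the
  least fixed point is added as long as the start lies inside it.\<close>

definition extends :: "bool list \<Rightarrow> state \<Rightarrow> state \<Rightarrow> bool" where
  "extends x s s' \<longleftrightarrow> snd s' = snd s \<and> contents x (fst s') \<and> interp x (fst s) \<subseteq> interp x (fst s') \<and>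
     (interp x (fst s) \<subseteq> meaning x \<longrightarrow> interp x (fst s') \<subseteq> meaning x)"

lemma extends_refl: "good x s \<Longrightarrow> extends x s s"
  by (auto simp: extends_def good_def)

lemma extends_trans: "extends x s s' \<Longrightarrow> extends x s' s'' \<Longrightarrow> extends x s s''"
  by (auto simp: extends_def)

lemma extends_good: "extends x s s' \<Longrightarrow> good x s \<Longrightarrow> good x s'"
  by (auto simp: extends_def good_def)

lemma extends_setp:
  "extends x (setp i v s) s' \<Longrightarrow> snd s i = w \<Longrightarrow> extends x s (setp i w s')"
  by (auto simp: extends_def)

lemma good_upd: "good x (c, p) \<Longrightarrow> \<not> tab i \<Longrightarrow> v < length x + 2 \<Longrightarrow> good x (c, p(i := v))"
  by (simp add: good_def)

text \<open>The heads from \<open>d\<close> on hold the tuple, \<open>z\<close> is a head at 0 for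
  the variables beyond the arity, and \<open>e\<close> receives the truth value.\<close>

definition record_fact :: "nat \<Rightarrow> nat \<Rightarrow> prog" where
  "record_fact r d = (let z = d + ar r; e = Suc z in
     Seq (ev (\<phi> r) (\<lambda>i. if i < ar r then d + i else z) e)
       (Cond e e (\<lambda>a _. a \<noteq> 3) (Seq (lefts 1 e)
         (Seq (goto (Suc r) [d..<z] e) (Seq (Mark (Suc r)) (home (Suc r))))) Skip))"

lemma det_Mark:
  "det (\<lambda>x s. contents x (fst s) \<and> snd s i > 0) (Mark i)
    (\<lambda>x s. ((fst s)(i := (fst s i)(snd s i := 1)), snd s))"
  by (rule detI[OF poly_bounded_const[of 1]]) (metis runs_Mark prod.collapse contents_eq_3 less_irrefl)

lemma contents_mark:
  "contents x c \<Longrightarrow> tab i \<Longrightarrow> v > 0 \<Longrightarrow> contents x (c(i := (c i)(v := 1)))"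
  by (auto simp: contents_def)

lemma det_record_fact:
  assumes "r < R" "R < d"
  defines "vs \<equiv> \<lambda>p. map p [d..<d + ar r]"
  shows "det (\<lambda>x s. good x s \<and> zero (d + ar r) (snd s)) (record_fact r d)
    (\<lambda>x s. if sat x (interp x (fst s)) (env (vs (snd s))) (\<phi> r)
       then ((fst s)(Suc r := (fst s (Suc r))(Suc (index (length x + 2) (vs (snd s))) := 1)), snd s)
       else s)"
proof -
  define z where "z = d + ar r"
  define e where "e = Suc z"
  let ?\<rho> = "\<lambda>i. if i < ar r then d + i else z"
  let ?c = "\<lambda>x s. (fst s)(Suc r := (fst s (Suc r))(Suc (index (length x + 2) (vs (snd s))) := 1))"
  have t: "tab (Suc r)" "\<not> tab e" "R < e" "Suc r \<noteq> e" "R < z"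
    using assms by (auto simp: tab_def e_def z_def)
  have \<rho>: "\<forall>i. ?\<rho> i < e \<and> \<not> tab (?\<rho> i)" using assms by (auto simp: e_def z_def tab_def)
  have 1: "det (\<lambda>x s. good x s \<and> zero e (snd s)) (ev (\<phi> r) ?\<rho> e)
    (\<lambda>x s. setp e (if sat x (interp x (fst s)) (snd s \<circ> ?\<rho>) (\<phi> r) then 1 else 0) s)"
    by (rule det_ev[OF wff[OF assms(1)] t(3) \<rho>])
  have vs_e: "\<forall>v\<in>set [d..<z]. \<not> tab v \<and> v < e" using assms by (auto simp: tab_def e_def z_def)
  have env: "p \<circ> ?\<rho> = env (vs p)" if "zero z p" for p
    using zeroD[OF that, of z] by (auto simp: fun_eq_iff vs_def env_def z_def)
  have vs: "vs (p(i := u)) = vs p" if "i \<notin> {d..<z}" for p i u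
    using that by (auto simp: vs_def z_def)
  have ix: "Suc (index (length x + 2) (vs p)) \<le> (length x + 2) ^ ar r" if "good x (c, p)" for x c p
  proof -
    have "set (vs p) \<subseteq> {..<length x + 2}"
      using goodD'(2)[OF that] assms by (auto simp: vs_def tab_def)
    from index_less[OF this] show ?thesis by (simp add: vs_def)
  qed
  have "det (\<lambda>x s. contents x (fst s) \<and> zero e (snd s) \<and> (\<forall>v\<in>set [d..<z]. snd s v < length x + 2) \<and>
       snd s (Suc r) = 0 \<and> Suc (index (length x + 2) (vs (snd s))) \<le> (length x + 2) ^ ar r)
     (Seq (goto (Suc r) [d..<z] e) (Seq (Mark (Suc r)) (home (Suc r))))
     (\<lambda>x s. setp (Suc r) 0 (?c x s, (snd s)(Suc r := 0)))"
    by (rule det_conv[OF det_Seq[where P = "\<lambda>x s. contents x (fst s) \<and> zero e (snd s) \<and>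
         (\<forall>v\<in>set [d..<z]. snd s v < length x + 2) \<and> snd s (Suc r) = 0 \<and>
         Suc (index (length x + 2) (vs (snd s))) \<le> (length x + 2) ^ ar r"
         and Q = "\<lambda>x s. contents x (fst s) \<and> 0 < snd s (Suc r) \<and> snd s (Suc r) \<le> (length x + 2) ^ ar r",
         OF det_pre[OF det_goto[OF t(1) t(3) vs_e]] det_Seq[where Q = "\<lambda>x s. contents x (fst s) \<and>
           snd s (Suc r) \<le> (length x + 2) ^ ar r", OF det_pre[OF det_Mark] det_home]]])
      (use t in \<open>auto simp: contents_mark[unfolded One_nat_def] setp_def fun_eq_iff vs_def z_def\<close>)
  then have 2: "det (\<lambda>x s. contents x (fst s) \<and> zero e (snd s) \<and> (\<forall>v\<in>set [d..<z]. snd s v < length x + 2) \<and>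
       snd s (Suc r) = 0 \<and> Suc (index (length x + 2) (vs (snd s))) \<le> (length x + 2) ^ ar r)
     (Seq (goto (Suc r) [d..<z] e) (Seq (Mark (Suc r)) (home (Suc r)))) (\<lambda>x s. (?c x s, snd s))"
    by (rule det_conv) (auto simp: setp_def)
  let ?Q = "\<lambda>x s. good x s \<and> zero (Suc e) (snd s) \<and> zero z ((snd s)(e := 0)) \<and> snd s e \<le> 1"
  have vs_tab: "\<not> tab v" if "d \<le> v" for v using that assms by (auto simp: tab_def)
  have zz: "zero z p \<Longrightarrow> zero e p" for p by (auto simp: e_def zero_SucI)
  have 3: "det ?Q (Cond e e (\<lambda>a _. a \<noteq> 3) (Seq (lefts 1 e)
         (Seq (goto (Suc r) [d..<z] e) (Seq (Mark (Suc r)) (home (Suc r))))) Skip)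
       (\<lambda>x s. if snd s e \<noteq> 0 then (?c x s, (snd s)(e := 0)) else s)"
    by (rule det_conv[OF det_Cond[where P = ?Q, OF det_Seq[OF det_pre[OF det_lefts] 2] det_Skip]])
      (use t vs_tab in \<open>auto simp: test_def good_eq_3 goodD' vs ix e_def setp_def\<close>)
  show ?thesis unfolding record_fact_def Let_def z_def[symmetric] e_def[symmetric]
    by (rule det_conv[OF det_Seq[where P = "\<lambda>x s. good x s \<and> zero z (snd s)" and Q = ?Q,
          OF det_pre[OF 1] 3]])
      (use t in \<open>auto simp: env vs zz zero_SucI zeroD setp_def e_def good_upd\<close>)
qed

text \<open>The tables grow while a round is running. The claim is made for every \<open>S\<close>
  already contained in them: by monotonicity, what follows from the facts present at the start of a
  round is still found later in it.\<close>

lemma does_record_fact: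
  assumes "r < R" "R < d"
  shows "does (\<lambda>x s. good x s \<and> zero (d + ar r) (snd s)) (record_fact r d)
    (\<lambda>x s s'. extends x s s' \<and> (\<forall>S\<subseteq>interp x (fst s).
       (r, map (snd s) [d..<d + ar r]) \<in> consequences x S \<longrightarrow>
       (r, map (snd s) [d..<d + ar r]) \<in> interp x (fst s')))"
  using det_record_fact[OF assms] unfolding det_def
proof (rule does_weaken)
  fix x and s s' :: state
  let ?vs = "map (snd s) [d..<d + ar r]"
  assume g: "good x s \<and> zero (d + ar r) (snd s)"
    and s': "s' = (if sat x (interp x (fst s)) (env ?vs) (\<phi> r)
      then ((fst s)(Suc r := (fst s (Suc r))(Suc (index (length x + 2) ?vs) := 1)), snd s) else s)"
  have vs: "set ?vs \<subseteq> {..<length x + 2}"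
    using assms goodD(2)[of x s] g by (auto simp: tab_def)
  show "extends x s s' \<and> (\<forall>S\<subseteq>interp x (fst s). (r, ?vs) \<in> consequences x S \<longrightarrow> (r, ?vs) \<in> interp x (fst s'))"
  proof (cases "sat x (interp x (fst s)) (env ?vs) (\<phi> r)")
    case True
    have i: "interp x (fst s') = insert (r, ?vs) (interp x (fst s))"
      unfolding s' using True interp_insert[OF assms(1) _ vs] by simp
    have "(r, ?vs) \<in> consequences x (interp x (fst s))"
      using True vs assms by (simp add: consequences_def)
    then have "interp x (fst s) \<subseteq> meaning x \<Longrightarrow> (r, ?vs) \<in> meaning x"
      using meaning_unfold monoD[OF mono_consequences] by blast
    moreover have "contents x (fst s')"
      unfolding s' using True g assms by (auto simp: tab_def intro!: contents_mark[unfolded One_nat_def] goodD)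
    ultimately show ?thesis using i True by (auto simp: extends_def s')
  next
    case False
    then have "(r, ?vs) \<notin> consequences x S" if "S \<subseteq> interp x (fst s)" for S
      using that sat_mono by (auto simp: consequences_def)
    then show ?thesis using False g by (auto simp: s' extends_refl)
  qed
qed auto

text \<open>The loops visit every assignment \<open>p\<close> of positions to the \<open>n\<close>
  heads from \<open>d\<close> on. \<open>G\<close> and \<open>K\<close> abstract from the premise
  and the fact that belong to an assignment.\<close>

lemma does_nest:
  assumes "R < d"
    and body: "does (\<lambda>x s. good x s \<and> zero (d + n) (snd s)) c
      (\<lambda>x s s'. extends x s s' \<and> (\<forall>S\<subseteq>interp x (fst s). G x S (snd s) \<longrightarrow> K x (snd s) \<in> interp x (fst s')))"
  shows "does (\<lambda>x s. good x s \<and> zero d (snd s)) (nest d n c)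
      (\<lambda>x s s'. extends x s s' \<and> (\<forall>S\<subseteq>interp x (fst s). \<forall>p. (\<forall>i. if i \<in> {d..<d + n} then p i < length x + 2
        else p i = snd s i) \<longrightarrow> G x S p \<longrightarrow> K x p \<in> interp x (fst s')))"
  using assms
proof (induction n arbitrary: d)
  case 0
  then show ?case by (auto elim!: does_weaken simp: fun_eq_iff[symmetric])
next
  case (Suc n)
  have t: "\<not> tab d" using Suc.prems by (simp add: tab_def)
  have IH: "does (\<lambda>x s. good x s \<and> zero (Suc d) (snd s)) (nest (Suc d) n c)
      (\<lambda>x s s'. extends x s s' \<and> (\<forall>S\<subseteq>interp x (fst s). \<forall>p. (\<forall>i. if i \<in> {Suc d..<Suc d + n} then p i < length x + 2
        else p i = snd s i) \<longrightarrow> G x S p \<longrightarrow> K x p \<in> interp x (fst s')))"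
    using Suc.prems by (intro Suc.IH) auto
  let ?J = "\<lambda>x s v s'. extends x s s' \<and> (\<forall>S\<subseteq>interp x (fst s). \<forall>p. (\<forall>i. if i \<in> {d..<d + Suc n} then p i < length x + 2
        else p i = snd s i) \<longrightarrow> p d < v \<longrightarrow> G x S p \<longrightarrow> K x p \<in> interp x (fst s'))"
  have "does (\<lambda>x s. good x s \<and> zero d (snd s)) (nest d (Suc n) c)
      (\<lambda>x s s'. fst s' d = cell x \<and> snd s' d = 0 \<and> ?J x s (length x + 2) s')"
    unfolding nest.simps
  proof (rule does_For[OF IH, where J = ?J])
    fix x s assume "good x s \<and> zero d (snd s)"
    then show "fst s d = cell x \<and> snd s d = 0 \<and> ?J x s 0 s"
      using t by (auto simp: extends_refl contents_cell goodD zeroD)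
  next
    fix x s0 v s s'
    assume s0: "good x s0 \<and> zero d (snd s0)" and J: "?J x s0 v s" and d: "fst s d = cell x" "snd s d = 0"
      and v: "v < length x + 2"
    have "good x s" using J s0 extends_good by blast
    then have good: "good x (setp d v s)" using t v by simp
    have eq: "snd s = snd s0" using J by (simp add: extends_def)
    then have z: "zero (Suc d) (snd (setp d v s))" using s0 by (simp add: zero_SucI)
    have "fst s' d = cell x \<and> snd s' d = v \<and> ?J x s0 (Suc v) (setp d 0 s')"
      if Q: "extends x (setp d v s) s' \<and> (\<forall>S\<subseteq>interp x (fst (setp d v s)). \<forall>p. (\<forall>i. if i \<in> {Suc d..<Suc d + n}
        then p i < length x + 2 else p i = snd (setp d v s) i) \<longrightarrow> G x S p \<longrightarrow> K x p \<in> interp x (fst s'))"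
    proof -
      have e: "extends x s (setp d 0 s')" using Q d by (intro extends_setp[of x d v]) auto
      then have "extends x s0 (setp d 0 s')" using J extends_trans by blast
      moreover have "K x p \<in> interp x (fst (setp d 0 s'))"
        if S: "S \<subseteq> interp x (fst s0)" and p: "\<forall>i. if i \<in> {d..<d + Suc n} then p i < length x + 2 else p i = snd s0 i"
          and pd: "p d < Suc v" and G: "G x S p" for S p
      proof (cases "p d = v")
        case True
        have "\<forall>i. if i \<in> {Suc d..<Suc d + n} then p i < length x + 2 else p i = snd (setp d v s) i"
          using p True eq by (auto simp: less_Suc_eq_le dest!: spec)
        moreover have "S \<subseteq> interp x (fst (setp d v s))" using S J by (auto simp: extends_def)
        ultimately show ?thesis using Q G by simp
      next
        \<comment> \<open>An earlier round recorded the fact, and the tables only grow.\<close>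
        case False
        then have "K x p \<in> interp x (fst s)" using J S p pd G by (simp add: less_Suc_eq)
        then show ?thesis using e by (auto simp: extends_def)
      qed
      moreover have "fst s' d = cell x" using Q t contents_cell by (auto simp: extends_def)
      moreover have "snd s' d = v" using Q by (auto simp: extends_def)
      ultimately show ?thesis by blast
    qed
    then show "(good x (setp d v s) \<and> zero (Suc d) (snd (setp d v s))) \<and>
      (extends x (setp d v s) s' \<and> (\<forall>S\<subseteq>interp x (fst (setp d v s)). \<forall>p. (\<forall>i. if i \<in> {Suc d..<Suc d + n}
        then p i < length x + 2 else p i = snd (setp d v s) i) \<longrightarrow> G x S p \<longrightarrow> K x p \<in> interp x (fst s')) \<longrightarrow>
       fst s' d = cell x \<and> snd s' d = v \<and> ?J x s0 (Suc v) (setp d 0 s'))"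
      using good z by blast
  qed
  then show ?case
  proof (rule does_weaken)
    fix x s s' assume *: "fst s' d = cell x \<and> snd s' d = 0 \<and> ?J x s (length x + 2) s'"
    have "p d < length x + 2" if "\<forall>i. if i \<in> {d..<d + Suc n} then p i < length x + 2 else p i = snd s i" for p
      using spec[OF that, of d] by simp
    then show "extends x s s' \<and> (\<forall>S\<subseteq>interp x (fst s). \<forall>p. (\<forall>i. if i \<in> {d..<d + Suc n} then p i < length x + 2
        else p i = snd s i) \<longrightarrow> G x S p \<longrightarrow> K x p \<in> interp x (fst s'))"
      using * by blast
  qed auto
qed

definition update :: "nat \<Rightarrow> nat \<Rightarrow> prog" where
  "update d r = nest d (ar r) (record_fact r d)"

lemma does_update:
  assumes "r < R" "R < d"
  shows "does (\<lambda>x s. good x s \<and> zero d (snd s)) (update d r)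
    (\<lambda>x s s'. extends x s s' \<and> (\<forall>S\<subseteq>interp x (fst s). \<forall>vs. (r, vs) \<in> consequences x S \<longrightarrow> (r, vs) \<in> interp x (fst s')))"
proof -
  define P where "P d x S p \<longleftrightarrow> (r, map p [d..<d + ar r]) \<in> consequences x S" for d x S and p :: "nat \<Rightarrow> nat"
  define K :: "nat \<Rightarrow> bool list \<Rightarrow> (nat \<Rightarrow> nat) \<Rightarrow> nat \<times> nat list" where "K d x p = (r, map p [d..<d + ar r])" for d x p
  have "does (\<lambda>x s. good x s \<and> zero d (snd s)) (update d r)
      (\<lambda>x s s'. extends x s s' \<and> (\<forall>S\<subseteq>interp x (fst s). \<forall>p. (\<forall>i. if i \<in> {d..<d + ar r} then p i < length x + 2
        else p i = snd s i) \<longrightarrow> P d x S p \<longrightarrow> K d x p \<in> interp x (fst s')))"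
    unfolding update_def
    by (rule does_nest[OF assms(2)]) (use does_record_fact[OF assms] in \<open>simp add: P_def K_def\<close>)
  then show ?thesis
  proof (rule does_weaken)
    fix x and s s' :: state
    assume *: "extends x s s' \<and> (\<forall>S\<subseteq>interp x (fst s). \<forall>p. (\<forall>i. if i \<in> {d..<d + ar r} then p i < length x + 2
        else p i = snd s i) \<longrightarrow> P d x S p \<longrightarrow> K d x p \<in> interp x (fst s'))"
    have "(r, vs) \<in> interp x (fst s')" if S: "S \<subseteq> interp x (fst s)" and vs: "(r, vs) \<in> consequences x S" for S vs
    proof -
      define p where "p i = (if i \<in> {d..<d + ar r} then vs ! (i - d) else snd s i)" for i
      have len: "length vs = ar r" and b: "set vs \<subseteq> {..<length x + 2}"
        using vs by (auto simp: consequences_def)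
      have eq: "map p [d..<d + ar r] = vs"
        by (rule nth_equalityI) (auto simp: p_def len)
      have "\<forall>i. if i \<in> {d..<d + ar r} then p i < length x + 2 else p i = snd s i"
        using b len by (auto simp: p_def subset_iff)
      moreover have "P d x S p" using vs by (simp add: P_def eq)
      ultimately have "K d x p \<in> interp x (fst s')" using * S by blast
      then show ?thesis by (simp add: K_def eq)
    qed
    then show "extends x s s' \<and> (\<forall>S\<subseteq>interp x (fst s). \<forall>vs. (r, vs) \<in> consequences x S \<longrightarrow> (r, vs) \<in> interp x (fst s'))"
      using * by blast
  qed auto
qed

fun round :: "nat \<Rightarrow> nat list \<Rightarrow> prog" where
  "round d [] = Skip"
| "round d (r # rs) = Seq (update d r) (round d rs)"

lemma does_round:
  assumes "set rs \<subseteq> {..<R}" "R < d"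
  shows "does (\<lambda>x s. good x s \<and> zero d (snd s)) (round d rs)
    (\<lambda>x s s'. extends x s s' \<and> (\<forall>S\<subseteq>interp x (fst s). \<forall>r vs. r \<in> set rs \<longrightarrow> (r, vs) \<in> consequences x S \<longrightarrow>
       (r, vs) \<in> interp x (fst s')))"
  using assms(1)
proof (induction rs)
  case Nil
  show ?case unfolding round.simps by (rule does_Skip) (auto simp: extends_refl)
next
  case (Cons r rs)
  have 1: "does (\<lambda>x s. good x s \<and> zero d (snd s)) (update d r)
    (\<lambda>x s s'. extends x s s' \<and> (\<forall>S\<subseteq>interp x (fst s). \<forall>vs. (r, vs) \<in> consequences x S \<longrightarrow> (r, vs) \<in> interp x (fst s')))"
    using Cons.prems assms(2) by (intro does_update) auto
  have 2: "does (\<lambda>x s. good x s \<and> zero d (snd s)) (round d rs)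
    (\<lambda>x s s'. extends x s s' \<and> (\<forall>S\<subseteq>interp x (fst s). \<forall>r vs. r \<in> set rs \<longrightarrow> (r, vs) \<in> consequences x S \<longrightarrow>
       (r, vs) \<in> interp x (fst s')))"
    using Cons.prems by (intro Cons.IH) auto
  show ?case unfolding round.simps
  proof (rule does_Seq[OF 1 2], goal_cases)
    case (1 x s s')
    then show ?case using extends_good[of x s s'] by (simp add: extends_def)
  next
    case (2 x s s' s'')
    then have e: "extends x s s'" "extends x s' s''" by auto
    then have sub: "interp x (fst s) \<subseteq> interp x (fst s')" "interp x (fst s') \<subseteq> interp x (fst s'')"
      by (auto simp: extends_def)
    have "(q, vs) \<in> interp x (fst s'')"
      if S: "S \<subseteq> interp x (fst s)" and q: "q \<in> set (r # rs)" and vs: "(q, vs) \<in> consequences x S" for S q vs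
    proof (cases "q = r")
      case True
      then have "(q, vs) \<in> interp x (fst s')" using 2(2) S vs by blast
      then show ?thesis using sub(2) by blast
    next
      case False
      then have "q \<in> set rs" using q by simp
      moreover have "S \<subseteq> interp x (fst s')" using S sub(1) by blast
      ultimately show ?thesis using 2(3) vs by blast
    qed
    then show ?case using extends_trans[OF e] by blast
  qed
qed

definition progress :: "bool list \<Rightarrow> nat \<Rightarrow> state \<Rightarrow> bool" where
  "progress x k s \<longleftrightarrow> meaning x \<subseteq> interp x (fst s) \<or> k \<le> card (interp x (fst s))"

text \<open>A round that adds nothing has met a set closed under \<open>consequences\<close>, which
  contains the least fixed point. Any other round adds at least one fact.\<close>

lemma progress_round:
  assumes "interp x (fst s) \<subseteq> interp x (fst s')" "consequences x (interp x (fst s)) \<subseteq> interp x (fst s')"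
    and "progress x k s"
  shows "progress x (Suc k) s'"
proof (cases "interp x (fst s') = interp x (fst s)")
  case True
  then have "meaning x \<subseteq> interp x (fst s')"
    using assms unfolding meaning_def by (metis lfp_lowerbound)
  then show ?thesis by (simp add: progress_def)
next
  case False
  then have "card (interp x (fst s)) < card (interp x (fst s'))"
    using assms(1) finite_subset[OF interp_subset finite_tuples] by (intro psubset_card_mono) auto
  then show ?thesis using assms by (auto simp: progress_def)
qed

text \<open>The body makes no use of the loop positions; the nest merely counts rounds.\<close>

lemma does_iterate:
  assumes "R < d"
    and body: "does (\<lambda>x s. good x s \<and> zero (d + n) (snd s)) c
      (\<lambda>x s s'. extends x s s' \<and> (\<forall>k. progress x k s \<longrightarrow> progress x (Suc k) s'))"
  shows "does (\<lambda>x s. good x s \<and> zero d (snd s)) (nest d n c)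
      (\<lambda>x s s'. extends x s s' \<and> (\<forall>k. progress x k s \<longrightarrow> progress x (k + (length x + 2) ^ n) s'))"
  using assms
proof (induction n arbitrary: d)
  case 0
  then show ?case by simp
next
  case (Suc n)
  have t: "\<not> tab d" using Suc.prems by (simp add: tab_def)
  have IH: "does (\<lambda>x s. good x s \<and> zero (Suc d) (snd s)) (nest (Suc d) n c)
      (\<lambda>x s s'. extends x s s' \<and> (\<forall>k. progress x k s \<longrightarrow> progress x (k + (length x + 2) ^ n) s'))"
    using Suc.prems by (intro Suc.IH) auto
  let ?J = "\<lambda>x s v s'. extends x s s' \<and> (\<forall>k. progress x k s \<longrightarrow> progress x (k + v * (length x + 2) ^ n) s')"
  have "does (\<lambda>x s. good x s \<and> zero d (snd s)) (nest d (Suc n) c)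
      (\<lambda>x s s'. fst s' d = cell x \<and> snd s' d = 0 \<and> ?J x s (length x + 2) s')"
    unfolding nest.simps
  proof (rule does_For[OF IH, where J = ?J])
    fix x s assume "good x s \<and> zero d (snd s)"
    then show "fst s d = cell x \<and> snd s d = 0 \<and> ?J x s 0 s"
      using t by (auto simp: extends_refl contents_cell goodD zeroD)
  next
    fix x s0 v s s'
    assume s0: "good x s0 \<and> zero d (snd s0)" and J: "?J x s0 v s" and d: "fst s d = cell x" "snd s d = 0"
      and v: "v < length x + 2"
    have "good x s" using J s0 extends_good by blast
    then have good: "good x (setp d v s)" using t v by simp
    have "zero (Suc d) (snd s)" using J s0 zero_SucI by (simp add: extends_def)
    then have z: "zero (Suc d) (snd (setp d v s))" by simp
    have pr: "progress x k (setp i u s) \<longleftrightarrow> progress x k s" for k i u s by (simp add: progress_def)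
    have "fst s' d = cell x \<and> snd s' d = v \<and> ?J x s0 (Suc v) (setp d 0 s')"
      if Q: "extends x (setp d v s) s' \<and> (\<forall>k. progress x k (setp d v s) \<longrightarrow> progress x (k + (length x + 2) ^ n) s')"
    proof -
      have "extends x s (setp d 0 s')" using Q d by (intro extends_setp[of x d v]) auto
      then have "extends x s0 (setp d 0 s')" using J extends_trans by blast
      moreover have "fst s' d = cell x" using Q t contents_cell by (auto simp: extends_def)
      moreover have "snd s' d = v" using Q by (auto simp: extends_def)
      moreover have "progress x (k + Suc v * (length x + 2) ^ n) s'" if "progress x k s0" for k
      proof -
        have "progress x (k + v * (length x + 2) ^ n) s" using J that by blast
        then have "progress x (k + v * (length x + 2) ^ n + (length x + 2) ^ n) s'" using Q pr by blast
        then show ?thesis by (simp add: add_ac)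
      qed
      ultimately show ?thesis using pr by blast
    qed
    then show "(good x (setp d v s) \<and> zero (Suc d) (snd (setp d v s))) \<and>
      (extends x (setp d v s) s' \<and> (\<forall>k. progress x k (setp d v s) \<longrightarrow> progress x (k + (length x + 2) ^ n) s') \<longrightarrow>
       fst s' d = cell x \<and> snd s' d = v \<and> ?J x s0 (Suc v) (setp d 0 s'))"
      using good z by blast
  qed
  then show ?case by (rule does_weaken) auto
qed

text \<open>Relation 0 has arity 0, so its only fact has address 1 on tape 1. The final
  \<open>Right 1\<close> puts the head there, and the symbol found is the verdict.\<close>

theorem goal_in_class_P: "{x. (0, []) \<in> meaning x} \<in> class_P"
proof -
  define d where "d = Suc R"
  define c where "c = nest d H (round (d + H) [0..<R])"
  have "does (\<lambda>x s. good x s \<and> zero (d + H) (snd s)) (round (d + H) [0..<R])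
      (\<lambda>x s s'. extends x s s' \<and> (\<forall>k. progress x k s \<longrightarrow> progress x (Suc k) s'))"
  proof (rule does_weaken[OF does_round[of "[0..<R]" "d + H"]], goal_cases)
    case (4 x s s')
    have "consequences x (interp x (fst s)) \<subseteq> interp x (fst s')"
    proof
      fix rvs assume *: "rvs \<in> consequences x (interp x (fst s))"
      then obtain r vs where "rvs = (r, vs)" "r < R" by (auto simp: consequences_def)
      then show "rvs \<in> interp x (fst s')" using 4 * by auto
    qed
    moreover have "extends x s s'" using 4 by blast
    moreover from this have "interp x (fst s) \<subseteq> interp x (fst s')" by (simp add: extends_def)
    ultimately show ?case using progress_round by blast
  qed (auto simp: d_def)
  then have "does (\<lambda>x s. good x s \<and> zero d (snd s)) c
      (\<lambda>x s s'. extends x s s' \<and> (\<forall>k. progress x k s \<longrightarrow> progress x (k + (length x + 2) ^ H) s'))"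
    unfolding c_def by (intro does_iterate) (simp add: d_def)
  then obtain T where T: "poly_bounded T"
    and run: "\<And>x s. good x s \<and> zero d (snd s) \<Longrightarrow> \<exists>s'. runs c s (T (length x)) s' \<and>
      extends x s s' \<and> (\<forall>k. progress x k s \<longrightarrow> progress x (k + (length x + 2) ^ H) s')"
    unfolding does_def by blast
  have "poly_bounded (\<lambda>n. T n + 1)" by (intro poly_bounded_intros T)
  then obtain C where C: "\<And>n. T n + 1 \<le> C * (n + 2) ^ C" unfolding poly_bounded_def by blast
  obtain K where K: "K > 1" "wf_prog K (Seq c (Right 1))" using ex_wf_prog by blast
  show ?thesis
  proof (rule class_P_if_exec[OF K(2,1), of tab C])
    show "\<not> tab 0" by (simp add: tab_def)
    fix x
    let ?s = "init_state tab x"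
    have good: "good x ?s"
      by (auto simp: good_def contents_def bounded_def init_state_def)
    then obtain s' where r: "runs c ?s (T (length x)) s'" and e: "extends x ?s s'"
      and p: "\<And>k. progress x k ?s \<Longrightarrow> progress x (k + (length x + 2) ^ H) s'"
      using run[of x ?s] by (auto simp: init_state_def zero_def)
    have "interp x (fst ?s) = {}"
      by (auto simp: interp_def init_state_def tab_def)
    then have sub: "interp x (fst s') \<subseteq> meaning x" using e by (auto simp: extends_def)
    have "progress x ((length x + 2) ^ H) s'" using p[of 0] by (simp add: progress_def)
    \<comment> \<open>With as many facts as there are tuples, the tables are full.\<close>
    moreover have "meaning x \<subseteq> interp x (fst s')" if "(length x + 2) ^ H \<le> card (interp x (fst s'))"
    proof -
      have "interp x (fst s') = tuples x"
        using that card_tuples[of x] interp_subset[of x "fst s'"] finite_tuples[of x]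
        by (intro card_seteq) auto
      then show ?thesis using meaning_subset by simp
    qed
    ultimately have eq: "interp x (fst s') = meaning x" using sub unfolding progress_def by blast
    have "snd s' 1 = 0" using e by (simp add: extends_def init_state_def)
    then have "runs (Right 1) s' 1 (setp 1 1 s')"
      using runs_Right[of 1 "fst s'" "snd s'"] by (simp add: setp_def)
    from runs_Seq[OF r this] obtain t where t: "t \<le> T (length x) + 1" "exec (Seq c (Right 1)) ?s t (setp 1 1 s')"
      unfolding runs_def by auto
    have "(0, []) \<in> interp x (fst s') \<longleftrightarrow> fst s' 1 1 = 1"
      using goal by (simp add: interp_def)
    then have "fst (setp 1 1 s') 1 (snd (setp 1 1 s') 1) = 1 \<longleftrightarrow> x \<in> {x. (0, []) \<in> meaning x}"
      by (simp add: eq)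
    moreover have "t \<le> C * (length x + 2) ^ C" using t C[of "length x"] by linarith
    ultimately show "\<exists>t s. t \<le> C * (length x + 2) ^ C \<and> exec (Seq c (Right 1)) (init_state tab x) t s \<and>
        (fst s 1 (snd s 1) = 1 \<longleftrightarrow> x \<in> {x. (0, []) \<in> meaning x})"
      using t by blast
  qed
qed

end

section \<open>Simon's congruence and regular patterns\<close>

text \<open>The bound is strict because \<open>a # y\<close> has to have length at most
  \<open>r\<close>; depth 0 demands nothing. Fixing the first letter makes the property insensitive
  to other letters in front of \<open>u\<close>.\<close>

definition agree :: "nat \<Rightarrow> nat list \<Rightarrow> nat list \<Rightarrow> nat \<Rightarrow> bool" where
  "agree a u v r \<longleftrightarrow> (\<forall>y. length y < r \<longrightarrow> (subseq (a # y) u \<longleftrightarrow> subseq (a # y) v))"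

lemma simon_congruent_alt:
  "simon_congruent k u v \<longleftrightarrow> (\<forall>y. length y \<le> k \<longrightarrow> (subseq y u \<longleftrightarrow> subseq y v))"
  unfolding simon_congruent_def by blast

text \<open>The empty word is a subsequence of every word, so only nonempty words matter, and these
  are sorted by their first letter.\<close>

lemma simon_congruent_agree: "simon_congruent k u v \<longleftrightarrow> (\<forall>a. agree a u v k)"
proof
  assume "simon_congruent k u v"
  then show "\<forall>a. agree a u v k"
    unfolding simon_congruent_alt agree_def by (auto simp: Suc_le_eq)
next
  assume *: "\<forall>a. agree a u v k"
  show "simon_congruent k u v"
    unfolding simon_congruent_alt
  proof (intro allI impI)
    fix y :: "nat list" assume "length y \<le> k"
    with * show "subseq y u \<longleftrightarrow> subseq y v"
      by (cases y) (auto simp: agree_def Suc_le_eq)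
  qed
qed

lemma subseq_subset: "subseq x u \<Longrightarrow> set x \<subseteq> set u"
  by (induction rule: list_emb.induct) auto

lemma not_subseq_Cons: "a \<notin> set v \<Longrightarrow> \<not> subseq (a # y) v"
  using subseq_subset[of "a # y" v] by auto

text \<open>Greedy embedding: the first letter may always be matched at its first
  occurrence.\<close>

lemma subseq_first: "a \<notin> set y \<Longrightarrow> subseq (a # z) (y @ a # v) \<longleftrightarrow> subseq z v"
  by (induction y) auto

lemma agree_0 [simp]: "agree a u v 0"
  by (simp add: agree_def)

lemma agree_sym: "agree a u v r \<Longrightarrow> agree a v u r"
  by (simp add: agree_def)

lemma agree_trans: "agree a u v r \<Longrightarrow> agree a v w r \<Longrightarrow> agree a u w r"
  by (simp add: agree_def)

lemma agree_mono: "agree a u v r \<Longrightarrow> s \<le> r \<Longrightarrow> agree a u v s"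
  by (simp add: agree_def)

lemma agree_absent: "a \<notin> set u \<Longrightarrow> a \<notin> set v \<Longrightarrow> agree a u v r"
  by (simp add: agree_def not_subseq_Cons)

lemma agree_SucD: "agree a u v (Suc r) \<Longrightarrow> a \<in> set u \<longleftrightarrow> a \<in> set v"
  by (auto simp: agree_def subseq_singleton_left dest: spec[of _ "[]"])

lemma agree_Nil: "agree a [] v r \<longleftrightarrow> r = 0 \<or> a \<notin> set v"
proof (cases r)
  case (Suc s)
  then show ?thesis using agree_SucD[of a "[]" v s] agree_absent[of a "[]" v r] by auto
qed simp

text \<open>Both words are cut behind their first \<open>a\<close>. What remains to be embedded is
  any word shorter by one, so its first letter is free again.\<close>

lemma agree_next:
  assumes "a \<notin> set y" "a \<notin> set z"
  shows "agree a (y @ a # u) (z @ a # v) (Suc r) \<longleftrightarrow> simon_congruent r u v"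
  using assms by (simp add: agree_def simon_congruent_alt subseq_first less_Suc_eq_le)

lemma agree_next_Cons:
  assumes "a \<notin> set z"
  shows "agree a (a # u) (z @ a # v) (Suc r) \<longleftrightarrow> simon_congruent r u v"
  using agree_next[of a "[]" z u v r] assms by simp

lemma agree_Cons_neq: "a \<noteq> b \<Longrightarrow> agree a (b # u) v r \<longleftrightarrow> agree a u v r"
  by (simp add: agree_def)

section \<open>Effect of one letter on the constraints\<close>

lemma simon_congruent_agree_on:
  assumes "set u \<subseteq> A" "set v \<subseteq> A"
  shows "simon_congruent k u v \<longleftrightarrow> (\<forall>a\<in>A. agree a u v k)"
  unfolding simon_congruent_agree using assms agree_absent by blast

text \<open>\<open>S\<close> collects the letters that take the new constraint \<open>v'\<close>,
  \<open>r'\<close>; the others keep one that is at least as deep. By transitivity, the kept ones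
  give agreement with \<open>v'\<close> up to \<open>r'\<close>, so \<open>u\<close> and
  \<open>v'\<close> are congruent, as \<open>b\<close> demands. The shallower constraints dropped by
  letters in \<open>S\<close> are recovered in the same way.\<close>

lemma read_sound:
  assumes A: "set u \<subseteq> A" "set v' \<subseteq> A" and v: "v b = y @ b # v'" "b \<notin> set y" and r: "r b = Suc r'"
    and S: "\<And>a. a \<in> A \<Longrightarrow> a \<in> S \<Longrightarrow> a \<noteq> b \<Longrightarrow> r a \<le> r' \<and> agree a v' (v a) (r a)"
    and nS: "\<And>a. a \<in> A \<Longrightarrow> a \<notin> S \<Longrightarrow> a \<noteq> b \<and> r' \<le> r a \<and> agree a (v a) v' r'"
    and u: "\<And>a. a \<in> A \<Longrightarrow> if a \<in> S then agree a u v' r' else agree a u (v a) (r a)"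
    and a: "a \<in> A"
  shows "agree a (b # u) (v a) (r a)"
proof (cases "a = b")
  case True
  have "agree c u v' r'" if "c \<in> A" for c
  proof (cases "c \<in> S")
    case False
    then have "r' \<le> r c" "agree c (v c) v' r'" "agree c u (v c) (r c)"
      using u[OF that] nS[OF that] by auto
    then show ?thesis using agree_mono agree_trans by blast
  qed (use u[OF that] in simp)
  then have "simon_congruent r' u v'" using simon_congruent_agree_on[OF A] by blast
  then show ?thesis using True v r by (simp add: agree_next_Cons)
next
  case False
  have "agree a u (v a) (r a)"
  proof (cases "a \<in> S")
    case True
    then have "r a \<le> r'" "agree a v' (v a) (r a)" "agree a u v' r'"
      using u[OF a] S[OF a] False by auto
    then show ?thesis using agree_mono agree_trans by blast
  qed (use u[OF a] in simp)
  then show ?thesis using False by (simp add: agree_Cons_neq)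
qed

text \<open>The rest \<open>u\<close> agrees with both suffixes between which a letter has to
  choose, so these agree with each other up to the smaller depth.\<close>

lemma read_complete:
  assumes A: "set u \<subseteq> A" "set (v b) \<subseteq> A" "b \<in> A" and r: "r b = Suc r'"
    and agree: "\<And>a. a \<in> A \<Longrightarrow> agree a (b # u) (v a) (r a)"
  obtains y v' S where "v b = y @ b # v'" "b \<notin> set y" "S \<subseteq> A"
    "\<And>a. a \<in> S \<Longrightarrow> a \<noteq> b \<Longrightarrow> r a \<le> r' \<and> agree a v' (v a) (r a)"
    "\<And>a. a \<in> A \<Longrightarrow> a \<notin> S \<Longrightarrow> a \<noteq> b \<and> r' \<le> r a \<and> agree a (v a) v' r'"
    "\<And>a. a \<in> A \<Longrightarrow> if a \<in> S then agree a u v' r' else agree a u (v a) (r a)"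
proof -
  have "b \<in> set (v b)" using agree_SucD[of b "b # u" "v b" r'] agree[OF A(3)] r by simp
  then obtain y v' where v: "v b = y @ b # v'" "b \<notin> set y" using split_list_first by metis
  have "simon_congruent r' u v'" using agree[OF A(3)] v r by (simp add: agree_next_Cons)
  then have c: "agree a u v' r'" for a by (simp add: simon_congruent_agree)
  have n: "agree a u (v a) (r a)" if "a \<in> A" "a \<noteq> b" for a
    using agree[OF that(1)] that(2) by (simp add: agree_Cons_neq)
  show thesis
  \<comment> \<open>Ties go to the new constraint; \<open>b\<close> has to take it because its old
    one is used up.\<close>
  proof (rule that[of y v' "{a\<in>A. a = b \<or> r a \<le> r'}"])
    show "r a \<le> r' \<and> agree a v' (v a) (r a)" if "a \<in> {a\<in>A. a = b \<or> r a \<le> r'}" "a \<noteq> b" for a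
    proof -
      have le: "r a \<le> r'" and n: "agree a u (v a) (r a)" using that n by auto
      from agree_trans[OF agree_sym[OF agree_mono[OF c le]] n] le show ?thesis by blast
    qed
    show "a \<noteq> b \<and> r' \<le> r a \<and> agree a (v a) v' r'" if "a \<in> A" "a \<notin> {a\<in>A. a = b \<or> r a \<le> r'}" for a
    proof -
      have ab: "a \<noteq> b" and le: "r' \<le> r a" using that by auto
      from agree_trans[OF agree_sym[OF agree_mono[OF n[OF that(1) ab] le]] c] ab le
      show ?thesis by blast
    qed
  qed (use v c n in auto)
qed

text \<open>If \<open>b\<close> is missing in \<open>v\<close>, the word \<open>[b]\<close>
  separates. Otherwise a separating word has a nonempty rest that separates \<open>u\<close> from
  \<open>v'\<close>, and \<open>c\<close> is the first letter of this rest.\<close>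

lemma not_agree_Cons:
  assumes "set u \<subseteq> A" "set v \<subseteq> A"
  shows "\<not> agree b (b # u) v r \<longleftrightarrow> (\<exists>r'. r = Suc r' \<and>
    (b \<notin> set v \<or> (\<exists>y v'. v = y @ b # v' \<and> b \<notin> set y \<and> (\<exists>c\<in>A. \<not> agree c u v' r'))))"
proof (cases r)
  case (Suc r')
  show ?thesis
  proof (cases "b \<in> set v")
    case True
    have *: "\<not> agree b (b # u) v r \<longleftrightarrow> (\<exists>c\<in>A. \<not> agree c u v' r')" if "v = y @ b # v'" "b \<notin> set y" for y v'
      using that assms Suc by (simp add: agree_next_Cons simon_congruent_agree_on[of u A v'])
    obtain y v' where "v = y @ b # v'" "b \<notin> set y" using split_list_first[OF True] by blast
    then show ?thesis using * Suc True by blast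
  next
    case False
    then show ?thesis using Suc agree_SucD[of b "b # u" v r'] by auto
  qed
qed simp

section \<open>Words denoted by a regular pattern\<close>

fun matches :: "nat \<Rightarrow> symbol list \<Rightarrow> nat list set" where
  "matches \<sigma> [] = {[]}"
| "matches \<sigma> (Const a # \<beta>) = (#) a ` matches \<sigma> \<beta>"
| "matches \<sigma> (Var x # \<beta>) = {u @ v |u v. u \<in> lists (terminals \<sigma>) \<and> v \<in> matches \<sigma> \<beta>}"

lemma matches_terminals:
  "\<beta> \<in> lists (symbols \<sigma>) \<Longrightarrow> u \<in> matches \<sigma> \<beta> \<Longrightarrow> u \<in> lists (terminals \<sigma>)"
proof (induction \<sigma> \<beta> arbitrary: u rule: matches.induct)
  case (2 \<sigma> a \<beta>)
  then have "a \<in> terminals \<sigma>" by (auto simp: symbols_def)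
  moreover obtain v where "u = a # v" "v \<in> matches \<sigma> \<beta>" using 2 by auto
  ultimately show ?case using 2 by simp
next
  case (3 \<sigma> x \<beta>)
  then obtain v w where "u = v @ w" "v \<in> lists (terminals \<sigma>)" "w \<in> matches \<sigma> \<beta>" by auto
  with 3 show ?case by simp
qed simp

fun image_of :: "(nat \<Rightarrow> nat list) \<Rightarrow> symbol \<Rightarrow> nat list" where
  "image_of f (Const a) = [a]"
| "image_of f (Var x) = f x"

lemma regular_pattern_Var:
  "regular_pattern (Var x # \<beta>) \<longleftrightarrow> Var x \<notin> set \<beta> \<and> regular_pattern \<beta>"
proof
  assume *: "regular_pattern (Var x # \<beta>)"
  have "count_list \<beta> (Var y) \<le> 1 \<and> (y = x \<longrightarrow> count_list \<beta> (Var y) = 0)" for y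
    using *[unfolded regular_pattern_def, rule_format, of y] by (auto split: if_splits)
  then show "Var x \<notin> set \<beta> \<and> regular_pattern \<beta>"
    unfolding regular_pattern_def using count_list_0_iff by metis
next
  assume "Var x \<notin> set \<beta> \<and> regular_pattern \<beta>"
  then show "regular_pattern (Var x # \<beta>)"
    unfolding regular_pattern_def by simp
qed

lemma regular_pattern_Const: "regular_pattern (Const a # \<beta>) \<longleftrightarrow> regular_pattern \<beta>"
  by (simp add: regular_pattern_def)

text \<open>\<open>matches\<close> chooses a word at each occurrence of a variable. Regularity makes
  the choices consistent: \<open>x\<close> does not occur in \<beta>, so redefining \<open>f\<close>
  at \<open>x\<close> leaves the image of \<beta> unchanged.\<close>

lemma matches_assignment:
  "regular_pattern \<beta> \<Longrightarrow> u \<in> matches \<sigma> \<beta> \<Longrightarrow>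
    \<exists>f. (\<forall>x. f x \<in> lists (terminals \<sigma>)) \<and> concat (map (image_of f) \<beta>) = u"
proof (induction \<sigma> \<beta> arbitrary: u rule: matches.induct)
  case (1 \<sigma>)
  then show ?case by (intro exI[of _ "\<lambda>_. []"]) auto
next
  case (2 \<sigma> a \<beta>)
  then show ?case by (auto simp: regular_pattern_Const)
next
  case (3 \<sigma> x \<beta>)
  then obtain v w where u: "u = v @ w" "v \<in> lists (terminals \<sigma>)" "w \<in> matches \<sigma> \<beta>" by auto
  have \<beta>: "Var x \<notin> set \<beta>" "regular_pattern \<beta>"
    using 3(2) by (simp_all add: regular_pattern_Var)
  obtain f where f: "\<forall>x. f x \<in> lists (terminals \<sigma>)" "concat (map (image_of f) \<beta>) = w"
    using 3(1)[OF \<beta>(2) u(3)] by blast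
  have "image_of (f(x := v)) s = image_of f s" if "s \<in> set \<beta>" for s
  proof -
    have "s \<noteq> Var x" using that \<beta>(1) by blast
    then show ?thesis by (cases s) auto
  qed
  then have m: "map (image_of (f(x := v))) \<beta> = map (image_of f) \<beta>" by simp
  have "concat (map (image_of (f(x := v))) (Var x # \<beta>)) = u"
    by (simp only: list.map concat.simps image_of.simps fun_upd_same m f(2) u(1))
  moreover have "\<forall>y. (f(x := v)) y \<in> lists (terminals \<sigma>)" using f(1) u(2) by simp
  ultimately show ?case by blast
qed

lemma matches_iff_substitution:
  assumes "\<beta> \<in> lists (symbols \<sigma>)" "regular_pattern \<beta>"
  shows "u \<in> matches \<sigma> \<beta> \<longleftrightarrow> (\<exists>h. substitution \<sigma> h \<and> h \<beta> = u)"
proof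
  assume "u \<in> matches \<sigma> \<beta>"
  then obtain f where f: "\<forall>x. f x \<in> lists (terminals \<sigma>)" "concat (map (image_of f) \<beta>) = u"
    using matches_assignment assms by blast
  have "image_of f s \<in> lists (terminals \<sigma>)" if "s \<in> symbols \<sigma>" for s
    using that spec[OF f(1)] by (cases s) (auto simp: symbols_def)
  then have "substitution \<sigma> (\<lambda>v. concat (map (image_of f) v))"
    unfolding substitution_def by (auto simp: in_lists_conv_set)
  with f show "\<exists>h. substitution \<sigma> h \<and> h \<beta> = u" by blast
next
  assume "\<exists>h. substitution \<sigma> h \<and> h \<beta> = u"
  then obtain h where h: "substitution \<sigma> h" "h \<beta> = u" by blast
  have app: "h (v @ w) = h v @ h w" if "v \<in> lists (symbols \<sigma>)" "w \<in> lists (symbols \<sigma>)" for v w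
    using h that unfolding substitution_def by blast
  have "h [] = []" using app[of "[]" "[]"] by simp
  have "h \<beta> \<in> matches \<sigma> \<beta>"
    using assms(1)
  proof (induction \<beta>)
    case Nil
    show ?case using \<open>h [] = []\<close> by simp
  next
    case (Cons s \<beta>)
    then have eq: "h (s # \<beta>) = h [s] @ h \<beta>" using app[of "[s]" \<beta>] by simp
    show ?case
    proof (cases s)
      case (Const a)
      then have "h [s] = [a]" using h(1) Cons by (auto simp: substitution_def symbols_def)
      then show ?thesis using Const eq Cons by simp
    next
      case (Var x)
      have "h [s] \<in> lists (terminals \<sigma>)"
      proof -
        have "[s] \<in> lists (symbols \<sigma>)" using Cons by simp
        then show ?thesis using h(1) unfolding substitution_def by blast
      qed
      then show ?thesis using Var eq Cons by auto
    qed
  qed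
  then show "u \<in> matches \<sigma> \<beta>" using h by simp
qed

lemma MatchSimon_regular:
  "(\<alpha>, w, k) \<in> MatchSimon \<sigma> \<inter> regular_inputs \<sigma> \<longleftrightarrow>
    (\<alpha>, w, k) \<in> regular_inputs \<sigma> \<and> (\<exists>u\<in>matches \<sigma> \<alpha>. simon_congruent k u w)"
proof (cases "(\<alpha>, w, k) \<in> regular_inputs \<sigma>")
  case True
  then have "(\<alpha>, w, k) \<in> inputs \<sigma>" "\<alpha> \<in> lists (symbols \<sigma>)" "regular_pattern \<alpha>"
    unfolding regular_inputs_def inputs_def by blast+
  moreover from this have "(\<alpha>, w, k) \<in> MatchSimon \<sigma> \<longleftrightarrow> (\<exists>h. substitution \<sigma> h \<and> simon_congruent k (h \<alpha>) w)"
    by (simp add: MatchSimon_def)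
  ultimately show ?thesis using True matches_iff_substitution[of \<alpha> \<sigma>] by auto
qed simp

lemma MatchStrictSimon_regular:
  "(\<alpha>, w, k) \<in> MatchStrictSimon \<sigma> \<inter> regular_inputs \<sigma> \<longleftrightarrow>
    (\<alpha>, w, k) \<in> regular_inputs \<sigma> \<and>
    (\<exists>u\<in>matches \<sigma> \<alpha>. simon_congruent k u w \<and> \<not> simon_congruent (k + 1) u w)"
proof (cases "(\<alpha>, w, k) \<in> regular_inputs \<sigma>")
  case True
  then have "(\<alpha>, w, k) \<in> inputs \<sigma>" "\<alpha> \<in> lists (symbols \<sigma>)" "regular_pattern \<alpha>"
    unfolding regular_inputs_def inputs_def by blast+
  moreover from this have "(\<alpha>, w, k) \<in> MatchStrictSimon \<sigma> \<longleftrightarrow> (\<exists>h. substitution \<sigma> h \<and> simon_congruent k (h \<alpha>) w \<and> \<not> simon_congruent (k + 1) (h \<alpha>) w)"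
    by (simp add: MatchStrictSimon_def)
  ultimately show ?thesis using True matches_iff_substitution[of \<alpha> \<sigma>] by auto
qed simp

section \<open>Decoding the input\<close>

definition Tru :: fm where "Tru = Off 0 0 0"
definition Fls :: fm where "Fls = Lt 0 0"
definition Le :: "nat \<Rightarrow> nat \<Rightarrow> fm" where "Le i j = Or (Lt i j) (Off i 0 j)"
definition Ands :: "fm list \<Rightarrow> fm" where "Ands fs = foldr And fs Tru"
definition Ors :: "fm list \<Rightarrow> fm" where "Ors fs = foldr Or fs Fls"

fun Lit :: "nat \<Rightarrow> nat \<Rightarrow> bool list \<Rightarrow> fm" where
  "Lit i n [] = Tru"
| "Lit i n (b # bs) = And (Chr i n (if b then 2 else 1)) (Lit i (Suc n) bs)"

definition At :: "nat \<Rightarrow> bool list \<Rightarrow> nat \<Rightarrow> fm" where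
  "At i bs j = And (Lit i 0 bs) (Off i (length bs) j)"

lemma sat_simps [simp]:
  "sat x S e Tru" "\<not> sat x S e Fls"
  "sat x S e (Le i j) \<longleftrightarrow> e i \<le> e j"
  by (auto simp: Tru_def Fls_def Le_def)

lemma sat_Ands [simp]: "sat x S e (Ands fs) \<longleftrightarrow> (\<forall>\<psi>\<in>set fs. sat x S e \<psi>)"
  by (induction fs) (auto simp: Ands_def)

lemma sat_Ors [simp]: "sat x S e (Ors fs) \<longleftrightarrow> (\<exists>\<psi>\<in>set fs. sat x S e \<psi>)"
  by (induction fs) (auto simp: Ors_def)

lemma wff_simps [simp]:
  "wff R ar Tru" "wff R ar Fls" "wff R ar (Le i j)"
  "wff R ar (Ands fs) \<longleftrightarrow> (\<forall>\<psi>\<in>set fs. wff R ar \<psi>)"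
  "wff R ar (Ors fs) \<longleftrightarrow> (\<forall>\<psi>\<in>set fs. wff R ar \<psi>)"
proof -
  show "wff R ar Tru" "wff R ar Fls" "wff R ar (Le i j)"
    by (simp_all add: Tru_def Fls_def Le_def)
  show "wff R ar (Ands fs) \<longleftrightarrow> (\<forall>\<psi>\<in>set fs. wff R ar \<psi>)"
    by (induction fs) (auto simp: Ands_def Tru_def)
  show "wff R ar (Ors fs) \<longleftrightarrow> (\<forall>\<psi>\<in>set fs. wff R ar \<psi>)"
    by (induction fs) (auto simp: Ors_def Fls_def)
qed

lemma wff_Lit [simp]: "wff R ar (Lit i n bs)"
  by (induction bs arbitrary: n) auto

lemma wff_At [simp]: "wff R ar (At i bs j)"
  by (simp add: At_def)

text \<open>Positions are cell numbers: bit \<open>i\<close> of the input is in cell \<open>i + 1\<close>, since cell 0 holds the marker.\<close>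

fun at :: "bool list \<Rightarrow> nat \<Rightarrow> bool list \<Rightarrow> nat \<Rightarrow> bool" where
  "at x p [] q \<longleftrightarrow> p = q \<and> 0 < p \<and> p < length x + 2"
| "at x p (b # bs) q \<longleftrightarrow> cell x p = (if b then 2 else 1) \<and> at x (Suc p) bs q"

lemma at_bounds: "at x p bs q \<Longrightarrow> 0 < p \<and> q = p + length bs \<and> q < length x + 2"
proof (induction bs arbitrary: p)
  case (Cons b bs)
  then have "cell x p \<noteq> 3" "at x (Suc p) bs q" by (auto split: if_splits)
  then show ?case using Cons.IH by fastforce
qed simp

lemma at_append: "at x p (u @ v) q \<longleftrightarrow> (\<exists>r. at x p u r \<and> at x r v q)"
proof (induction u arbitrary: p)
  case Nil
  show ?case using at_bounds[of x p v q] by auto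
qed auto

lemma sat_Lit:
  "e i + n > 0 \<Longrightarrow> e j < length x + 2 \<Longrightarrow>
    sat x S e (Lit i n bs) \<and> e j = e i + n + length bs \<longleftrightarrow> at x (e i + n) bs (e j)"
proof (induction bs arbitrary: n)
  case (Cons b bs)
  from Cons.IH[of "Suc n"] Cons.prems show ?case by auto
qed auto

text \<open>An empty word would hold at the marker, where \<open>at\<close> fails; a nonempty one
  fails there because the marker is no bit.\<close>

lemma sat_At:
  assumes "e j < length x + 2" "bs \<noteq> []"
  shows "sat x S e (At i bs j) \<longleftrightarrow> at x (e i) bs (e j)"
proof (cases "e i = 0")
  case True
  then show ?thesis using assms by (cases bs) (auto simp: At_def cell_def)
next
  case False
  then show ?thesis using sat_Lit[of e i 0 j x S bs] assms by (auto simp: At_def)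
qed

lemma at_drop: "at x p bs q \<Longrightarrow> drop (p - 1) x = bs @ drop (q - 1) x"
proof (induction bs arbitrary: p)
  case (Cons b bs)
  have "0 < p" "q = p + length (b # bs)" "q < length x + 2"
    using at_bounds[OF Cons.prems] by auto
  then obtain p' where p: "p = Suc p'" "p' < length x" by (cases p) auto
  have "x ! p' = b" using Cons.prems p by (auto simp: cell_def split: if_splits)
  moreover have "drop (Suc p') x = bs @ drop (q - 1) x" using Cons.IH[of "Suc p"] Cons.prems p(1) by simp
  ultimately show ?case using Cons_nth_drop_Suc[OF p(2)] p(1) by simp
qed simp

lemma at_take: "0 < p \<Longrightarrow> p + length bs < length x + 2 \<Longrightarrow> drop (p - 1) x = bs @ ys \<Longrightarrow> at x p bs (p + length bs)"
proof (induction bs arbitrary: p)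
  case (Cons b bs)
  then obtain p' where p: "p = Suc p'" "p' < length x" by (cases p) auto
  have "x ! p' # drop (Suc p') x = b # bs @ ys" using Cons.prems p Cons_nth_drop_Suc[OF p(2)] by simp
  then have b: "x ! p' = b" and d: "drop (Suc p - 1) x = bs @ ys" using p by auto
  have "at x (Suc p) bs (Suc p + length bs)" using Cons.IH[OF _ _ d] Cons.prems by simp
  then show ?case using b p by (simp add: cell_def)
qed simp

lemma at_whole: "at x 1 bs (length x + 1) \<longleftrightarrow> x = bs"
proof
  assume "at x 1 bs (length x + 1)"
  from at_drop[OF this] show "x = bs" by simp
next
  assume "x = bs"
  then show "at x 1 bs (length x + 1)" using at_take[of 1 bs x "[]"] by simp
qed

text \<open>Both code words are prefixes of the same rest of the input, so a prefix-free encoding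
  forces them to coincide.\<close>

lemma at_unique:
  assumes "\<And>a b r s. f a @ r = f b @ s \<Longrightarrow> a = b" "at x p (f a) q" "at x p (f b) q'"
  shows "a = b \<and> q = q'"
proof -
  have "a = b" using assms(1) at_drop[OF assms(2)] at_drop[OF assms(3)] by metis
  then show ?thesis using at_bounds[OF assms(2)] at_bounds[OF assms(3)] by simp
qed

lemma at_enc_nat_unique: "at x p (enc_nat n) q \<Longrightarrow> at x p (enc_nat m) q' \<Longrightarrow> n = m \<and> q = q'"
  by (rule at_unique[of enc_nat]) (auto simp: enc_nat_append_inject)

lemma enc_nat_0: "enc_nat 0 = [False]"
  by (simp add: enc_nat_def bits.simps[of 0])

lemma enc_nat_pos: "n > 0 \<Longrightarrow> enc_nat n = True # odd n # enc_nat (n div 2)"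
  by (simp add: enc_nat_def bits.simps[of n])

lemma hd_enc_nat: "\<exists>bs. enc_nat n = (n > 0) # bs"
  by (cases "n = 0") (auto simp: enc_nat_0 enc_nat_pos)

section \<open>Relations of the system and their formulas\<close>

definition NAT :: nat where "NAT = 1"
definition DBL :: nat where "DBL = 2"
definition VAL :: nat where "VAL = 3"
definition NEQ :: nat where "NEQ = 4"
definition NOTIN :: nat where "NOTIN = 5"
definition ALIST :: nat where "ALIST = 6"
definition WLIST :: nat where "WLIST = 7"
text \<open>From 8 on, four families indexed by letters are interleaved, so that the residue modulo
  4 tells them apart. Number 0 is left to the goal.\<close>

definition NOA :: "nat \<Rightarrow> nat" where "NOA a = 8 + 4 * a"
definition NXT :: "nat \<Rightarrow> nat" where "NXT a = 9 + 4 * a"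
definition EQ :: "nat \<Rightarrow> nat" where "EQ a = 10 + 4 * a"
definition ACC :: "nat \<Rightarrow> nat" where "ACC q = 11 + 4 * q"

lemmas rel_defs = NAT_def DBL_def VAL_def NEQ_def NOTIN_def ALIST_def WLIST_def NOA_def NXT_def EQ_def ACC_def

text \<open>Without leading zeros, the last bit of a positive numeral is \<open>True\<close>. So a
  bit may be split off only if another one follows (\<open>Chr 2 0 2\<close>), and the recursion
  ends in \<open>[True, True, False]\<close>, the number 1.\<close>

definition nat_fm :: fm where
  "nat_fm = Ors [At 0 [False] 1, At 0 [True, True, False] 1,
     Ex 2 (Ands [Or (At 0 [True, True] 2) (At 0 [True, False] 2), Chr 2 0 2, Rel NAT [2, 1]])]"

text \<open>Formulas know constant offsets but no arithmetic; doubling has to be defined by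
  recursion and serves \<open>val_fm\<close>.\<close>

definition dbl_fm :: fm where
  "dbl_fm = Or (And (Chr 0 0 3) (Chr 1 0 3)) (Ex 2 (Ex 3 (Ands [Off 2 1 0, Off 3 2 1, Rel DBL [2, 3]])))"

text \<open>Horner evaluation of a numeral, least significant bit first. Only values that are
  positions are reached, which suffices for k \<le> |w|.\<close>

definition val_fm :: fm where
  "val_fm = Or (And (Chr 0 0 1) (Chr 1 0 3))
     (Ex 2 (Ex 3 (Ex 4 (Ands [Or (And (At 0 [True, False] 2) (Off 4 0 1)) (And (At 0 [True, True] 2) (Off 4 1 1)),
        Rel VAL [2, 3], Rel DBL [3, 4]]))))"

text \<open>Inequality described positively: both numerals are walked in parallel, two cells per
  bit, until one ends earlier or two bits differ.\<close>

definition neq_fm :: fm where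
  "neq_fm = Ors [And (Chr 0 0 1) (Chr 1 0 2), And (Chr 0 0 2) (Chr 1 0 1),
     Ands [Chr 0 0 2, Chr 1 0 2, Ors [And (Chr 0 1 1) (Chr 1 1 2), And (Chr 0 1 2) (Chr 1 1 1),
       Ex 2 (Ex 3 (Ands [Off 0 2 2, Off 1 2 3, Rel NEQ [2, 3]]))]]]"

text \<open>Variable 0 points to the numeral of a pattern variable, variable 1 to the rest of the
  encoded pattern. An item is a list bit, a tag and a numeral; \<open>NAT\<close> skips the numeral,
  and only items tagged as variables are compared.\<close>

definition notin_fm :: fm where
  "notin_fm = Or (Chr 1 0 1) (Ex 2 (Ex 3 (Ands [Chr 1 0 2, Off 1 2 2, Rel NAT [2, 3],
     Or (Chr 1 1 1) (And (Chr 1 1 2) (Rel NEQ [0, 2])), Rel NOTIN [0, 3]])))"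

definition letters :: "nat \<Rightarrow> nat list" where
  "letters \<sigma> = [1..<Suc \<sigma>]"

lemma set_letters [simp]: "set (letters \<sigma>) = terminals \<sigma>"
  by (auto simp: letters_def terminals_def)

text \<open>\<open>NOTIN\<close> at every variable enforces regularity. Terminals are spelled out
  one by one, which is possible since the alphabet is fixed.\<close>

definition alist_fm :: "nat \<Rightarrow> fm" where
  "alist_fm \<sigma> = Ors (At 0 [False] 1 #
     Ex 2 (Ex 3 (Ands [At 0 [True, True] 2, Rel NAT [2, 3], Rel NOTIN [2, 3], Rel ALIST [3, 1]])) #
     map (\<lambda>a. Ex 2 (And (At 0 (True # False # enc_nat a) 2) (Rel ALIST [2, 1]))) (letters \<sigma>))"

definition wlist_fm :: "nat \<Rightarrow> fm" where
  "wlist_fm \<sigma> = Ors (And (At 0 [False] 1) (Chr 2 0 3) #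
     map (\<lambda>a. Ex 3 (Ex 4 (Ands [At 0 (True # enc_nat a) 3, Off 4 1 2, Rel WLIST [3, 1, 4]]))) (letters \<sigma>))"

text \<open>Counterpart of \<open>nxt_fm\<close> for a missing letter, established by walking to the
  end of the word instead of by negation.\<close>

definition noa_fm :: "nat \<Rightarrow> nat \<Rightarrow> fm" where
  "noa_fm \<sigma> a = Ors (Chr 0 0 1 #
     map (\<lambda>b. Ex 1 (And (At 0 (True # enc_nat b) 1) (Rel (NOA a) [1]))) (filter (\<lambda>b. b \<noteq> a) (letters \<sigma>)))"

definition nxt_fm :: "nat \<Rightarrow> nat \<Rightarrow> fm" where
  "nxt_fm \<sigma> a = Ors (At 0 (True # enc_nat a) 1 #
     map (\<lambda>b. Ex 2 (And (At 0 (True # enc_nat b) 2) (Rel (NXT a) [2, 1]))) (filter (\<lambda>b. b \<noteq> a) (letters \<sigma>)))"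

text \<open>Mirrors the recursion of \<open>agree\<close>: depth 0, a letter missing on both sides,
  or agreement for all letters, one level less deep, behind the next occurrences.\<close>

definition eq_fm :: "nat \<Rightarrow> nat \<Rightarrow> fm" where
  "eq_fm \<sigma> a = Ors [Chr 2 0 3, And (Rel (NOA a) [0]) (Rel (NOA a) [1]),
     Ex 3 (Ex 4 (Ex 5 (Ands ([Rel (NXT a) [0, 3], Rel (NXT a) [1, 4], Off 5 1 2] @
       map (\<lambda>b. Rel (EQ b) [3, 4, 5]) (letters \<sigma>)))))]"

text \<open>
  A tuple of the relation \<open>ACC q\<close> consists of a position in the pattern (variable 0), for every
  letter \<open>a\<close> a position in the word and a depth (variables \<open>2 * a - 1\<close> and \<open>2 * a\<close>), and another
  such pair for the letter \<open>q\<close>. It holds if the rest of the pattern matches a word that agrees with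
  the suffix of the word for every letter up to its depth but, unless \<open>q = 0\<close>, does not agree for
  the last pair and the letter \<open>q\<close>.
\<close>

definition arity :: "nat \<Rightarrow> nat" where "arity \<sigma> = 2 * \<sigma> + 3"

text \<open>Variables \<open>n + 1\<close> and \<open>n + 2\<close> hold the new position and depth,
  taken by the letters in \<open>T\<close>. In either case the pair that a letter retains is at
  least as deep as the discarded one, and \<open>EQ\<close> certifies that it implies that one. The
  letter \<open>b\<close> has to be in \<open>T\<close>.\<close>

definition guard_fm :: "nat \<Rightarrow> nat \<Rightarrow> nat set \<Rightarrow> fm" where
  "guard_fm \<sigma> b T = (let n = arity \<sigma> in Ands (map (\<lambda>a.
     if a \<in> T then if a = b then Tru else And (Le (2 * a) (n + 2)) (Rel (EQ a) [n + 1, 2 * a - 1, 2 * a])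
     else if a = b then Fls else And (Le (n + 2) (2 * a)) (Rel (EQ a) [2 * a - 1, n + 1, n + 2])) (letters \<sigma>)))"

text \<open>The continuation \<open>k\<close> receives the variable that holds each entry of the
  next tuple. Entries \<open>2 * a - 1\<close> and \<open>2 * a\<close> belong to the letter
  \<open>a\<close>, recovered as \<open>(i + 1) div 2\<close>; for entry 0 and the last pair this is
  no letter. At depth 0 the constraint of \<open>b\<close> demands nothing and stays.\<close>

definition pos_fm :: "nat \<Rightarrow> nat \<Rightarrow> ((nat \<Rightarrow> nat) \<Rightarrow> fm) \<Rightarrow> fm" where
  "pos_fm \<sigma> b k = (let n = arity \<sigma> in Or (And (Chr (2 * b) 0 3) (k (\<lambda>i. i)))
     (Ex (n + 1) (Ex (n + 2) (Ands [Rel (NXT b) [2 * b - 1, n + 1], Off (n + 2) 1 (2 * b),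
       Ors (map (\<lambda>S. And (guard_fm \<sigma> b (set S))
         (k (\<lambda>i. if (i + 1) div 2 \<in> set S then if odd i then n + 1 else n + 2 else i)))
       (subseqs (letters \<sigma>)))]))))"

text \<open>Follows \<open>not_agree_Cons\<close>; the letter 0 stands for a separation already
  achieved. The bound variables start at \<open>n + 3\<close>, because \<open>n + 1\<close> and
  \<open>n + 2\<close> are bound by the surrounding \<open>pos_fm\<close>.\<close>

definition neg_fm :: "nat \<Rightarrow> nat \<Rightarrow> nat \<Rightarrow> (nat \<Rightarrow> (nat \<Rightarrow> nat) \<Rightarrow> fm) \<Rightarrow> fm" where
  "neg_fm \<sigma> q b k = (let n = arity \<sigma>; j = 2 * \<sigma> + 1; r = 2 * \<sigma> + 2 in if q \<noteq> b then k q (\<lambda>i. i) else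
     Or (Ands [Ex (n + 3) (Off (n + 3) 1 r), Rel (NOA b) [j], k 0 (\<lambda>i. i)])
       (Ex (n + 3) (Ex (n + 4) (Ands [Rel (NXT b) [j, n + 3], Off (n + 4) 1 r,
         Ors (map (\<lambda>c. k c ((\<lambda>i. i)(j := n + 3, r := n + 4))) (letters \<sigma>))]))))"

definition move_fm :: "nat \<Rightarrow> nat \<Rightarrow> (nat \<Rightarrow> nat) \<Rightarrow> fm" where
  "move_fm \<sigma> q m = Rel (ACC q) (map m [0..<arity \<sigma>])"

definition read_fm :: "nat \<Rightarrow> nat \<Rightarrow> nat \<Rightarrow> nat \<Rightarrow> fm" where
  "read_fm \<sigma> q b y = pos_fm \<sigma> b (\<lambda>m. neg_fm \<sigma> q b (\<lambda>q' m'.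
     move_fm \<sigma> q' (\<lambda>i. if i = 0 then y else if i > 2 * \<sigma> then m' i else m i)))"

text \<open>A nondeterministic automaton for the pattern: stop at its end, leave a variable, read a
  terminal, or read a letter into a variable without moving on. At the end the unread word is empty,
  so each constraint needs depth 0 or a suffix without its letter, whereas a pending separation
  needs positive depth and a suffix that contains \<open>q\<close>.\<close>

definition acc_fm :: "nat \<Rightarrow> nat \<Rightarrow> fm" where
  "acc_fm \<sigma> q = (let n = arity \<sigma>; j = 2 * \<sigma> + 1; r = 2 * \<sigma> + 2 in Ors (
     Ands (Chr 0 0 1 # (if q = 0 then Tru else Ands [Ex n (Off n 1 r), Ex n (Rel (NXT q) [j, n])]) #
       map (\<lambda>a. Or (Chr (2 * a) 0 3) (Rel (NOA a) [2 * a - 1])) (letters \<sigma>)) #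
     Ex n (Ex (n + 1) (Ands [At 0 [True, True] n, Rel NAT [n, n + 1], move_fm \<sigma> q ((\<lambda>i. i)(0 := n + 1))])) #
     map (\<lambda>b. Ex n (And (At 0 (True # False # enc_nat b) n) (read_fm \<sigma> q b n))) (letters \<sigma>) @
     map (\<lambda>b. Ands [Chr 0 0 2, Chr 0 1 2, read_fm \<sigma> q b 0]) (letters \<sigma>)))"

text \<open>Variables 0 and 1 are the marker and the first position, 2 and 3 the ends of pattern and
  word, 4 is |w|, 5 is k, and 6 is the first blank, which makes the encoding exhaust the input. In
  the strict case, 7 is k + 1, the depth granted to the separation.\<close>

definition goal_fm :: "nat \<Rightarrow> bool \<Rightarrow> fm" where
  "goal_fm \<sigma> strict = Ex 0 (Ex 1 (Ex 2 (Ex 3 (Ex 4 (Ex 5 (Ex 6 (Ands [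
     Chr 0 0 3, Off 0 1 1, Rel ALIST [1, 2], Rel WLIST [2, 3, 4], Rel NAT [3, 6], Chr 6 0 0,
     Rel VAL [3, 5], Lt 0 5, Le 5 4,
     if strict
     then Ex 7 (And (Off 5 1 7) (Ors (map (\<lambda>q. move_fm \<sigma> q
       (\<lambda>i. if i = 0 then 1 else if odd i then 2 else if i = 2 * \<sigma> + 2 then 7 else 5)) (letters \<sigma>))))
     else move_fm \<sigma> 0 (\<lambda>i. if i = 0 then 1 else if odd i then 2 else 5)])))))))"

section \<open>The fixed-point system for a given alphabet\<close>

locale simon =
  fixes \<sigma> :: nat and strict :: bool
begin

definition rar :: "nat \<Rightarrow> nat" where
  "rar r = (if r = 0 then 0 else if r \<le> 6 then 2 else if r = 7 then 3 else
     if r mod 4 = 0 then 1 else if r mod 4 = 1 then 2 else if r mod 4 = 2 then 3 else arity \<sigma>)"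

definition body :: "nat \<Rightarrow> fm" where
  "body r = (if r = 0 then goal_fm \<sigma> strict else if r = 1 then nat_fm else if r = 2 then dbl_fm
     else if r = 3 then val_fm else if r = 4 then neq_fm else if r = 5 then notin_fm
     else if r = 6 then alist_fm \<sigma> else if r = 7 then wlist_fm \<sigma> else
     let a = r div 4 - 2 in if r mod 4 = 0 then noa_fm \<sigma> a else if r mod 4 = 1 then nxt_fm \<sigma> a
       else if r mod 4 = 2 then eq_fm \<sigma> a else acc_fm \<sigma> a)"

definition rels :: nat where "rels = 12 + 4 * \<sigma>"

lemma rar_simps [simp]:
  "rar NAT = 2" "rar DBL = 2" "rar VAL = 2" "rar NEQ = 2" "rar NOTIN = 2" "rar ALIST = 2" "rar WLIST = 3"
  "rar (NOA a) = 1" "rar (NXT a) = 2" "rar (EQ a) = 3" "rar (ACC q) = arity \<sigma>" "rar 0 = 0"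
proof -
  have "(8 + 4 * a) mod 4 = 0" "(9 + 4 * a) mod 4 = 1" "(10 + 4 * a) mod 4 = 2" "(11 + 4 * q) mod 4 = 3"
    by presburger+
  then show "rar NAT = 2" "rar DBL = 2" "rar VAL = 2" "rar NEQ = 2" "rar NOTIN = 2" "rar ALIST = 2" "rar WLIST = 3"
    "rar (NOA a) = 1" "rar (NXT a) = 2" "rar (EQ a) = 3" "rar (ACC q) = arity \<sigma>" "rar 0 = 0"
    by (simp_all add: rar_def rel_defs)
qed

lemma body_simps:
  "body NAT = nat_fm" "body DBL = dbl_fm" "body VAL = val_fm" "body NEQ = neq_fm" "body NOTIN = notin_fm"
  "body ALIST = alist_fm \<sigma>" "body WLIST = wlist_fm \<sigma>" "body (NOA a) = noa_fm \<sigma> a"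
  "body (NXT a) = nxt_fm \<sigma> a" "body (EQ a) = eq_fm \<sigma> a" "body (ACC q) = acc_fm \<sigma> q"
  "body 0 = goal_fm \<sigma> strict"
proof -
  have "(8 + 4 * a) mod 4 = 0" "(9 + 4 * a) mod 4 = 1" "(10 + 4 * a) mod 4 = 2" "(11 + 4 * q) mod 4 = 3"
    "(8 + 4 * a) div 4 = 2 + a" "(9 + 4 * a) div 4 = 2 + a" "(10 + 4 * a) div 4 = 2 + a" "(11 + 4 * q) div 4 = 2 + q"
    by presburger+
  then show "body NAT = nat_fm" "body DBL = dbl_fm" "body VAL = val_fm" "body NEQ = neq_fm" "body NOTIN = notin_fm"
    "body ALIST = alist_fm \<sigma>" "body WLIST = wlist_fm \<sigma>" "body (NOA a) = noa_fm \<sigma> a"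
    "body (NXT a) = nxt_fm \<sigma> a" "body (EQ a) = eq_fm \<sigma> a" "body (ACC q) = acc_fm \<sigma> q"
    "body 0 = goal_fm \<sigma> strict"
    by (simp_all add: body_def rel_defs)
qed

lemma less_rels [simp]:
  "NAT < rels" "DBL < rels" "VAL < rels" "NEQ < rels" "NOTIN < rels" "ALIST < rels" "WLIST < rels"
  "NOA a < rels \<longleftrightarrow> a \<le> \<sigma>" "NXT a < rels \<longleftrightarrow> a \<le> \<sigma>" "EQ a < rels \<longleftrightarrow> a \<le> \<sigma>" "ACC a < rels \<longleftrightarrow> a \<le> \<sigma>"
  "0 < rels"
  by (auto simp: rels_def rel_defs)

lemma rels_cases:
  assumes "r < rels"
  obtains "r = 0" | "r = NAT" | "r = DBL" | "r = VAL" | "r = NEQ" | "r = NOTIN" | "r = ALIST" | "r = WLIST"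
    | a where "a \<le> \<sigma>" "r = NOA a" | a where "a \<le> \<sigma>" "r = NXT a" | a where "a \<le> \<sigma>" "r = EQ a"
    | a where "a \<le> \<sigma>" "r = ACC a"
proof (cases "r < 8")
  case True
  then have "r = 0 \<or> r = 1 \<or> r = 2 \<or> r = 3 \<or> r = 4 \<or> r = 5 \<or> r = 6 \<or> r = 7" by linarith
  then show ?thesis using that(1-8) by (auto simp: rel_defs)
next
  case False
  define a m where "a = r div 4 - 2" and "m = r mod 4"
  have "r = 4 * (r div 4) + m" "m < 4" unfolding m_def by simp_all
  then have r: "r = 8 + 4 * a + m" using False unfolding a_def by linarith
  have "a \<le> \<sigma>" using assms r by (simp add: rels_def)
  moreover from \<open>m < 4\<close> have "m = 0 \<or> m = 1 \<or> m = 2 \<or> m = 3" by linarith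
  then have "r = NOA a \<or> r = NXT a \<or> r = EQ a \<or> r = ACC a" using r unfolding rel_defs by auto
  ultimately show ?thesis using that(9-12)[of a] by blast
qed

lemma wff_move [simp]: "q \<le> \<sigma> \<Longrightarrow> wff rels rar (move_fm \<sigma> q m)"
  by (simp add: move_fm_def)

lemma wff_neg: "q \<le> \<sigma> \<Longrightarrow> (\<And>q m. q \<le> \<sigma> \<Longrightarrow> wff rels rar (k q m)) \<Longrightarrow> wff rels rar (neg_fm \<sigma> q b k)"
  by (auto simp: neg_fm_def Let_def terminals_def)

lemma wff_pos: "b \<le> \<sigma> \<Longrightarrow> (\<And>m. wff rels rar (k m)) \<Longrightarrow> wff rels rar (pos_fm \<sigma> b k)"
  by (auto simp: pos_fm_def guard_fm_def Let_def terminals_def)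

lemma wff_read: "b \<le> \<sigma> \<Longrightarrow> q \<le> \<sigma> \<Longrightarrow> wff rels rar (read_fm \<sigma> q b y)"
  unfolding read_fm_def by (intro wff_pos wff_neg wff_move)

lemma wff_body:
  assumes "r < rels"
  shows "wff rels rar (body r)"
  using assms
  by (cases rule: rels_cases)
    (auto simp: body_simps goal_fm_def nat_fm_def dbl_fm_def val_fm_def neq_fm_def notin_fm_def alist_fm_def
      wlist_fm_def noa_fm_def nxt_fm_def eq_fm_def acc_fm_def Let_def terminals_def intro!: wff_read)

sublocale fixpoint_system rels rar body
  by unfold_locales (auto simp: wff_body)

lemma meaning_iff:
  "(r, vs) \<in> meaning x \<longleftrightarrow> r < rels \<and> length vs = rar r \<and> (\<forall>v\<in>set vs. v < length x + 2) \<and>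
    sat x (meaning x) (env vs) (body r)"
proof -
  have "(r, vs) \<in> meaning x \<longleftrightarrow> (r, vs) \<in> consequences x (meaning x)"
    by (rule arg_cong[OF meaning_unfold])
  also have "\<dots> \<longleftrightarrow> r < rels \<and> length vs = rar r \<and> (\<forall>v\<in>set vs. v < length x + 2) \<and>
      sat x (meaning x) (env vs) (body r)"
    unfolding consequences_def by (auto simp: subset_iff)
  finally show ?thesis .
qed

end

declare at.simps [simp del]

context fixpoint_system begin

lemma env_simps [simp]:
  "env [] i = 0" "env (v # vs) 0 = v" "env (v # vs) (Suc i) = env vs i"
  "env (v # vs) (numeral n) = env vs (pred_numeral n)"
  by (simp_all add: env_def numeral_eq_Suc)

end

context simon begin

section \<open>Numerals and lists in the input\<close>

lemma NAT_unfold: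
  "(NAT, [p, q]) \<in> meaning x \<longleftrightarrow> p < length x + 2 \<and> q < length x + 2 \<and>
    (at x p [False] q \<or> at x p [True, True, False] q \<or>
     (\<exists>v<length x + 2. (\<exists>b. at x p [True, b] v) \<and> cell x v = 2 \<and> (NAT, [v, q]) \<in> meaning x))"
proof -
  have "(\<exists>b. at x p [True, b] v) \<longleftrightarrow> at x p [True, True] v \<or> at x p [True, False] v" for v
    by (metis (full_types))
  then show ?thesis
    by (subst meaning_iff) (auto simp: body_simps nat_fm_def sat_At)
qed

text \<open>Every recursive call moves to the right, so the fixed-point equation determines the
  relation, and an induction on the rest of the input replaces fixed-point induction.\<close>

lemma NAT_iff: "(NAT, [p, q]) \<in> meaning x \<longleftrightarrow> (\<exists>n. at x p (enc_nat n) q)"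
proof
  show "\<exists>n. at x p (enc_nat n) q" if "(NAT, [p, q]) \<in> meaning x"
    using that
  proof (induction "length x + 2 - p" arbitrary: p rule: less_induct)
    case less
    consider "at x p [False] q" | "at x p [True, True, False] q"
      | v b where "at x p [True, b] v" "cell x v = 2" "(NAT, [v, q]) \<in> meaning x"
      using less.prems NAT_unfold[of p q x] by blast
    then show ?case
    proof cases
      case 1
      then show ?thesis by (intro exI[of _ 0]) (simp add: enc_nat_0)
    next
      case 2
      then show ?thesis by (intro exI[of _ 1]) (simp add: enc_nat_0 enc_nat_pos)
    next
      case 3
      have "length x + 2 - v < length x + 2 - p" using at_bounds[OF 3(1)] by auto
      then obtain n where n: "at x v (enc_nat n) q"
        using less.hyps 3(3) by blast
      \<comment> \<open>Another bit follows at \<open>v\<close>, so the numeral there is not 0 and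
        may be extended by any lower bit.\<close>
      have "n > 0"
      proof (rule ccontr)
        assume "\<not> n > 0"
        then show False using n 3(2) by (simp add: enc_nat_0 at.simps)
      qed
      then have "enc_nat (2 * n + of_bool b) = [True, b] @ enc_nat n"
        by (cases b) (simp_all add: enc_nat_pos)
      moreover have "at x p ([True, b] @ enc_nat n) q" using n 3(1) at_append by blast
      ultimately show ?thesis by metis
    qed
  qed
next
  assume "\<exists>n. at x p (enc_nat n) q"
  then obtain n where "at x p (enc_nat n) q" by blast
  then show "(NAT, [p, q]) \<in> meaning x"
  proof (induction n arbitrary: p rule: less_induct)
    case (less n)
    note b = at_bounds[OF less.prems]
    consider "n = 0" | "n = 1" | "n > 1" by linarith
    then show ?case
    proof cases
      case 1
      then have "at x p [False] q" using less.prems by (simp add: enc_nat_0)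
      then show ?thesis using b NAT_unfold[of p q x] by auto
    next
      case 2
      then have "at x p [True, True, False] q" using less.prems by (simp add: enc_nat_0 enc_nat_pos)
      then show ?thesis using b NAT_unfold[of p q x] by auto
    next
      case 3
      then have "at x p ([True, odd n] @ enc_nat (n div 2)) q" using less.prems by (simp add: enc_nat_pos)
      then obtain v where v: "at x p [True, odd n] v" "at x v (enc_nat (n div 2)) q"
        using at_append by blast
      have "cell x v = 2" using v(2) 3 by (simp add: enc_nat_pos[of "n div 2"] at.simps)
      moreover have "(NAT, [v, q]) \<in> meaning x" using less.IH[OF _ v(2)] 3 by simp
      moreover have "v < length x + 2" using at_bounds[OF v(1)] by simp
      ultimately show ?thesis using b v(1) NAT_unfold[of p q x] by auto
    qed
  qed
qed

lemma DBL_unfold: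
  "(DBL, [u, v]) \<in> meaning x \<longleftrightarrow> u < length x + 2 \<and> v < length x + 2 \<and>
    (u = 0 \<and> v = 0 \<or> (\<exists>u' v'. u = Suc u' \<and> v = v' + 2 \<and> (DBL, [u', v']) \<in> meaning x))"
proof -
  have "(DBL, [u, v]) \<in> meaning x \<longleftrightarrow> u < length x + 2 \<and> v < length x + 2 \<and>
    (u = 0 \<and> v = 0 \<or> (\<exists>u'<length x + 2. \<exists>v'<length x + 2. u = Suc u' \<and> v = v' + 2 \<and> (DBL, [u', v']) \<in> meaning x))"
    by (subst meaning_iff) (simp add: body_simps dbl_fm_def conj_ac)
  moreover have "u = Suc u' \<Longrightarrow> u < n \<Longrightarrow> u' < n" "v = v' + 2 \<Longrightarrow> v < n \<Longrightarrow> v' < n" for u' v' n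
    by simp_all
  ultimately show ?thesis by blast
qed

lemma DBL_iff: "(DBL, [u, v]) \<in> meaning x \<longleftrightarrow> v = 2 * u \<and> v < length x + 2"
proof (induction u arbitrary: v)
  case 0
  show ?case by (subst DBL_unfold) auto
next
  case (Suc u)
  show ?case by (subst DBL_unfold) (auto simp: Suc)
qed

lemma VAL_unfold:
  "(VAL, [p, v]) \<in> meaning x \<longleftrightarrow> p < length x + 2 \<and> v < length x + 2 \<and>
    (cell x p = 1 \<and> v = 0 \<or> (\<exists>b q. at x p [True, b] q \<and>
      (\<exists>m. (VAL, [q, m]) \<in> meaning x \<and> v = 2 * m + of_bool b)))"
  (is "_ \<longleftrightarrow> _ \<and> _ \<and> (_ \<or> ?R)")
proof -
  let ?L = "\<exists>q<length x + 2. \<exists>m<length x + 2. \<exists>d<length x + 2.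
       (at x p [True, False] q \<and> v = d \<or> at x p [True, True] q \<and> v = d + 1) \<and>
       (VAL, [q, m]) \<in> meaning x \<and> (DBL, [m, d]) \<in> meaning x"
  have ?R if L: ?L
  proof -
    from L obtain q m d where "at x p [True, False] q \<and> v = d \<or> at x p [True, True] q \<and> v = d + 1"
      and m: "(VAL, [q, m]) \<in> meaning x" "d = 2 * m" unfolding DBL_iff by blast
    then have "at x p [True, v \<noteq> d] q \<and> v = 2 * m + of_bool (v \<noteq> d)" by auto
    then show ?thesis using m by blast
  qed
  moreover have ?L if R: ?R and v: "v < length x + 2"
  proof -
    from R obtain b q m where q: "at x p [True, b] q" and m: "(VAL, [q, m]) \<in> meaning x" "v = 2 * m + of_bool b"
      by blast
    have "q < length x + 2" "m < length x + 2" "2 * m < length x + 2" "(DBL, [m, 2 * m]) \<in> meaning x"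
      using at_bounds[OF q] v m(2) by (auto simp: DBL_iff)
    moreover have "at x p [True, False] q \<and> v = 2 * m \<or> at x p [True, True] q \<and> v = 2 * m + 1"
      using q m(2) by (cases b) auto
    ultimately show ?thesis using m(1) by blast
  qed
  moreover have "(VAL, [p, v]) \<in> meaning x \<longleftrightarrow> p < length x + 2 \<and> v < length x + 2 \<and> (cell x p = 1 \<and> v = 0 \<or> ?L)"
    by (subst meaning_iff) (simp add: body_simps val_fm_def sat_At conj_ac cong: conj_cong)
  ultimately show ?thesis by blast
qed

text \<open>\<open>VAL\<close> does not exclude leading zeros, which is the business of
  \<open>NAT\<close>; hence the assumption that a numeral starts at \<open>p\<close>.\<close>

lemma VAL_iff: "at x p (enc_nat n) q \<Longrightarrow> (VAL, [p, v]) \<in> meaning x \<longleftrightarrow> v = n \<and> v < length x + 2"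
proof (induction n arbitrary: p v rule: less_induct)
  case (less n)
  note b = at_bounds[OF less.prems]
  show ?case
  proof (cases "n = 0")
    case True
    then have "cell x p = 1" using less.prems by (simp add: enc_nat_0 at.simps)
    moreover from this have "\<not> at x p [True, c] r" for c r by (simp add: at.simps)
    ultimately show ?thesis using True b by (subst VAL_unfold) auto
  next
    case False
    then have "at x p ([True, odd n] @ enc_nat (n div 2)) q" using less.prems by (simp add: enc_nat_pos)
    then obtain r where r: "at x p [True, odd n] r" "at x r (enc_nat (n div 2)) q"
      using at_append by blast
    have u: "b = odd n \<and> r' = r" if "at x p [True, b] r'" for b r'
      using r(1) that by (cases b; cases "odd n") (simp_all add: at.simps)
    have c: "cell x p \<noteq> 1" using r(1) by (simp add: at.simps)
    have IH: "(VAL, [r, m]) \<in> meaning x \<longleftrightarrow> m = n div 2 \<and> m < length x + 2" for m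
      using less.IH[OF _ r(2)] False by simp
    have "(VAL, [p, v]) \<in> meaning x \<longleftrightarrow> v < length x + 2 \<and> n div 2 < length x + 2 \<and> v = 2 * (n div 2) + of_bool (odd n)"
    proof
      assume "(VAL, [p, v]) \<in> meaning x"
      then obtain c r' m where v: "v < length x + 2" "v = 2 * m + of_bool c"
        and m: "at x p [True, c] r'" "(VAL, [r', m]) \<in> meaning x"
        using VAL_unfold[of p v x] c by blast
      have cr: "c = odd n" "r' = r" using u[OF m(1)] by blast+
      have "m = n div 2" "m < length x + 2" using m(2) IH[of m] unfolding cr by blast+
      then show "v < length x + 2 \<and> n div 2 < length x + 2 \<and> v = 2 * (n div 2) + of_bool (odd n)"
        using v unfolding cr by blast
    next
      assume "v < length x + 2 \<and> n div 2 < length x + 2 \<and> v = 2 * (n div 2) + of_bool (odd n)"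
      moreover from this have "(VAL, [r, n div 2]) \<in> meaning x" using IH[of "n div 2"] by blast
      moreover have "p < length x + 2" using b by simp
      ultimately show "(VAL, [p, v]) \<in> meaning x"
        using VAL_unfold[of p v x] r(1) by blast
    qed
    also have "\<dots> \<longleftrightarrow> v = n \<and> v < length x + 2"
    proof -
      have "2 * (n div 2) + of_bool (odd n) = n" by (cases "odd n") auto
      then show ?thesis by auto
    qed
    finally show ?thesis .
  qed
qed

lemma NEQ_unfold:
  "(NEQ, [p, q]) \<in> meaning x \<longleftrightarrow> p < length x + 2 \<and> q < length x + 2 \<and>
    (cell x p = 1 \<and> cell x q = 2 \<or> cell x p = 2 \<and> cell x q = 1 \<or> cell x p = 2 \<and> cell x q = 2 \<and>
      (cell x (p + 1) = 1 \<and> cell x (q + 1) = 2 \<or> cell x (p + 1) = 2 \<and> cell x (q + 1) = 1 \<or>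
       (NEQ, [p + 2, q + 2]) \<in> meaning x))"
proof -
  have "(NEQ, [p, q]) \<in> meaning x \<Longrightarrow> p < length x + 2 \<and> q < length x + 2" for p q
    by (subst (asm) meaning_iff) auto
  from this[of "p + 2" "q + 2"] show ?thesis
    by (subst meaning_iff) (auto simp: body_simps neq_fm_def)
qed

lemma NEQ_iff:
  "at x p (enc_nat n) p' \<Longrightarrow> at x q (enc_nat m) q' \<Longrightarrow> (NEQ, [p, q]) \<in> meaning x \<longleftrightarrow> n \<noteq> m"
proof (induction n arbitrary: m p q rule: less_induct)
  case (less n)
  note b = at_bounds[OF less.prems(1)] at_bounds[OF less.prems(2)]
  have bd: "p < length x + 2" "q < length x + 2" using b by auto
  have c: "cell x p = (if n = 0 then 1 else 2)" "cell x q = (if m = 0 then 1 else 2)"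
    using less.prems hd_enc_nat[of n] hd_enc_nat[of m] by (auto simp: at.simps)
  show ?case
  proof (cases "n = 0 \<or> m = 0")
    case True
    then show ?thesis using c bd by (subst NEQ_unfold) auto
  next
    case False
    then have "at x p ([True, odd n] @ enc_nat (n div 2)) p'"
      using less.prems False by (simp add: enc_nat_pos)
    then obtain r where r: "at x p [True, odd n] r" "at x r (enc_nat (n div 2)) p'"
      using at_append by blast
    have "at x q ([True, odd m] @ enc_nat (m div 2)) q'"
      using less.prems False by (simp add: enc_nat_pos)
    then obtain s where s: "at x q [True, odd m] s" "at x s (enc_nat (m div 2)) q'"
      using at_append by blast
    have rs: "r = p + 2" "s = q + 2" using at_bounds[OF r(1)] at_bounds[OF s(1)] by auto
    have o: "cell x (p + 1) = (if odd n then 2 else 1)" "cell x (q + 1) = (if odd m then 2 else 1)"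
      using r(1) s(1) by (auto simp: at.simps)
    have IH: "(NEQ, [p + 2, q + 2]) \<in> meaning x \<longleftrightarrow> n div 2 \<noteq> m div 2"
      using less.IH[OF _ r(2) s(2)] False rs by simp
    have "(NEQ, [p, q]) \<in> meaning x \<longleftrightarrow> odd n \<noteq> odd m \<or> n div 2 \<noteq> m div 2"
      using c bd False o IH by (subst NEQ_unfold) auto
    also have "\<dots> \<longleftrightarrow> n \<noteq> m"
      by (metis bit_eq_rec)
    finally show ?thesis .
  qed
qed

lemma NOTIN_unfold:
  "(NOTIN, [p, q]) \<in> meaning x \<longleftrightarrow> p < length x + 2 \<and> q < length x + 2 \<and>
    (cell x q = 1 \<or> cell x q = 2 \<and> (\<exists>r. (NAT, [q + 2, r]) \<in> meaning x \<and>
      (cell x (q + 1) = 1 \<or> cell x (q + 1) = 2 \<and> (NEQ, [p, q + 2]) \<in> meaning x) \<and> (NOTIN, [p, r]) \<in> meaning x))"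
proof -
  have "(NAT, [p, q]) \<in> meaning x \<Longrightarrow> p < length x + 2 \<and> q < length x + 2" for p q
    by (subst (asm) meaning_iff) auto
  moreover have "(NOTIN, [p, q]) \<in> meaning x \<longleftrightarrow> p < length x + 2 \<and> q < length x + 2 \<and>
    (cell x q = 1 \<or> (\<exists>s<length x + 2. \<exists>r<length x + 2. cell x q = 2 \<and> s = q + 2 \<and> (NAT, [s, r]) \<in> meaning x \<and>
      (cell x (q + 1) = 1 \<or> cell x (q + 1) = 2 \<and> (NEQ, [p, s]) \<in> meaning x) \<and> (NOTIN, [p, r]) \<in> meaning x))"
    by (subst meaning_iff) (simp add: body_simps notin_fm_def)
  ultimately show ?thesis by blast
qed

lemma NOTIN_iff:
  assumes "at x p (enc_nat n) p'"
  shows "at x q (enc_list enc_symbol \<beta>) q' \<Longrightarrow> (NOTIN, [p, q]) \<in> meaning x \<longleftrightarrow> Var n \<notin> set \<beta>"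
proof (induction \<beta> arbitrary: q)
  case Nil
  then have "cell x q = 1" by (simp add: at.simps)
  then show ?case using at_bounds[OF assms] at_bounds[OF Nil] by (subst NOTIN_unfold) auto
next
  case (Cons s \<beta>)
  have b: "p < length x + 2" "q < length x + 2" using at_bounds[OF assms] at_bounds[OF Cons.prems] by auto
  obtain m where m: "s = Const m \<or> s = Var m" by (cases s) auto
  define t where "t = (case s of Const _ \<Rightarrow> False | Var _ \<Rightarrow> True)"
  have "enc_list enc_symbol (s # \<beta>) = [True, t] @ (enc_nat m @ enc_list enc_symbol \<beta>)"
    using m by (auto simp: t_def)
  then obtain r1 r where r: "at x q [True, t] r1" "at x r1 (enc_nat m) r" "at x r (enc_list enc_symbol \<beta>) q'"
    using Cons.prems at_append by metis
  have r1: "r1 = q + 2" using at_bounds[OF r(1)] by simp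
  have c: "cell x q = 2" "cell x (q + 1) = (if t then 2 else 1)" using r(1) by (auto simp: at.simps)
  have nat: "(NAT, [q + 2, r']) \<in> meaning x \<longleftrightarrow> r' = r" for r'
    unfolding NAT_iff using r(2) at_enc_nat_unique unfolding r1 by blast
  have "(NEQ, [p, q + 2]) \<in> meaning x \<longleftrightarrow> n \<noteq> m"
    using NEQ_iff[OF assms r(2)] r1 by simp
  then have "(NOTIN, [p, q]) \<in> meaning x \<longleftrightarrow> (t \<longrightarrow> n \<noteq> m) \<and> (NOTIN, [p, r]) \<in> meaning x"
    using b c nat by (subst NOTIN_unfold) auto
  then show ?case using Cons.IH[OF r(3)] m by (auto simp: t_def)
qed

lemma at_less: "at x p bs q \<Longrightarrow> p < length x + 2" "at x p bs q \<Longrightarrow> q < length x + 2"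
  using at_bounds[of x p bs q] by auto

lemma ALIST_unfold:
  "(ALIST, [p, q]) \<in> meaning x \<longleftrightarrow> p < length x + 2 \<and> q < length x + 2 \<and>
    (at x p [False] q \<or>
     (\<exists>r s. at x p [True, True] r \<and> (NAT, [r, s]) \<in> meaning x \<and> (NOTIN, [r, s]) \<in> meaning x \<and> (ALIST, [s, q]) \<in> meaning x) \<or>
     (\<exists>a\<in>terminals \<sigma>. \<exists>r. at x p (True # False # enc_nat a) r \<and> (ALIST, [r, q]) \<in> meaning x))"
proof -
  have "(ALIST, [p, q]) \<in> meaning x \<longleftrightarrow> p < length x + 2 \<and> q < length x + 2 \<and>
    (at x p [False] q \<or>
     (\<exists>r<length x + 2. \<exists>s<length x + 2. at x p [True, True] r \<and> (NAT, [r, s]) \<in> meaning x \<and> (NOTIN, [r, s]) \<in> meaning x \<and> (ALIST, [s, q]) \<in> meaning x) \<or>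
     (\<exists>a\<in>terminals \<sigma>. \<exists>r<length x + 2. at x p (True # False # enc_nat a) r \<and> (ALIST, [r, q]) \<in> meaning x))"
    by (subst meaning_iff) (simp add: body_simps alist_fm_def sat_At cong: conj_cong)
  moreover have "(NAT, [r, s]) \<in> meaning x \<Longrightarrow> s < length x + 2" for r s
    unfolding NAT_iff using at_less by blast
  then have "(\<exists>r<length x + 2. \<exists>s<length x + 2. at x p [True, True] r \<and> (NAT, [r, s]) \<in> meaning x \<and>
      (NOTIN, [r, s]) \<in> meaning x \<and> (ALIST, [s, q]) \<in> meaning x) \<longleftrightarrow>
    (\<exists>r s. at x p [True, True] r \<and> (NAT, [r, s]) \<in> meaning x \<and> (NOTIN, [r, s]) \<in> meaning x \<and> (ALIST, [s, q]) \<in> meaning x)"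
    using at_less(2)[of x p "[True, True]"] by blast
  moreover have "(\<exists>r<length x + 2. at x p (True # False # enc_nat a) r \<and> (ALIST, [r, q]) \<in> meaning x) \<longleftrightarrow>
    (\<exists>r. at x p (True # False # enc_nat a) r \<and> (ALIST, [r, q]) \<in> meaning x)" for a
    using at_less(2)[of x p "True # False # enc_nat a"] by blast
  ultimately show ?thesis by (simp only:)
qed

text \<open>Comparing each variable with the items behind it is enough for regularity.\<close>

lemma ALIST_iff:
  "(ALIST, [p, q]) \<in> meaning x \<longleftrightarrow>
    (\<exists>\<alpha>\<in>lists (symbols \<sigma>). regular_pattern \<alpha> \<and> at x p (enc_list enc_symbol \<alpha>) q)"
proof
  assume "(ALIST, [p, q]) \<in> meaning x"
  then show "\<exists>\<alpha>\<in>lists (symbols \<sigma>). regular_pattern \<alpha> \<and> at x p (enc_list enc_symbol \<alpha>) q"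
  proof (induction "length x + 2 - p" arbitrary: p rule: less_induct)
    case less
    have IH: "\<exists>\<alpha>\<in>lists (symbols \<sigma>). regular_pattern \<alpha> \<and> at x r (enc_list enc_symbol \<alpha>) q"
      if "at x p bs r" "bs \<noteq> []" "(ALIST, [r, q]) \<in> meaning x" for r bs
    proof (rule less.hyps)
      show "length x + 2 - r < length x + 2 - p" using at_bounds[OF that(1)] that(2) by (cases bs) auto
    qed fact
    from less.prems consider "at x p [False] q"
      | r s where "at x p [True, True] r" "(NAT, [r, s]) \<in> meaning x" "(NOTIN, [r, s]) \<in> meaning x" "(ALIST, [s, q]) \<in> meaning x"
      | a r where "a \<in> terminals \<sigma>" "at x p (True # False # enc_nat a) r" "(ALIST, [r, q]) \<in> meaning x"
      using ALIST_unfold[of p q x] by blast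
    then show ?case
    proof cases
      case 1
      then show ?thesis by (intro bexI[of _ "[]"]) (auto simp: regular_pattern_def)
    next
      case 2
      obtain n where n: "at x r (enc_nat n) s" using 2(2) NAT_iff by blast
      have p: "at x p ([True, True] @ enc_nat n) s" using 2(1) n at_append by blast
      obtain \<beta> where \<beta>: "\<beta> \<in> lists (symbols \<sigma>)" "regular_pattern \<beta>" "at x s (enc_list enc_symbol \<beta>) q"
        using IH[OF p _ 2(4)] by auto
      have "Var n \<notin> set \<beta>" using NOTIN_iff[OF n \<beta>(3)] 2(3) by simp
      then have "regular_pattern (Var n # \<beta>)" using \<beta> by (simp add: regular_pattern_Var)
      moreover have "at x p (([True, True] @ enc_nat n) @ enc_list enc_symbol \<beta>) q"
        using p \<beta>(3) at_append by blast
      moreover have "Var n # \<beta> \<in> lists (symbols \<sigma>)" using \<beta> by (simp add: symbols_def)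
      ultimately show ?thesis by (intro bexI[of _ "Var n # \<beta>"]) auto
    next
      case 3
      obtain \<beta> where \<beta>: "\<beta> \<in> lists (symbols \<sigma>)" "regular_pattern \<beta>" "at x r (enc_list enc_symbol \<beta>) q"
        using IH[OF 3(2) _ 3(3)] by auto
      have "regular_pattern (Const a # \<beta>)" using \<beta> by (simp add: regular_pattern_Const)
      moreover have "at x p ((True # False # enc_nat a) @ enc_list enc_symbol \<beta>) q"
        using 3(2) \<beta>(3) at_append by blast
      moreover have "Const a # \<beta> \<in> lists (symbols \<sigma>)" using \<beta> 3(1) by (simp add: symbols_def)
      ultimately show ?thesis by (intro bexI[of _ "Const a # \<beta>"]) auto
    qed
  qed
next
  assume "\<exists>\<alpha>\<in>lists (symbols \<sigma>). regular_pattern \<alpha> \<and> at x p (enc_list enc_symbol \<alpha>) q"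
  then obtain \<alpha> where "\<alpha> \<in> lists (symbols \<sigma>)" "regular_pattern \<alpha>" "at x p (enc_list enc_symbol \<alpha>) q" by blast
  then show "(ALIST, [p, q]) \<in> meaning x"
  proof (induction \<alpha> arbitrary: p rule: list.induct)
    case Nil
    then have "at x p [False] q" by simp
    then show ?case using at_less ALIST_unfold[of p q x] by blast
  next
    case (Cons s \<beta>)
    note l = at_less[OF Cons.prems(3)]
    show ?case
    proof (cases s)
      case (Const a)
      then have "at x p ((True # False # enc_nat a) @ enc_list enc_symbol \<beta>) q" using Cons.prems by simp
      then obtain r where r: "at x p (True # False # enc_nat a) r" "at x r (enc_list enc_symbol \<beta>) q"
        using at_append by blast
      have "(ALIST, [r, q]) \<in> meaning x"
        using Cons Const r(2) by (intro Cons.IH) (auto simp: regular_pattern_Const)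
      moreover have "a \<in> terminals \<sigma>" using Cons.prems(1) Const by (auto simp: symbols_def)
      ultimately show ?thesis using l r(1) ALIST_unfold[of p q x] by blast
    next
      case (Var n)
      then have "at x p ([True, True] @ (enc_nat n @ enc_list enc_symbol \<beta>)) q" using Cons.prems by simp
      then obtain r where r: "at x p [True, True] r" "at x r (enc_nat n @ enc_list enc_symbol \<beta>) q"
        using at_append by blast
      then obtain t where t: "at x r (enc_nat n) t" "at x t (enc_list enc_symbol \<beta>) q"
        using at_append by blast
      have reg: "Var n \<notin> set \<beta>" "regular_pattern \<beta>"
        using Cons.prems(2) Var by (simp_all add: regular_pattern_Var)
      have "(ALIST, [t, q]) \<in> meaning x"
        using Cons.prems reg t(2) by (intro Cons.IH) auto
      moreover have "(NOTIN, [r, t]) \<in> meaning x" using NOTIN_iff[OF t] reg by simp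
      moreover have "(NAT, [r, t]) \<in> meaning x" using t(1) NAT_iff by blast
      ultimately show ?thesis using l r(1) ALIST_unfold[of p q x] by blast
    qed
  qed
qed

section \<open>Words in the input: next occurrences and agreement\<close>

definition word_at :: "bool list \<Rightarrow> nat \<Rightarrow> nat list \<Rightarrow> bool" where
  "word_at x p v \<longleftrightarrow> v \<in> lists (terminals \<sigma>) \<and> (\<exists>q. at x p (enc_list enc_nat v) q)"

lemma word_at_Nil: "word_at x p [] \<Longrightarrow> cell x p = 1 \<and> \<not> at x p (True # bs) r"
  by (auto simp: word_at_def at.simps)

lemma word_at_less: "word_at x p v \<Longrightarrow> p < length x + 2"
  by (auto simp: word_at_def dest: at_less)

lemma at_letter_unique: "at x p (True # enc_nat a) r \<Longrightarrow> at x p (True # enc_nat b) r' \<Longrightarrow> a = b \<and> r = r'"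
  using at_enc_nat_unique by (auto simp: at.simps)

text \<open>Prefix-freeness makes reading deterministic, so the disjunctions over all letters in the
  formulas collapse to a single case.\<close>

lemma word_at_Cons:
  assumes "word_at x p (c # v)"
  obtains r where "at x p (True # enc_nat c) r" "word_at x r v" "cell x p = 2" "c \<in> terminals \<sigma>"
    "\<And>b r'. at x p (True # enc_nat b) r' \<longleftrightarrow> b = c \<and> r' = r"
proof -
  obtain q where "at x p ((True # enc_nat c) @ enc_list enc_nat v) q" using assms by (auto simp: word_at_def)
  then obtain r where r: "at x p (True # enc_nat c) r" "at x r (enc_list enc_nat v) q"
    using at_append by blast
  have "word_at x r v" "c \<in> terminals \<sigma>" using r(2) assms by (auto simp: word_at_def)
  moreover have "cell x p = 2" using r(1) by (simp add: at.simps)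
  moreover have "at x p (True # enc_nat b) r' \<longleftrightarrow> b = c \<and> r' = r" for b r'
    using r(1) at_letter_unique by blast
  ultimately show thesis using that r(1) by blast
qed

lemma WLIST_unfold:
  "(WLIST, [p, q, l]) \<in> meaning x \<longleftrightarrow> p < length x + 2 \<and> q < length x + 2 \<and> l < length x + 2 \<and>
    (at x p [False] q \<and> l = 0 \<or>
     (\<exists>a\<in>terminals \<sigma>. \<exists>r l'. at x p (True # enc_nat a) r \<and> l = Suc l' \<and> (WLIST, [r, q, l']) \<in> meaning x))"
proof -
  have "(WLIST, [p, q, l]) \<in> meaning x \<longleftrightarrow> p < length x + 2 \<and> q < length x + 2 \<and> l < length x + 2 \<and>
    (at x p [False] q \<and> l = 0 \<or>
     (\<exists>a\<in>terminals \<sigma>. \<exists>r<length x + 2. \<exists>l'<length x + 2. at x p (True # enc_nat a) r \<and> l = Suc l' \<and> (WLIST, [r, q, l']) \<in> meaning x))"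
    by (subst meaning_iff) (simp add: body_simps wlist_fm_def sat_At cong: conj_cong)
  moreover have "l < length x + 2 \<Longrightarrow> (\<exists>r<length x + 2. \<exists>l'<length x + 2. at x p (True # enc_nat a) r \<and> l = Suc l' \<and> (WLIST, [r, q, l']) \<in> meaning x) \<longleftrightarrow>
    (\<exists>r l'. at x p (True # enc_nat a) r \<and> l = Suc l' \<and> (WLIST, [r, q, l']) \<in> meaning x)" for a
    using at_less(2)[of x p "True # enc_nat a"] Suc_lessD by blast
  ultimately show ?thesis by (simp only: cong: conj_cong)
qed

lemma WLIST_iff:
  "(WLIST, [p, q, l]) \<in> meaning x \<longleftrightarrow> (\<exists>w\<in>lists (terminals \<sigma>). at x p (enc_list enc_nat w) q \<and> length w = l)"
proof
  show "\<exists>w\<in>lists (terminals \<sigma>). at x p (enc_list enc_nat w) q \<and> length w = l"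
    if "(WLIST, [p, q, l]) \<in> meaning x"
    using that
  proof (induction l arbitrary: p)
    case 0
    then have "at x p [False] q" using WLIST_unfold[of p q 0 x] by blast
    then show ?case by (intro bexI[of _ "[]"]) auto
  next
    case (Suc l)
    then obtain a r where a: "a \<in> terminals \<sigma>" "at x p (True # enc_nat a) r" "(WLIST, [r, q, l]) \<in> meaning x"
      using WLIST_unfold[of p q "Suc l" x] by blast
    then obtain w where w: "w \<in> lists (terminals \<sigma>)" "at x r (enc_list enc_nat w) q" "length w = l"
      using Suc.IH by blast
    have "at x p ((True # enc_nat a) @ enc_list enc_nat w) q" using a w at_append by blast
    then show ?case using a(1) w by (intro bexI[of _ "a # w"]) auto
  qed
next
  have "(WLIST, [p, q, length w]) \<in> meaning x" if "at x p (enc_list enc_nat w) q" "\<forall>a\<in>set w. a \<in> terminals \<sigma>" for w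
    using that
  proof (induction w arbitrary: p)
    case Nil
    then have "at x p [False] q" by simp
    then show ?case using at_less WLIST_unfold[of p q 0 x] by simp
  next
    case (Cons a w)
    then have "at x p ((True # enc_nat a) @ enc_list enc_nat w) q" by simp
    then obtain r where r: "at x p (True # enc_nat a) r" "at x r (enc_list enc_nat w) q"
      using at_append by blast
    then have m: "(WLIST, [r, q, length w]) \<in> meaning x" using Cons by simp
    \<comment> \<open>Every letter takes at least one bit, so the length of a word is itself a
      position.\<close>
    have len: "length w < length (enc_list enc_nat w)" for w by (induction w) auto
    have "length (a # w) < length x + 2"
      using at_bounds[OF Cons.prems(1)] len[of "a # w"] by linarith
    then have "Suc (length w) < length x + 2" by simp
    moreover have "a \<in> terminals \<sigma>" using Cons by simp
    ultimately show ?case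
      using WLIST_unfold[of p q "Suc (length w)" x] r(1) m at_less[OF Cons.prems(1)] unfolding list.size by auto
  qed
  then show "(WLIST, [p, q, l]) \<in> meaning x"
    if "\<exists>w\<in>lists (terminals \<sigma>). at x p (enc_list enc_nat w) q \<and> length w = l"
    using that by (auto simp: in_lists_conv_set)
qed

lemma NOA_unfold:
  "a \<le> \<sigma> \<Longrightarrow> (NOA a, [p]) \<in> meaning x \<longleftrightarrow> p < length x + 2 \<and>
    (cell x p = 1 \<or> (\<exists>b\<in>terminals \<sigma>. b \<noteq> a \<and> (\<exists>r. at x p (True # enc_nat b) r \<and> (NOA a, [r]) \<in> meaning x)))"
proof -
  assume "a \<le> \<sigma>"
  then have "(NOA a, [p]) \<in> meaning x \<longleftrightarrow> p < length x + 2 \<and>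
    (cell x p = 1 \<or> (\<exists>b\<in>{b \<in> terminals \<sigma>. b \<noteq> a}. \<exists>r<length x + 2. at x p (True # enc_nat b) r \<and> (NOA a, [r]) \<in> meaning x))"
    by (subst meaning_iff) (simp add: body_simps noa_fm_def sat_At cong: conj_cong)
  moreover have "(\<exists>r<length x + 2. at x p (True # enc_nat b) r \<and> (NOA a, [r]) \<in> meaning x) \<longleftrightarrow>
      (\<exists>r. at x p (True # enc_nat b) r \<and> (NOA a, [r]) \<in> meaning x)" for b
    using at_less(2)[of x p "True # enc_nat b"] by blast
  ultimately show ?thesis by (simp only: mem_Collect_eq) blast
qed

lemma NOA_iff: "a \<le> \<sigma> \<Longrightarrow> word_at x p v \<Longrightarrow> (NOA a, [p]) \<in> meaning x \<longleftrightarrow> a \<notin> set v"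
proof (induction v arbitrary: p)
  case Nil
  then show ?case using word_at_Nil[OF Nil(2)] word_at_less[OF Nil(2)] NOA_unfold[of a p x] by simp
next
  case (Cons c v)
  obtain r where r: "at x p (True # enc_nat c) r" "word_at x r v" "cell x p = 2" "c \<in> terminals \<sigma>"
    "\<And>b r'. at x p (True # enc_nat b) r' \<longleftrightarrow> b = c \<and> r' = r"
    using word_at_Cons[OF Cons.prems(2)] by blast
  have "(NOA a, [p]) \<in> meaning x \<longleftrightarrow> c \<noteq> a \<and> (NOA a, [r]) \<in> meaning x"
    using NOA_unfold[OF Cons.prems(1), of p x] r(3-5) word_at_less[OF Cons.prems(2)] by auto
  then show ?case using Cons.IH[OF Cons.prems(1) r(2)] by auto
qed

lemma NXT_unfold:
  "a \<le> \<sigma> \<Longrightarrow> (NXT a, [p, q]) \<in> meaning x \<longleftrightarrow> p < length x + 2 \<and> q < length x + 2 \<and>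
    (at x p (True # enc_nat a) q \<or>
      (\<exists>b\<in>terminals \<sigma>. b \<noteq> a \<and> (\<exists>r. at x p (True # enc_nat b) r \<and> (NXT a, [r, q]) \<in> meaning x)))"
proof -
  assume "a \<le> \<sigma>"
  then have "(NXT a, [p, q]) \<in> meaning x \<longleftrightarrow> p < length x + 2 \<and> q < length x + 2 \<and>
    (at x p (True # enc_nat a) q \<or>
      (\<exists>b\<in>{b \<in> terminals \<sigma>. b \<noteq> a}. \<exists>r<length x + 2. at x p (True # enc_nat b) r \<and> (NXT a, [r, q]) \<in> meaning x))"
    by (subst meaning_iff) (simp add: body_simps nxt_fm_def sat_At cong: conj_cong)
  moreover have "(\<exists>r<length x + 2. at x p (True # enc_nat b) r \<and> (NXT a, [r, q]) \<in> meaning x) \<longleftrightarrow>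
      (\<exists>r. at x p (True # enc_nat b) r \<and> (NXT a, [r, q]) \<in> meaning x)" for b
    using at_less(2)[of x p "True # enc_nat b"] by blast
  ultimately show ?thesis by (simp only: mem_Collect_eq) blast
qed

lemma NXT_sound:
  "a \<le> \<sigma> \<Longrightarrow> word_at x p v \<Longrightarrow> (NXT a, [p, q]) \<in> meaning x \<Longrightarrow>
    \<exists>y v'. v = y @ a # v' \<and> a \<notin> set y \<and> word_at x q v'"
proof (induction v arbitrary: p)
  case Nil
  then show ?case using word_at_Nil[OF Nil(2)] NXT_unfold[of a p q x] by blast
next
  case (Cons c v)
  obtain r where r: "at x p (True # enc_nat c) r" "word_at x r v" "cell x p = 2" "c \<in> terminals \<sigma>"
    "\<And>b r'. at x p (True # enc_nat b) r' \<longleftrightarrow> b = c \<and> r' = r"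
    using word_at_Cons[OF Cons.prems(2)] by blast
  show ?case
  proof (cases "c = a")
    case True
    then have "q = r" using NXT_unfold[OF Cons.prems(1), of p q x] Cons.prems(3) r(5) by blast
    then show ?thesis using True r(2) by (intro exI[of _ "[]"] exI[of _ v]) simp
  next
    case False
    then have "\<not> at x p (True # enc_nat a) q" using r(5) by simp
    then obtain b s where "at x p (True # enc_nat b) s" "(NXT a, [s, q]) \<in> meaning x"
      using NXT_unfold[OF Cons.prems(1), of p q x] Cons.prems(3) by blast
    then have "(NXT a, [r, q]) \<in> meaning x" using r(5) by simp
    then obtain y v' where "v = y @ a # v'" "a \<notin> set y" "word_at x q v'"
      using Cons.IH[OF Cons.prems(1) r(2)] by blast
    then show ?thesis using False by (intro exI[of _ "c # y"] exI[of _ v']) simp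
  qed
qed

lemma NXT_complete:
  "a \<le> \<sigma> \<Longrightarrow> word_at x p (y @ a # v) \<Longrightarrow> a \<notin> set y \<Longrightarrow> \<exists>q. (NXT a, [p, q]) \<in> meaning x \<and> word_at x q v"
proof (induction y arbitrary: p)
  case Nil
  have "word_at x p (a # v)" using Nil by simp
  then obtain r where r: "at x p (True # enc_nat a) r" "word_at x r v"
    by (rule word_at_Cons)
  then show ?case using NXT_unfold[OF Nil(1), of p r x] at_less[OF r(1)] by blast
next
  case (Cons c y)
  have "word_at x p (c # (y @ a # v))" using Cons.prems by simp
  then obtain r where r: "at x p (True # enc_nat c) r" "word_at x r (y @ a # v)" "c \<in> terminals \<sigma>"
    by (rule word_at_Cons)
  then obtain q where q: "(NXT a, [r, q]) \<in> meaning x" "word_at x q v" using Cons by auto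
  have "c \<noteq> a" using Cons.prems(3) by auto
  then have "(NXT a, [p, q]) \<in> meaning x"
    using NXT_unfold[OF Cons.prems(1), of p q x] r q at_less[OF r(1)] word_at_less[OF q(2)] by blast
  then show ?case using q by blast
qed

lemma EQ_unfold:
  "a \<le> \<sigma> \<Longrightarrow> (EQ a, [p, q, r]) \<in> meaning x \<longleftrightarrow> p < length x + 2 \<and> q < length x + 2 \<and> r < length x + 2 \<and>
    (r = 0 \<or> (NOA a, [p]) \<in> meaning x \<and> (NOA a, [q]) \<in> meaning x \<or>
     (\<exists>p'<length x + 2. \<exists>q'<length x + 2. \<exists>r'<length x + 2. (NXT a, [p, p']) \<in> meaning x \<and> (NXT a, [q, q']) \<in> meaning x \<and> r = Suc r' \<and>
       (\<forall>b\<in>terminals \<sigma>. (EQ b, [p', q', r']) \<in> meaning x)))"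
  by (subst meaning_iff) (simp add: body_simps eq_fm_def ball_Un cong: conj_cong)

lemma agree_next_terminals:
  assumes "a \<notin> set y" "a \<notin> set z" "u \<in> lists (terminals \<sigma>)" "v \<in> lists (terminals \<sigma>)"
  shows "agree a (y @ a # u) (z @ a # v) (Suc r) \<longleftrightarrow> (\<forall>b\<in>terminals \<sigma>. agree b u v r)"
  using assms agree_next simon_congruent_agree_on[of u "terminals \<sigma>" v r] by (auto simp: in_lists_conv_set subset_iff)

text \<open>By induction on the depth, for all letters and positions at once, since agreement for
  one letter rests on agreement for all letters one level below.\<close>

lemma EQ_iff:
  "a \<in> terminals \<sigma> \<Longrightarrow> word_at x p u \<Longrightarrow> word_at x q v \<Longrightarrow> r < length x + 2 \<Longrightarrow>
    (EQ a, [p, q, r]) \<in> meaning x \<longleftrightarrow> agree a u v r"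
proof (induction r arbitrary: a p q u v)
  case 0
  then have "a \<le> \<sigma>" by (simp add: terminals_def)
  then show ?case using EQ_unfold[of a p q 0 x] word_at_less[OF 0(2)] word_at_less[OF 0(3)] by simp
next
  case (Suc r)
  have a: "a \<le> \<sigma>" using Suc.prems(1) by (simp add: terminals_def)
  note unfold = EQ_unfold[OF a, of p q "Suc r" x]
  note l = word_at_less[OF Suc.prems(2)] word_at_less[OF Suc.prems(3)]
  note noa = NOA_iff[OF a Suc.prems(2)] NOA_iff[OF a Suc.prems(3)]
  show ?case
  proof
    assume "(EQ a, [p, q, Suc r]) \<in> meaning x"
    then consider "a \<notin> set u" "a \<notin> set v"
      | p' q' where "(NXT a, [p, p']) \<in> meaning x" "(NXT a, [q, q']) \<in> meaning x"
        "\<forall>b\<in>terminals \<sigma>. (EQ b, [p', q', r]) \<in> meaning x"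
      using unfold noa by blast
    then show "agree a u v (Suc r)"
    proof cases
      case 1
      then show ?thesis by (rule agree_absent)
    next
      case 2
      obtain y u' where u: "u = y @ a # u'" "a \<notin> set y" "word_at x p' u'"
        using NXT_sound[OF a Suc.prems(2) 2(1)] by blast
      obtain z v' where v: "v = z @ a # v'" "a \<notin> set z" "word_at x q' v'"
        using NXT_sound[OF a Suc.prems(3) 2(2)] by blast
      have "\<forall>b\<in>terminals \<sigma>. agree b u' v' r"
        using 2(3) Suc.IH[OF _ u(3) v(3)] Suc.prems(4) by simp
      then show ?thesis using agree_next_terminals u v by (simp add: word_at_def)
    qed
  next
    assume ag: "agree a u v (Suc r)"
    show "(EQ a, [p, q, Suc r]) \<in> meaning x"
    proof (cases "a \<in> set u")
      case False
      then have "a \<notin> set v" using agree_SucD[OF ag] by simp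
      then show ?thesis using False unfold noa l Suc.prems(4) by blast
    next
      case True
      then have "a \<in> set v" using agree_SucD[OF ag] by simp
      obtain y u' where u: "u = y @ a # u'" "a \<notin> set y" using split_list_first[OF True] by blast
      obtain z v' where v: "v = z @ a # v'" "a \<notin> set z" using split_list_first[OF \<open>a \<in> set v\<close>] by blast
      obtain p' where p': "(NXT a, [p, p']) \<in> meaning x" "word_at x p' u'"
        using NXT_complete[OF a _ u(2)] Suc.prems(2) u(1) by blast
      obtain q' where q': "(NXT a, [q, q']) \<in> meaning x" "word_at x q' v'"
        using NXT_complete[OF a _ v(2)] Suc.prems(3) v(1) by blast
      have "\<forall>b\<in>terminals \<sigma>. agree b u' v' r"
        using ag agree_next_terminals u v p'(2) q'(2) by (simp add: word_at_def)
      then have "\<forall>b\<in>terminals \<sigma>. (EQ b, [p', q', r]) \<in> meaning x"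
        using Suc.IH[OF _ p'(2) q'(2)] Suc.prems(4) by simp
      moreover have "r < length x + 2" using Suc.prems(4) by simp
      ultimately show ?thesis
        using unfold p'(1) q'(1) word_at_less[OF p'(2)] word_at_less[OF q'(2)] l Suc.prems(4) by blast
    qed
  qed
qed

section \<open>Traversing the pattern\<close>

abbreviation n :: nat where "n \<equiv> arity \<sigma>"

definition B :: "bool list \<Rightarrow> nat" where "B x = length x + 2"

text \<open>
  Reading a letter \<open>b\<close> whose pair has depth \<open>Suc R\<close> leads to the position \<open>J\<close> behind the next
  \<open>b\<close>, and every letter then has two constraints, of which the one with the larger depth implies the
  other one. The letters in \<open>T\<close> take the new constraint.
\<close>

definition pos_step :: "bool list \<Rightarrow> (nat \<times> nat list) set \<Rightarrow> (nat \<Rightarrow> nat) \<Rightarrow> nat \<Rightarrow> (nat \<Rightarrow> nat) \<Rightarrow> bool" where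
  "pos_step x S f b g \<longleftrightarrow> f (2 * b) = 0 \<and> g = f \<or>
    (\<exists>J<B x. \<exists>R<B x. (NXT b, [f (2 * b - 1), J]) \<in> S \<and> f (2 * b) = Suc R \<and> (\<exists>T\<subseteq>terminals \<sigma>.
      (\<forall>a\<in>terminals \<sigma>. if a \<in> T then a \<noteq> b \<longrightarrow> f (2 * a) \<le> R \<and> (EQ a, [J, f (2 * a - 1), f (2 * a)]) \<in> S
         else a \<noteq> b \<and> R \<le> f (2 * a) \<and> (EQ a, [f (2 * a - 1), J, R]) \<in> S) \<and>
      g = (\<lambda>i. if (i + 1) div 2 \<in> T then if odd i then J else R else f i)))"

definition neg_step :: "bool list \<Rightarrow> (nat \<times> nat list) set \<Rightarrow> (nat \<Rightarrow> nat) \<Rightarrow> nat \<Rightarrow> nat \<Rightarrow> nat \<Rightarrow> (nat \<Rightarrow> nat) \<Rightarrow> bool" where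
  "neg_step x S f q b q' h \<longleftrightarrow> (if q \<noteq> b then q' = q \<and> h = f else
    f (2 * \<sigma> + 2) \<noteq> 0 \<and> (NOA b, [f (2 * \<sigma> + 1)]) \<in> S \<and> q' = 0 \<and> h = f \<or>
    (\<exists>J<B x. \<exists>R<B x. (NXT b, [f (2 * \<sigma> + 1), J]) \<in> S \<and> f (2 * \<sigma> + 2) = Suc R \<and> q' \<in> terminals \<sigma> \<and>
       h = f(2 * \<sigma> + 1 := J, 2 * \<sigma> + 2 := R)))"

text \<open>The two parts of a step concern disjoint entries: \<open>g\<close> supplies the
  constraints and \<open>h\<close> the separating pair.\<close>

definition moved :: "nat \<Rightarrow> (nat \<Rightarrow> nat) \<Rightarrow> (nat \<Rightarrow> nat) \<Rightarrow> nat \<Rightarrow> nat" where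
  "moved y g h i = (if i = 0 then y else if i > 2 * \<sigma> then h i else g i)"

definition acc :: "(nat \<times> nat list) set \<Rightarrow> nat \<Rightarrow> (nat \<Rightarrow> nat) \<Rightarrow> bool" where
  "acc S q f \<longleftrightarrow> (ACC q, map f [0..<n]) \<in> S"

definition read_step :: "bool list \<Rightarrow> (nat \<times> nat list) set \<Rightarrow> (nat \<Rightarrow> nat) \<Rightarrow> nat \<Rightarrow> nat \<Rightarrow> nat \<Rightarrow> bool" where
  "read_step x S f q b y \<longleftrightarrow> (\<exists>g q' h. pos_step x S f b g \<and> neg_step x S f q b q' h \<and> acc S q' (moved y g h))"

section \<open>Semantics of the acceptance formulas\<close>

lemma acc_cong: "(\<And>i. i < n \<Longrightarrow> f i = g i) \<Longrightarrow> acc S q f = acc S q g"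
  unfolding acc_def by (metis (no_types, lifting) atLeastLessThan_iff map_cong set_upt)

text \<open>The choice of \<open>T\<close> is a disjunction over the subsets of a fixed alphabet, so
  the formula does not depend on the input.\<close>

lemma subseqs_letters: "(\<exists>T\<in>set (subseqs (letters \<sigma>)). P (set T)) \<longleftrightarrow> (\<exists>T\<subseteq>terminals \<sigma>. P T)"
proof -
  have "set ` set (subseqs (letters \<sigma>)) = Pow (terminals \<sigma>)" by (simp add: subseqs_powset)
  then show ?thesis by (metis (mono_tags, opaque_lifting) PowD PowI imageE imageI)
qed

lemma terminals_index [simp]:
  "a \<in> terminals \<sigma> \<Longrightarrow> 2 * a < n" "a \<in> terminals \<sigma> \<Longrightarrow> 2 * a - 1 < n"
  "a \<in> terminals \<sigma> \<Longrightarrow> 2 * a \<noteq> n + k" "a \<in> terminals \<sigma> \<Longrightarrow> 2 * a - 1 \<noteq> n + k"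
  by (auto simp: terminals_def arity_def)

lemma sat_pos_fm:
  assumes b: "b \<in> terminals \<sigma>" and e: "\<And>i. i < n \<Longrightarrow> e i = f i"
  shows "sat x S e (pos_fm \<sigma> b k) \<longleftrightarrow> f (2 * b) = 0 \<and> sat x S e (k (\<lambda>i. i)) \<or>
    (\<exists>J<B x. \<exists>R<B x. (NXT b, [f (2 * b - 1), J]) \<in> S \<and> f (2 * b) = Suc R \<and> (\<exists>T\<subseteq>terminals \<sigma>.
      (\<forall>a\<in>terminals \<sigma>. if a \<in> T then a \<noteq> b \<longrightarrow> f (2 * a) \<le> R \<and> (EQ a, [J, f (2 * a - 1), f (2 * a)]) \<in> S
         else a \<noteq> b \<and> R \<le> f (2 * a) \<and> (EQ a, [f (2 * a - 1), J, R]) \<in> S) \<and>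
      sat x S (e(n + 1 := J, n + 2 := R)) (k (\<lambda>i. if (i + 1) div 2 \<in> T then if odd i then n + 1 else n + 2 else i))))"
proof -
  have f: "e (2 * a) = f (2 * a)" "e (2 * a - 1) = f (2 * a - 1)" if "a \<in> terminals \<sigma>" for a
    using e[OF terminals_index(1)[OF that]] e[OF terminals_index(2)[OF that]] by blast+
  have u: "(e(n + 1 := J, n + 2 := R)) (2 * a) = f (2 * a)" "(e(n + 1 := J, n + 2 := R)) (2 * a - 1) = f (2 * a - 1)"
    "(e(n + 1 := J, n + 2 := R)) (n + 1) = J" "(e(n + 1 := J, n + 2 := R)) (n + 2) = R"
    if "a \<in> terminals \<sigma>" for a J R
  proof -
    have "2 * a \<noteq> n + 1" "2 * a \<noteq> n + 2" "2 * a - 1 \<noteq> n + 1" "2 * a - 1 \<noteq> n + 2"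
      using terminals_index(1,2)[OF that] by linarith+
    then show "(e(n + 1 := J, n + 2 := R)) (2 * a) = f (2 * a)" "(e(n + 1 := J, n + 2 := R)) (2 * a - 1) = f (2 * a - 1)"
      "(e(n + 1 := J, n + 2 := R)) (n + 1) = J" "(e(n + 1 := J, n + 2 := R)) (n + 2) = R"
      using f[OF that] by (simp_all only: fun_upd_apply) simp_all
  qed
  have guard: "sat x S (e(n + 1 := J, n + 2 := R)) (guard_fm \<sigma> b T) \<longleftrightarrow>
      (\<forall>a\<in>terminals \<sigma>. if a \<in> T then a \<noteq> b \<longrightarrow> f (2 * a) \<le> R \<and> (EQ a, [J, f (2 * a - 1), f (2 * a)]) \<in> S
         else a \<noteq> b \<and> R \<le> f (2 * a) \<and> (EQ a, [f (2 * a - 1), J, R]) \<in> S)" for T J R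
    unfolding guard_fm_def Let_def sat_Ands set_map set_letters ball_simps
    by (rule ball_cong[OF refl]) (simp add: u del: fun_upd_apply One_nat_def)
  show ?thesis
    unfolding pos_fm_def Let_def sat.simps sat_Ands sat_Ors B_def[symmetric] subseqs_letters[symmetric]
    using u[OF b] f[OF b]
    by (simp add: guard Suc_eq_plus1 del: fun_upd_apply One_nat_def set_subseqs_eq in_set_subseqs)
qed

lemma sat_neg_fm:
  assumes b: "b \<in> terminals \<sigma>" and e: "\<And>i. i < n \<Longrightarrow> e i = f i" and f: "f (2 * \<sigma> + 2) < B x"
  shows "sat x S e (neg_fm \<sigma> q b k) \<longleftrightarrow> (if q \<noteq> b then sat x S e (k q (\<lambda>i. i)) else
    f (2 * \<sigma> + 2) \<noteq> 0 \<and> (NOA b, [f (2 * \<sigma> + 1)]) \<in> S \<and> sat x S e (k 0 (\<lambda>i. i)) \<or>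
    (\<exists>J<B x. \<exists>R<B x. (NXT b, [f (2 * \<sigma> + 1), J]) \<in> S \<and> f (2 * \<sigma> + 2) = Suc R \<and> (\<exists>c\<in>terminals \<sigma>.
       sat x S (e(n + 3 := J, n + 4 := R)) (k c ((\<lambda>i. i)(2 * \<sigma> + 1 := n + 3, 2 * \<sigma> + 2 := n + 4))))))"
proof -
  let ?j = "2 * \<sigma> + 1" and ?r = "2 * \<sigma> + 2"
  have ne: "?j \<noteq> n + i" "?r \<noteq> n + i" for i by (auto simp: arity_def)
  have ef: "e ?j = f ?j" "e ?r = f ?r" using e by (simp_all add: arity_def)
  \<comment> \<open>A nonzero depth below \<open>B x\<close> has its predecessor among the
    positions.\<close>
  have "(\<exists>v<B x. f ?r = v + 1) \<longleftrightarrow> f ?r \<noteq> 0"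
    using f by (cases "f ?r") auto
  then show ?thesis
    unfolding neg_fm_def Let_def using ef
    by (simp add: ne B_def[symmetric] Suc_eq_plus1 del: One_nat_def)
qed

text \<open>The bound \<open>n + 3\<close> on the renamed variables keeps them apart from those that
  \<open>neg_fm\<close> binds.\<close>

lemma sat_tail:
  assumes b: "b \<in> terminals \<sigma>" and e: "\<And>i. i < n \<Longrightarrow> e i = f i" and f: "f (2 * \<sigma> + 2) < B x"
    and m: "\<And>i. i \<le> 2 * \<sigma> \<Longrightarrow> e (m i) = g i \<and> m i < n + 3" and y: "y = 0 \<or> y = n"
  shows "sat x S e (neg_fm \<sigma> q b (\<lambda>q' m'. move_fm \<sigma> q' (\<lambda>i. if i = 0 then y else if i > 2 * \<sigma> then m' i else m i)))
    \<longleftrightarrow> (\<exists>q' h. neg_step x S f q b q' h \<and> acc S q' (moved (e y) g h))"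
proof -
  let ?j = "2 * \<sigma> + 1" and ?r = "2 * \<sigma> + 2"
  let ?m = "\<lambda>m' i. if i = 0 then y else if i > 2 * \<sigma> then m' i else m i"
  have move: "sat x S e' (move_fm \<sigma> q' m') \<longleftrightarrow> acc S q' (\<lambda>i. e' (m' i))" for e' q' m'
    by (simp add: move_fm_def acc_def o_def)
  have 1: "acc S q' (\<lambda>i. e (?m (\<lambda>i. i) i)) = acc S q' (moved (e y) g f)" for q'
    by (rule acc_cong) (use e m in \<open>auto simp: moved_def\<close>)
  have 2: "acc S q' (\<lambda>i. (e(n + 3 := J, n + 4 := R)) (?m ((\<lambda>i. i)(?j := n + 3, ?r := n + 4)) i)) =
      acc S q' (moved (e y) g (f(?j := J, ?r := R)))" for q' J R
  proof (rule acc_cong)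
    fix i assume i: "i < n"
    consider "i = 0" | "i > 2 * \<sigma>" "i = ?j" | "i > 2 * \<sigma>" "i = ?r" | "0 < i" "i \<le> 2 * \<sigma>"
      using i unfolding arity_def by linarith
    then show "(e(n + 3 := J, n + 4 := R)) (?m ((\<lambda>i. i)(?j := n + 3, ?r := n + 4)) i) =
        moved (e y) g (f(?j := J, ?r := R)) i"
    proof cases
      case 4
      then have "m i \<noteq> n + 3" "m i \<noteq> n + 4" "e (m i) = g i" using m[of i] by auto
      then show ?thesis using 4 by (simp add: moved_def)
    qed (use y in \<open>auto simp: moved_def arity_def\<close>)
  qed
  have "sat x S e (neg_fm \<sigma> q b (\<lambda>q' m'. move_fm \<sigma> q' (?m m'))) \<longleftrightarrow> (if q \<noteq> b then acc S q (moved (e y) g f) else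
    f ?r \<noteq> 0 \<and> (NOA b, [f ?j]) \<in> S \<and> acc S 0 (moved (e y) g f) \<or>
    (\<exists>J<B x. \<exists>R<B x. (NXT b, [f ?j, J]) \<in> S \<and> f ?r = Suc R \<and> (\<exists>c\<in>terminals \<sigma>.
       acc S c (moved (e y) g (f(?j := J, ?r := R))))))"
    by (subst sat_neg_fm[where e = e and f = f, OF b e f]) (simp_all only: move 1 2)
  then show ?thesis
    unfolding neg_step_def by (auto simp del: fun_upd_apply One_nat_def)
qed

text \<open>Turns the continuation style of the formulas into the choice of a next tuple
  \<open>g\<close>, so that the kind of step is separated from what follows it.\<close>

lemma ex_choice:
  fixes d :: nat
  shows "P \<and> Q c \<or> (\<exists>J<d. \<exists>R<d. A J \<and> E R \<and> (\<exists>T\<subseteq>U. G J R T \<and> Q (t J R T))) \<longleftrightarrow>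
    (\<exists>g. (P \<and> g = c \<or> (\<exists>J<d. \<exists>R<d. A J \<and> E R \<and> (\<exists>T\<subseteq>U. G J R T \<and> g = t J R T))) \<and> Q g)"
  by blast

lemma sat_read_fm:
  assumes b: "b \<in> terminals \<sigma>" and e: "\<And>i. i < n \<Longrightarrow> e i = f i" and f: "f (2 * \<sigma> + 2) < B x"
    and y: "y = 0 \<or> y = n"
  shows "sat x S e (read_fm \<sigma> q b y) \<longleftrightarrow> read_step x S f q b (e y)"
proof -
  let ?k = "\<lambda>m. neg_fm \<sigma> q b (\<lambda>q' m'. move_fm \<sigma> q' (\<lambda>i. if i = 0 then y else if i > 2 * \<sigma> then m' i else m i))"
  let ?R = "\<lambda>g. \<exists>q' h. neg_step x S f q b q' h \<and> acc S q' (moved (e y) g h)"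
  have 1: "sat x S e (?k (\<lambda>i. i)) \<longleftrightarrow> ?R f"
    by (rule sat_tail[OF b, of e f, OF e f _ y]) (use e in \<open>auto simp: arity_def\<close>)
  have 2: "sat x S (e(n + 1 := J, n + 2 := R)) (?k (\<lambda>i. if (i + 1) div 2 \<in> T then if odd i then n + 1 else n + 2 else i)) \<longleftrightarrow>
      ?R (\<lambda>i. if (i + 1) div 2 \<in> T then if odd i then J else R else f i)" for J R T
  proof -
    let ?e = "e(n + 1 := J, n + 2 := R)"
    have "?e y = e y" using y by (auto simp: arity_def)
    moreover have "sat x S ?e (?k (\<lambda>i. if (i + 1) div 2 \<in> T then if odd i then n + 1 else n + 2 else i)) \<longleftrightarrow>
      (\<exists>q' h. neg_step x S f q b q' h \<and> acc S q' (moved (?e y) (\<lambda>i. if (i + 1) div 2 \<in> T then if odd i then J else R else f i) h))"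
      by (rule sat_tail[OF b, of ?e f, OF _ f _ y]) (use e in \<open>auto simp: arity_def\<close>)
    ultimately show ?thesis by (simp only:)
  qed
  have "read_step x S f q b (e y) \<longleftrightarrow> (\<exists>g. pos_step x S f b g \<and> ?R g)"
    unfolding read_step_def by blast
  then show ?thesis
    unfolding read_fm_def pos_step_def ex_choice[where Q = ?R, symmetric]
    by (subst sat_pos_fm[where e = e and f = f, OF b e]) (simp_all only: 1 2)
qed

definition acc_step :: "bool list \<Rightarrow> (nat \<times> nat list) set \<Rightarrow> nat \<Rightarrow> (nat \<Rightarrow> nat) \<Rightarrow> bool" where
  "acc_step x S q f \<longleftrightarrow>
    cell x (f 0) = 1 \<and> (\<forall>a\<in>terminals \<sigma>. f (2 * a) = 0 \<or> (NOA a, [f (2 * a - 1)]) \<in> S) \<and>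
      (q \<noteq> 0 \<longrightarrow> f (2 * \<sigma> + 2) \<noteq> 0 \<and> (\<exists>v<B x. (NXT q, [f (2 * \<sigma> + 1), v]) \<in> S)) \<or>
    (\<exists>u<B x. \<exists>v<B x. at x (f 0) [True, True] u \<and> (NAT, [u, v]) \<in> S \<and> acc S q (f(0 := v))) \<or>
    (\<exists>b\<in>terminals \<sigma>. \<exists>y<B x. at x (f 0) (True # False # enc_nat b) y \<and> read_step x S f q b y) \<or>
    (\<exists>b\<in>terminals \<sigma>. cell x (f 0) = 2 \<and> cell x (f 0 + 1) = 2 \<and> read_step x S f q b (f 0))"

lemma sat_acc_fm:
  assumes f: "f (2 * \<sigma> + 2) < B x"
  shows "sat x S f (acc_fm \<sigma> q) \<longleftrightarrow> acc_step x S q f"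
proof -
  let ?j = "2 * \<sigma> + 1" and ?r = "2 * \<sigma> + 2"
  have ne: "?j \<noteq> n" "?r \<noteq> n" "0 \<noteq> n" by (auto simp: arity_def)
  have e0: "sat x S f (Chr 0 0 1) \<longleftrightarrow> cell x (f 0) = 1" by simp
  have e1: "sat x S f (if q = 0 then Tru else Ands [Ex n (Off n 1 ?r), Ex n (Rel (NXT q) [?j, n])]) \<longleftrightarrow>
     (q \<noteq> 0 \<longrightarrow> f ?r \<noteq> 0 \<and> (\<exists>v<B x. (NXT q, [f ?j, v]) \<in> S))"
  proof -
    have "(\<exists>v<B x. f ?r = v + 1) \<longleftrightarrow> f ?r \<noteq> 0"
      using f by (cases "f ?r") auto
    then show ?thesis using ne by (simp add: B_def[symmetric] del: One_nat_def)
  qed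
  have e2: "(\<forall>\<psi>\<in>set (map (\<lambda>a. Or (Chr (2 * a) 0 3) (Rel (NOA a) [2 * a - 1])) (letters \<sigma>)). sat x S f \<psi>) \<longleftrightarrow>
     (\<forall>a\<in>terminals \<sigma>. f (2 * a) = 0 \<or> (NOA a, [f (2 * a - 1)]) \<in> S)"
    by (simp del: One_nat_def)
  have e3: "sat x S f (Ex n (Ex (n + 1) (Ands [At 0 [True, True] n, Rel NAT [n, n + 1], move_fm \<sigma> q ((\<lambda>i. i)(0 := n + 1))]))) \<longleftrightarrow>
     (\<exists>u<B x. \<exists>v<B x. at x (f 0) [True, True] u \<and> (NAT, [u, v]) \<in> S \<and> acc S q (f(0 := v)))"
  proof -
    have "sat x S (f(n := u, n + 1 := v)) (move_fm \<sigma> q ((\<lambda>i. i)(0 := n + 1))) \<longleftrightarrow> acc S q (f(0 := v))" for u v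
      unfolding move_fm_def sat.simps map_map acc_def[symmetric]
      by (rule acc_cong) (auto simp: arity_def)
    then show ?thesis using ne by (simp add: B_def[symmetric] sat_At cong: conj_cong)
  qed
  have r: "sat x S (f(n := y)) (read_fm \<sigma> q b n) \<longleftrightarrow> read_step x S f q b y" if "b \<in> terminals \<sigma>" for b y
    using sat_read_fm[OF that, of "f(n := y)" f x n S q] f by simp
  have e4: "(\<exists>\<psi>\<in>set (map (\<lambda>b. Ex n (And (At 0 (True # False # enc_nat b) n) (read_fm \<sigma> q b n))) (letters \<sigma>)). sat x S f \<psi>) \<longleftrightarrow>
     (\<exists>b\<in>terminals \<sigma>. \<exists>y<B x. at x (f 0) (True # False # enc_nat b) y \<and> read_step x S f q b y)"
    using ne by (simp add: B_def[symmetric] sat_At r cong: conj_cong)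
  have e5: "(\<exists>\<psi>\<in>set (map (\<lambda>b. Ands [Chr 0 0 2, Chr 0 1 2, read_fm \<sigma> q b 0]) (letters \<sigma>)). sat x S f \<psi>) \<longleftrightarrow>
     (\<exists>b\<in>terminals \<sigma>. cell x (f 0) = 2 \<and> cell x (f 0 + 1) = 2 \<and> read_step x S f q b (f 0))"
    using sat_read_fm[of _ f f x 0 S q] f by (simp del: One_nat_def)
  show ?thesis
    unfolding acc_fm_def Let_def sat_Ors set_simps set_append bex_simps ball_simps bex_Un sat_Ands e1 e2 e3 e4 e5 acc_step_def
    by (simp add: e0 e1 e2 e3 e4 e5 del: One_nat_def set_map sat.simps) blast
qed

section \<open>Patterns in the input\<close>

definition pattern_at :: "bool list \<Rightarrow> nat \<Rightarrow> symbol list \<Rightarrow> bool" where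
  "pattern_at x p \<beta> \<longleftrightarrow> \<beta> \<in> lists (symbols \<sigma>) \<and> (\<exists>q. at x p (enc_list enc_symbol \<beta>) q)"

lemma pattern_at_Nil: "pattern_at x p [] \<Longrightarrow> cell x p = 1 \<and> \<not> at x p (True # bs) r"
  by (auto simp: pattern_at_def at.simps)

lemma pattern_at_less: "pattern_at x p \<beta> \<Longrightarrow> p < length x + 2"
  by (auto simp: pattern_at_def dest: at_less)

lemma pattern_at_Const:
  assumes "pattern_at x p (Const a # \<beta>)"
  obtains r where "at x p (True # False # enc_nat a) r" "pattern_at x r \<beta>" "a \<in> terminals \<sigma>"
proof -
  obtain q where "at x p ((True # False # enc_nat a) @ enc_list enc_symbol \<beta>) q" using assms by (auto simp: pattern_at_def)
  then obtain r where "at x p (True # False # enc_nat a) r" "at x r (enc_list enc_symbol \<beta>) q"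
    using at_append by blast
  then show thesis using that assms by (auto simp: pattern_at_def symbols_def)
qed

lemma pattern_at_Var:
  assumes "pattern_at x p (Var m # \<beta>)"
  obtains u r where "at x p [True, True] u" "at x u (enc_nat m) r" "pattern_at x r \<beta>"
proof -
  obtain q where "at x p ([True, True] @ (enc_nat m @ enc_list enc_symbol \<beta>)) q" using assms by (auto simp: pattern_at_def)
  then obtain u where u: "at x p [True, True] u" "at x u (enc_nat m @ enc_list enc_symbol \<beta>) q"
    using at_append by blast
  then obtain r where "at x u (enc_nat m) r" "at x r (enc_list enc_symbol \<beta>) q"
    using at_append by blast
  then show thesis using that u assms by (auto simp: pattern_at_def)
qed

lemma pattern_at_end:
  assumes "pattern_at x p \<beta>" "cell x p = 1"
  shows "\<beta> = []"
proof (cases \<beta>)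
  case (Cons s \<beta>')
  then show ?thesis using assms by (auto simp: pattern_at_def at.simps)
qed simp

lemma pattern_at_Const_D:
  assumes "pattern_at x p \<beta>" "at x p (True # False # enc_nat b) y"
  shows "\<exists>\<beta>'. \<beta> = Const b # \<beta>' \<and> pattern_at x y \<beta>'"
proof (cases \<beta>)
  case Nil
  then show ?thesis using assms pattern_at_Nil by blast
next
  case (Cons s \<beta>')
  show ?thesis
  proof (cases s)
    case (Const c)
    then obtain r where r: "at x p (True # False # enc_nat c) r" "pattern_at x r \<beta>'"
      using pattern_at_Const assms(1) Cons by blast
    have "at x (Suc (Suc p)) (enc_nat b) y" "at x (Suc (Suc p)) (enc_nat c) r"
      using r(1) assms(2) by (simp_all add: at.simps)
    then show ?thesis using at_enc_nat_unique r(2) Cons Const by blast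
  next
    case (Var m)
    then obtain u where "at x p [True, True] u" using pattern_at_Var assms(1) Cons by blast
    then show ?thesis using assms(2) by (simp add: at.simps)
  qed
qed

lemma pattern_at_Var_D:
  assumes "pattern_at x p \<beta>" "cell x p = 2" "cell x (p + 1) = 2"
  shows "\<exists>m \<beta>' r. \<beta> = Var m # \<beta>' \<and> at x p [True, True] (p + 2) \<and> at x (p + 2) (enc_nat m) r \<and> pattern_at x r \<beta>'"
proof (cases \<beta>)
  case Nil
  then show ?thesis using assms pattern_at_Nil by fastforce
next
  case (Cons s \<beta>')
  show ?thesis
  proof (cases s)
    case (Const c)
    then obtain r where "at x p (True # False # enc_nat c) r" using pattern_at_Const assms(1) Cons by blast
    then show ?thesis using assms(3) by (simp add: at.simps)
  next
    case (Var m)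
    then obtain u r where r: "at x p [True, True] u" "at x u (enc_nat m) r" "pattern_at x r \<beta>'"
      using pattern_at_Var assms(1) Cons by blast
    then have "u = p + 2" using at_bounds by fastforce
    then show ?thesis using r Cons Var by blast
  qed
qed

section \<open>Soundness and completeness of the traversal\<close>

definition wctx :: "bool list \<Rightarrow> nat \<Rightarrow> (nat \<Rightarrow> nat) \<Rightarrow> (nat \<Rightarrow> nat list) \<Rightarrow> nat list \<Rightarrow> bool" where
  "wctx x q f v w \<longleftrightarrow> (\<forall>a\<in>terminals \<sigma>. word_at x (f (2 * a - 1)) (v a)) \<and>
     (q \<noteq> 0 \<longrightarrow> q \<in> terminals \<sigma> \<and> word_at x (f (2 * \<sigma> + 1)) w)"

text \<open>The invariant of the traversal: \<open>u\<close> is still to be read, \<open>v a\<close>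
  and \<open>w\<close> are the suffixes to which the pairs point, and \<open>q = 0\<close> means
  that no separation is owed.\<close>

definition holds :: "nat \<Rightarrow> (nat \<Rightarrow> nat) \<Rightarrow> (nat \<Rightarrow> nat list) \<Rightarrow> nat list \<Rightarrow> nat list \<Rightarrow> bool" where
  "holds q f v w u \<longleftrightarrow> (\<forall>a\<in>terminals \<sigma>. agree a u (v a) (f (2 * a))) \<and>
     (q \<noteq> 0 \<longrightarrow> \<not> agree q u w (f (2 * \<sigma> + 2)))"

lemma word_at_set: "word_at x p v \<Longrightarrow> set v \<subseteq> terminals \<sigma>"
  by (auto simp: word_at_def)

lemma terminals_le: "a \<in> terminals \<sigma> \<Longrightarrow> a \<le> \<sigma>" "a \<in> terminals \<sigma> \<Longrightarrow> a \<noteq> 0"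
  by (auto simp: terminals_def)

lemma half_index: "a \<in> terminals \<sigma> \<Longrightarrow> (2 * a - 1 + 1) div 2 = a \<and> odd (2 * a - 1) \<and> (2 * a + 1) div 2 = a"
  by (cases a) (auto simp: terminals_def)

text \<open>Stated for an arbitrary part \<open>S\<close> of the least fixed point, because
  fixed-point induction supplies such a part.\<close>

lemma pos_sound:
  assumes S: "S \<subseteq> meaning x" and b: "b \<in> terminals \<sigma>" and step: "pos_step x S f b g"
    and W: "\<And>a. a \<in> terminals \<sigma> \<Longrightarrow> word_at x (f (2 * a - 1)) (v a)" and f: "\<And>i. f i < B x"
  obtains v' where "\<And>a. a \<in> terminals \<sigma> \<Longrightarrow> word_at x (g (2 * a - 1)) (v' a)"
    "\<And>u a. set u \<subseteq> terminals \<sigma> \<Longrightarrow> (\<And>a. a \<in> terminals \<sigma> \<Longrightarrow> agree a u (v' a) (g (2 * a))) \<Longrightarrow>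
      a \<in> terminals \<sigma> \<Longrightarrow> agree a (b # u) (v a) (f (2 * a))"
  using step[unfolded pos_step_def]
proof (elim disjE exE conjE)
  assume z: "f (2 * b) = 0" and g: "g = f"
  show thesis
  proof (rule that[of v])
    fix u a assume "\<And>a. a \<in> terminals \<sigma> \<Longrightarrow> agree a u (v a) (g (2 * a))" "a \<in> terminals \<sigma>"
    then show "agree a (b # u) (v a) (f (2 * a))" using z g by (cases "a = b") (auto simp: agree_Cons_neq)
  qed (use W g in auto)
next
  fix J R T
  assume J: "J < B x" "R < B x" and nxt: "(NXT b, [f (2 * b - 1), J]) \<in> S" and R: "f (2 * b) = Suc R"
    and T: "\<forall>a\<in>terminals \<sigma>. if a \<in> T then a \<noteq> b \<longrightarrow> f (2 * a) \<le> R \<and> (EQ a, [J, f (2 * a - 1), f (2 * a)]) \<in> S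
         else a \<noteq> b \<and> R \<le> f (2 * a) \<and> (EQ a, [f (2 * a - 1), J, R]) \<in> S"
    and g: "g = (\<lambda>i. if (i + 1) div 2 \<in> T then if odd i then J else R else f i)"
  obtain y w where y: "v b = y @ b # w" "b \<notin> set y" "word_at x J w"
    using NXT_sound[OF terminals_le(1)[OF b] W[OF b]] nxt S by blast
  have gi: "g (2 * a - 1) = (if a \<in> T then J else f (2 * a - 1))" "g (2 * a) = (if a \<in> T then R else f (2 * a))"
    if "a \<in> terminals \<sigma>" for a
    unfolding g using half_index[OF that] by (simp_all del: One_nat_def)
  have B': "R < length x + 2" "f i < length x + 2" for i using J(2) f by (simp_all add: B_def)
  have eq1: "agree a w (v a) (f (2 * a)) \<and> f (2 * a) \<le> R" if "a \<in> terminals \<sigma>" "a \<in> T" "a \<noteq> b" for a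
    using bspec[OF T that(1)] that S EQ_iff[OF that(1) y(3) W[OF that(1)] B'(2)] by auto
  have eq2: "a \<noteq> b \<and> R \<le> f (2 * a) \<and> agree a (v a) w R" if "a \<in> terminals \<sigma>" "a \<notin> T" for a
    using bspec[OF T that(1)] that S EQ_iff[OF that(1) W[OF that(1)] y(3) B'(1)] by auto
  show thesis
  proof (rule that[of "\<lambda>a. if a \<in> T then w else v a"])
    fix a assume "a \<in> terminals \<sigma>"
    then show "word_at x (g (2 * a - 1)) (if a \<in> T then w else v a)" using gi(1) W y(3) by simp
  next
    fix u a assume u: "set u \<subseteq> terminals \<sigma>" and a: "a \<in> terminals \<sigma>"
      and ag: "\<And>a. a \<in> terminals \<sigma> \<Longrightarrow> agree a u (if a \<in> T then w else v a) (g (2 * a))"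
    show "agree a (b # u) (v a) (f (2 * a))"
    proof (rule read_sound[where r = "\<lambda>a. f (2 * a)" and v = v and b = b and S = T and A = "terminals \<sigma>", OF u word_at_set[OF y(3)] y(1,2) R _ _ _ a])
      fix c assume c: "c \<in> terminals \<sigma>"
      show "if c \<in> T then agree c u w R else agree c u (v c) (f (2 * c))"
        using ag[OF c] gi(2)[OF c] by (cases "c \<in> T") simp_all
    qed (use eq1 eq2 in blast)+
  qed
qed

lemma neg_sound:
  assumes S: "S \<subseteq> meaning x" and b: "b \<in> terminals \<sigma>" and step: "neg_step x S f q b q' h"
    and W: "q \<noteq> 0 \<Longrightarrow> q \<in> terminals \<sigma> \<and> word_at x (f (2 * \<sigma> + 1)) w"
  obtains w' where "q' \<noteq> 0 \<Longrightarrow> q' \<in> terminals \<sigma> \<and> word_at x (h (2 * \<sigma> + 1)) w'"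
    "\<And>u. set u \<subseteq> terminals \<sigma> \<Longrightarrow> (q' \<noteq> 0 \<Longrightarrow> \<not> agree q' u w' (h (2 * \<sigma> + 2))) \<Longrightarrow>
      q \<noteq> 0 \<Longrightarrow> \<not> agree q (b # u) w (f (2 * \<sigma> + 2))"
proof (cases "q = b")
  case False
  then have "q' = q" "h = f" using step by (auto simp: neg_step_def)
  then show thesis using that[of w] W False by (auto simp: agree_Cons_neq)
next
  case True
  then have "q \<noteq> 0" using b terminals_le by blast
  note W = W[OF this]
  note w = word_at_set[OF conjunct2[OF W]]
  note noa = NOA_iff[OF terminals_le(1)[OF b] conjunct2[OF W]]
  from True step consider "f (2 * \<sigma> + 2) \<noteq> 0" "(NOA b, [f (2 * \<sigma> + 1)]) \<in> S" "q' = 0" "h = f"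
    | J R where "(NXT b, [f (2 * \<sigma> + 1), J]) \<in> S" "f (2 * \<sigma> + 2) = Suc R" "q' \<in> terminals \<sigma>"
       "h = f(2 * \<sigma> + 1 := J, 2 * \<sigma> + 2 := R)"
    unfolding neg_step_def by auto
  then show thesis
  proof cases
    case 1
    have "b \<notin> set w" using noa 1(2) S by blast
    moreover obtain r where "f (2 * \<sigma> + 2) = Suc r" using 1(1) by (cases "f (2 * \<sigma> + 2)") auto
    ultimately show thesis using that[of w] not_agree_Cons[OF _ w, of _ b] 1(3) True by blast
  next
    case 2
    obtain y w' where y: "w = y @ b # w'" "b \<notin> set y" "word_at x J w'"
      using NXT_sound[OF terminals_le(1)[OF b] conjunct2[OF W]] 2(1) S by blast
    show thesis
    proof (rule that[of w'])
      show "q' \<in> terminals \<sigma> \<and> word_at x (h (2 * \<sigma> + 1)) w'" using 2 y(3) by simp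
      fix u assume u: "set u \<subseteq> terminals \<sigma>" and n: "q' \<noteq> 0 \<Longrightarrow> \<not> agree q' u w' (h (2 * \<sigma> + 2))"
      have "\<not> agree q' u w' R" using n terminals_le(2)[OF 2(3)] 2(4) by simp
      then show "\<not> agree q (b # u) w (f (2 * \<sigma> + 2))"
        using not_agree_Cons[OF u w, of b "f (2 * \<sigma> + 2)"] True 2(2,3) y(1,2) by blast
    qed
  qed
qed

lemma moved_simps:
  "moved y g h 0 = y" "a \<in> terminals \<sigma> \<Longrightarrow> moved y g h (2 * a - 1) = g (2 * a - 1)"
  "a \<in> terminals \<sigma> \<Longrightarrow> moved y g h (2 * a) = g (2 * a)"
  "moved y g h (2 * \<sigma> + 1) = h (2 * \<sigma> + 1)" "moved y g h (2 * \<sigma> + 2) = h (2 * \<sigma> + 2)"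
  by (auto simp: moved_def terminals_def)

lemma step_sound:
  assumes S: "S \<subseteq> meaning x" and b: "b \<in> terminals \<sigma>"
    and pos: "pos_step x S f b g" and neg: "neg_step x S f q b q' h"
    and wctx: "wctx x q f v w" and f: "\<And>i. f i < B x"
  obtains v' w' where "wctx x q' (moved y g h) v' w'"
    "\<And>u. set u \<subseteq> terminals \<sigma> \<Longrightarrow> holds q' (moved y g h) v' w' u \<Longrightarrow> holds q f v w (b # u)"
proof -
  obtain v' where v': "\<And>a. a \<in> terminals \<sigma> \<Longrightarrow> word_at x (g (2 * a - 1)) (v' a)"
    "\<And>u a. set u \<subseteq> terminals \<sigma> \<Longrightarrow> (\<And>a. a \<in> terminals \<sigma> \<Longrightarrow> agree a u (v' a) (g (2 * a))) \<Longrightarrow>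
      a \<in> terminals \<sigma> \<Longrightarrow> agree a (b # u) (v a) (f (2 * a))"
    using pos_sound[OF S b pos _ f] wctx unfolding wctx_def by blast
  obtain w' where w': "q' \<noteq> 0 \<Longrightarrow> q' \<in> terminals \<sigma> \<and> word_at x (h (2 * \<sigma> + 1)) w'"
    "\<And>u. set u \<subseteq> terminals \<sigma> \<Longrightarrow> (q' \<noteq> 0 \<Longrightarrow> \<not> agree q' u w' (h (2 * \<sigma> + 2))) \<Longrightarrow>
      q \<noteq> 0 \<Longrightarrow> \<not> agree q (b # u) w (f (2 * \<sigma> + 2))"
    using neg_sound[OF S b neg] wctx unfolding wctx_def by blast
  show thesis
  proof (rule that[of v' w'])
    show "wctx x q' (moved y g h) v' w'" using v'(1) w'(1) by (simp add: wctx_def moved_simps del: One_nat_def)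
    fix u assume u: "set u \<subseteq> terminals \<sigma>" and "holds q' (moved y g h) v' w' u"
    then have "\<And>a. a \<in> terminals \<sigma> \<Longrightarrow> agree a u (v' a) (g (2 * a))" "q' \<noteq> 0 \<Longrightarrow> \<not> agree q' u w' (h (2 * \<sigma> + 2))"
      by (auto simp: holds_def moved_simps)
    then show "holds q f v w (b # u)"
      unfolding holds_def using v'(2)[OF u] w'(2)[OF u] by blast
  qed
qed

lemma pos_complete:
  assumes b: "b \<in> terminals \<sigma>" and u: "set u \<subseteq> terminals \<sigma>"
    and W: "\<And>a. a \<in> terminals \<sigma> \<Longrightarrow> word_at x (f (2 * a - 1)) (v a)" and f: "\<And>i. f i < B x"
    and ag: "\<And>a. a \<in> terminals \<sigma> \<Longrightarrow> agree a (b # u) (v a) (f (2 * a))"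
  obtains g v' where "pos_step x (meaning x) f b g" "\<And>a. a \<in> terminals \<sigma> \<Longrightarrow> word_at x (g (2 * a - 1)) (v' a)"
    "\<And>a. a \<in> terminals \<sigma> \<Longrightarrow> agree a u (v' a) (g (2 * a))" "\<And>i. g i < B x"
proof (cases "f (2 * b)")
  case 0
  show thesis
  proof (rule that[of f "v(b := v b)"])
    show "pos_step x (meaning x) f b f" using 0 by (simp add: pos_step_def)
    fix a assume "a \<in> terminals \<sigma>"
    then show "agree a u ((v(b := v b)) a) (f (2 * a))" "word_at x (f (2 * a - 1)) ((v(b := v b)) a)"
      using ag[of a] W[of a] 0 by (cases "a = b"; auto simp: agree_Cons_neq)+
  qed (use f in auto)
next
  case (Suc R)
  have R: "R < B x" using f[of "2 * b"] Suc by simp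
  obtain y w T where y: "v b = y @ b # w" "b \<notin> set y" and T: "T \<subseteq> terminals \<sigma>"
    and t1: "\<And>a. a \<in> T \<Longrightarrow> a \<noteq> b \<Longrightarrow> f (2 * a) \<le> R \<and> agree a w (v a) (f (2 * a))"
    and t2: "\<And>a. a \<in> terminals \<sigma> \<Longrightarrow> a \<notin> T \<Longrightarrow> a \<noteq> b \<and> R \<le> f (2 * a) \<and> agree a (v a) w R"
    and t3: "\<And>a. a \<in> terminals \<sigma> \<Longrightarrow> if a \<in> T then agree a u w R else agree a u (v a) (f (2 * a))"
    using read_complete[where r = "\<lambda>a. f (2 * a)" and v = v and b = b and A = "terminals \<sigma>", OF u word_at_set[OF W[OF b]] b Suc ag] by blast
  have "word_at x (f (2 * b - 1)) (y @ b # w)" using W[OF b] y(1) by simp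
  then obtain J where J: "(NXT b, [f (2 * b - 1), J]) \<in> meaning x" "word_at x J w"
    using NXT_complete[OF terminals_le(1)[OF b] _ y(2)] by blast
  define g where "g = (\<lambda>i. if (i + 1) div 2 \<in> T then if odd i then J else R else f i)"
  have gi: "g (2 * a - 1) = (if a \<in> T then J else f (2 * a - 1))" "g (2 * a) = (if a \<in> T then R else f (2 * a))"
    if "a \<in> terminals \<sigma>" for a
    unfolding g_def using half_index[OF that] by (simp_all del: One_nat_def)
  have B': "R < length x + 2" "f i < length x + 2" for i using R f by (simp_all add: B_def)
  have JB: "J < B x" using word_at_less[OF J(2)] by (simp add: B_def)
  show thesis
  proof (rule that[of g "\<lambda>a. if a \<in> T then w else v a"])
    have "\<forall>a\<in>terminals \<sigma>. if a \<in> T then a \<noteq> b \<longrightarrow> f (2 * a) \<le> R \<and> (EQ a, [J, f (2 * a - 1), f (2 * a)]) \<in> meaning x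
         else a \<noteq> b \<and> R \<le> f (2 * a) \<and> (EQ a, [f (2 * a - 1), J, R]) \<in> meaning x"
    proof
      fix a assume a: "a \<in> terminals \<sigma>"
      show "if a \<in> T then a \<noteq> b \<longrightarrow> f (2 * a) \<le> R \<and> (EQ a, [J, f (2 * a - 1), f (2 * a)]) \<in> meaning x
         else a \<noteq> b \<and> R \<le> f (2 * a) \<and> (EQ a, [f (2 * a - 1), J, R]) \<in> meaning x"
        using t1[of a] t2[of a] a EQ_iff[OF a J(2) W[OF a] B'(2)] EQ_iff[OF a W[OF a] J(2) B'(1)]
        by (cases "a \<in> T") simp_all
    qed
    then show "pos_step x (meaning x) f b g"
      unfolding pos_step_def using J(1) JB R Suc T g_def by blast
    fix a assume a: "a \<in> terminals \<sigma>"
    show "word_at x (g (2 * a - 1)) (if a \<in> T then w else v a)" using gi(1)[OF a] W[OF a] J(2) by simp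
    show "agree a u (if a \<in> T then w else v a) (g (2 * a))" using gi(2)[OF a] t3[OF a] by (cases "a \<in> T") simp_all
  next
    fix i show "g i < B x" using JB R f by (simp add: g_def)
  qed
qed

text \<open>The last conclusion keeps the entries beyond the tuple unchanged, so that they remain 0,
  the default of \<open>env\<close>.\<close>

lemma neg_complete:
  assumes b: "b \<in> terminals \<sigma>" and u: "set u \<subseteq> terminals \<sigma>"
    and W: "q \<noteq> 0 \<Longrightarrow> q \<in> terminals \<sigma> \<and> word_at x (f (2 * \<sigma> + 1)) w" and f: "\<And>i. f i < B x"
    and ag: "q \<noteq> 0 \<Longrightarrow> \<not> agree q (b # u) w (f (2 * \<sigma> + 2))"
  obtains q' h w' where "neg_step x (meaning x) f q b q' h" "q' \<noteq> 0 \<Longrightarrow> q' \<in> terminals \<sigma> \<and> word_at x (h (2 * \<sigma> + 1)) w'"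
    "q' \<noteq> 0 \<Longrightarrow> \<not> agree q' u w' (h (2 * \<sigma> + 2))" "\<And>i. h i < B x" "\<And>i. i \<ge> n \<Longrightarrow> h i = f i"
proof (cases "q = b")
  case False
  show thesis
  proof (rule that[of q f w])
    show "neg_step x (meaning x) f q b q f" using False by (simp add: neg_step_def)
    show "q \<noteq> 0 \<Longrightarrow> \<not> agree q u w (f (2 * \<sigma> + 2))" using ag False by (simp add: agree_Cons_neq)
  qed (use W f in auto)
next
  case True
  then have "q \<noteq> 0" using b terminals_le by blast
  note W = W[OF this] and ag = ag[OF this]
  note w = word_at_set[OF conjunct2[OF W]]
  obtain R where R: "f (2 * \<sigma> + 2) = Suc R"
    and *: "b \<notin> set w \<or> (\<exists>y v'. w = y @ b # v' \<and> b \<notin> set y \<and> (\<exists>c\<in>terminals \<sigma>. \<not> agree c u v' R))"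
    using ag not_agree_Cons[OF u w, of b "f (2 * \<sigma> + 2)"] True by blast
  have RB: "R < B x" using f[of "2 * \<sigma> + 2"] R by simp
  show thesis
  proof (cases "b \<in> set w")
    case False
    then have "(NOA b, [f (2 * \<sigma> + 1)]) \<in> meaning x"
      using NOA_iff[OF terminals_le(1)[OF b] conjunct2[OF W]] by simp
    then have "neg_step x (meaning x) f q b 0 f" using True R by (simp add: neg_step_def)
    then show thesis using that[of 0 f] f by blast
  next
    case b': True
    then obtain y v' c where y: "w = y @ b # v'" "b \<notin> set y" and c: "c \<in> terminals \<sigma>" "\<not> agree c u v' R"
      using * by blast
    obtain J where J: "(NXT b, [f (2 * \<sigma> + 1), J]) \<in> meaning x" "word_at x J v'"
      using NXT_complete[OF terminals_le(1)[OF b] _ y(2)] conjunct2[OF W] y(1) by blast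
    have JB: "J < B x" using word_at_less[OF J(2)] by (simp add: B_def)
    show thesis
    proof (rule that[of c "f(2 * \<sigma> + 1 := J, 2 * \<sigma> + 2 := R)" v'])
      show "neg_step x (meaning x) f q b c (f(2 * \<sigma> + 1 := J, 2 * \<sigma> + 2 := R))"
        unfolding neg_step_def using True J(1) JB RB R c(1) by auto
      show "c \<in> terminals \<sigma> \<and> word_at x ((f(2 * \<sigma> + 1 := J, 2 * \<sigma> + 2 := R)) (2 * \<sigma> + 1)) v'"
        using c(1) J(2) by simp
      show "\<not> agree c u v' ((f(2 * \<sigma> + 1 := J, 2 * \<sigma> + 2 := R)) (2 * \<sigma> + 2))" using c(2) by simp
      show "(f(2 * \<sigma> + 1 := J, 2 * \<sigma> + 2 := R)) i < B x" for i using JB RB f by simp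
      show "i \<ge> n \<Longrightarrow> (f(2 * \<sigma> + 1 := J, 2 * \<sigma> + 2 := R)) i = f i" for i by (simp add: arity_def)
    qed
  qed
qed

lemma index_cong:
  assumes "\<And>i. i < n \<Longrightarrow> f i = g i"
  shows "a \<in> terminals \<sigma> \<Longrightarrow> f (2 * a - 1) = g (2 * a - 1)" "a \<in> terminals \<sigma> \<Longrightarrow> f (2 * a) = g (2 * a)"
    "f (2 * \<sigma> + 1) = g (2 * \<sigma> + 1)" "f (2 * \<sigma> + 2) = g (2 * \<sigma> + 2)"
  using assms[OF terminals_index(2)] assms[OF terminals_index(1)] by (blast, blast, simp_all add: assms arity_def)

lemma wctx_cong: "(\<And>i. i < n \<Longrightarrow> f i = g i) \<Longrightarrow> wctx x q f v w = wctx x q g v w"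
  using index_cong[of f g] unfolding wctx_def by (simp del: One_nat_def)

lemma holds_cong: "(\<And>i. i < n \<Longrightarrow> f i = g i) \<Longrightarrow> holds q f v w u = holds q g v w u"
  using index_cong[of f g] unfolding holds_def by (simp del: One_nat_def)

lemma env_map: "i < n \<Longrightarrow> env (map f [0..<n]) i = f i"
  by (simp add: env_def)

lemma neg_step_le: "neg_step x S f q b q' h \<Longrightarrow> q \<le> \<sigma> \<Longrightarrow> q' \<le> \<sigma>"
  by (auto simp: neg_step_def terminals_def split: if_splits)

text \<open>A property of facts, as needed for fixed-point induction. A fact determines
  \<open>f\<close> only below \<open>n\<close>, so every such \<open>f\<close> is covered; relations
  other than \<open>ACC q\<close> are not constrained.\<close>

definition sound :: "bool list \<Rightarrow> nat \<times> nat list \<Rightarrow> bool" where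
  "sound x z \<longleftrightarrow> (\<forall>q f \<beta> v w. z = (ACC q, map f [0..<n]) \<longrightarrow> q \<le> \<sigma> \<longrightarrow> pattern_at x (f 0) \<beta> \<longrightarrow> wctx x q f v w \<longrightarrow>
     (\<exists>u\<in>matches \<sigma> \<beta>. holds q f v w u))"

lemma pattern_at_lists: "pattern_at x p \<beta> \<Longrightarrow> \<beta> \<in> lists (symbols \<sigma>)"
  by (simp add: pattern_at_def)

lemma matches_set: "pattern_at x p \<beta> \<Longrightarrow> u \<in> matches \<sigma> \<beta> \<Longrightarrow> set u \<subseteq> terminals \<sigma>"
  using matches_terminals[OF pattern_at_lists] by (auto simp: in_lists_conv_set)

lemma acc_step_sound:
  assumes S: "S \<subseteq> meaning x" "S \<subseteq> Collect (sound x)" and step: "acc_step x S q f" and q: "q \<le> \<sigma>"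
    and A: "pattern_at x (f 0) \<beta>" and ctx: "wctx x q f v w" and f: "\<And>i. f i < B x"
  shows "\<exists>u\<in>matches \<sigma> \<beta>. holds q f v w u"
proof -
  have n0: "0 < n" by (simp add: arity_def)
  have IH: "\<exists>u\<in>matches \<sigma> \<beta>'. holds q' g v' w' u"
    if "acc S q' g" "q' \<le> \<sigma>" "pattern_at x (g 0) \<beta>'" "wctx x q' g v' w'" for q' g \<beta>' v' w'
  proof -
    have "sound x (ACC q', map g [0..<n])" using that(1) S(2) by (auto simp: acc_def)
    then show ?thesis using that(2-4) unfolding sound_def by blast
  qed
  have read: "\<exists>u\<in>matches \<sigma> \<beta>'. holds q f v w (b # u)"
    if b: "b \<in> terminals \<sigma>" and r: "read_step x S f q b y" and A': "pattern_at x y \<beta>'" for b y \<beta>'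
  proof -
    obtain g q' h where s: "pos_step x S f b g" "neg_step x S f q b q' h" "acc S q' (moved y g h)"
      using r unfolding read_step_def by blast
    obtain v' w' where c: "wctx x q' (moved y g h) v' w'"
      and hl: "\<And>u. set u \<subseteq> terminals \<sigma> \<Longrightarrow> holds q' (moved y g h) v' w' u \<Longrightarrow> holds q f v w (b # u)"
      using step_sound[OF S(1) b s(1,2) ctx f] by blast
    have "pattern_at x (moved y g h 0) \<beta>'" using A' by (simp add: moved_simps)
    then obtain u where "u \<in> matches \<sigma> \<beta>'" "holds q' (moved y g h) v' w' u"
      using IH[OF s(3) neg_step_le[OF s(2) q] _ c] by blast
    then show ?thesis using hl matches_set[OF A'] by blast
  qed
  from step[unfolded acc_step_def] show ?thesis
  proof (elim disjE conjE bexE exE)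
    assume c: "cell x (f 0) = 1" and p: "\<forall>a\<in>terminals \<sigma>. f (2 * a) = 0 \<or> (NOA a, [f (2 * a - 1)]) \<in> S"
      and ng: "q \<noteq> 0 \<longrightarrow> f (2 * \<sigma> + 2) \<noteq> 0 \<and> (\<exists>v<B x. (NXT q, [f (2 * \<sigma> + 1), v]) \<in> S)"
    have "\<beta> = []" using pattern_at_end[OF A c] .
    moreover have "holds q f v w []"
      unfolding holds_def
    proof (intro conjI ballI impI)
      fix a assume a: "a \<in> terminals \<sigma>"
      then have "word_at x (f (2 * a - 1)) (v a)" using ctx by (simp add: wctx_def)
      then show "agree a [] (v a) (f (2 * a))"
        using bspec[OF p a] S(1) NOA_iff[OF terminals_le(1)[OF a]] unfolding agree_Nil by blast
    next
      assume q0: "q \<noteq> 0"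
      then have qt: "q \<in> terminals \<sigma>" "word_at x (f (2 * \<sigma> + 1)) w" using ctx by (simp_all add: wctx_def)
      obtain J where "(NXT q, [f (2 * \<sigma> + 1), J]) \<in> S" using ng q0 by blast
      then have "q \<in> set w" using NXT_sound[OF q qt(2)] S(1) by fastforce
      then show "\<not> agree q [] w (f (2 * \<sigma> + 2))" using ng q0 by (simp add: agree_Nil)
    qed
    ultimately show ?thesis by simp
  next
    fix y u assume at: "at x (f 0) [True, True] y" and nat: "(NAT, [y, u]) \<in> S" and acc: "acc S q (f(0 := u))"
    have y: "y = f 0 + 2" using at_bounds[OF at] by simp
    have "cell x (f 0) = 2" "cell x (f 0 + 1) = 2" using at by (simp_all add: at.simps)
    from pattern_at_Var_D[OF A this] obtain m \<beta>' r where r: "\<beta> = Var m # \<beta>'" "at x (f 0 + 2) (enc_nat m) r" "pattern_at x r \<beta>'" by blast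
    obtain k where "at x y (enc_nat k) u" using nat S(1) NAT_iff by blast
    then have "u = r" using at_enc_nat_unique r(2) unfolding y by blast
    have c: "wctx x q (f(0 := u)) v w" using ctx by (auto simp: wctx_def terminals_def)
    have "pattern_at x ((f(0 := u)) 0) \<beta>'" using r(3) \<open>u = r\<close> by simp
    from IH[OF acc q this c] obtain t where t: "t \<in> matches \<sigma> \<beta>'" "holds q (f(0 := u)) v w t" by blast
    have "holds q f v w t" using t(2) by (auto simp: holds_def terminals_def)
    \<comment> \<open>Leaving the variable contributes the empty word.\<close>
    moreover have "t \<in> matches \<sigma> \<beta>" unfolding r(1) matches.simps using t(1)
      by (intro CollectI exI[of _ "[]"] exI[of _ t]) simp
    ultimately show ?thesis by blast
  next
    fix b y assume b: "b \<in> terminals \<sigma>" and at: "at x (f 0) (True # False # enc_nat b) y" and r: "read_step x S f q b y"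
    obtain \<beta>' where \<beta>': "\<beta> = Const b # \<beta>'" "pattern_at x y \<beta>'" using pattern_at_Const_D[OF A at] by blast
    from read[OF b r \<beta>'(2)] show ?thesis unfolding \<beta>'(1) by auto
  next
    fix b assume b: "b \<in> terminals \<sigma>" and c: "cell x (f 0) = 2" "cell x (f 0 + 1) = 2" and r: "read_step x S f q b (f 0)"
    obtain m \<beta>' where \<beta>': "\<beta> = Var m # \<beta>'" using pattern_at_Var_D[OF A c] by blast
    from read[OF b r A] obtain u where u: "u \<in> matches \<sigma> \<beta>" "holds q f v w (b # u)" by blast
    then obtain u1 u2 where "u = u1 @ u2" "u1 \<in> lists (terminals \<sigma>)" "u2 \<in> matches \<sigma> \<beta>'" unfolding \<beta>' by auto
    \<comment> \<open>The position stayed on the variable, so the letter is put in front of the word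
      that the variable contributes.\<close>
    then have "b # u \<in> matches \<sigma> \<beta>" unfolding \<beta>' matches.simps using b
      by (intro CollectI exI[of _ "b # u1"] exI[of _ u2]) simp
    then show ?thesis using u(2) by blast
  qed
qed

text \<open>Reading a letter of depth 0 other than \<open>q\<close> into a variable does not change
  the tuple at all. So the recursion of \<open>ACC\<close> is not well-founded and its equation
  would also admit facts that support only themselves. Leastness excludes these, and it enters
  through fixed-point induction.\<close>

lemma meaning_sound: "meaning x \<subseteq> Collect (sound x)"
  unfolding meaning_def
proof (rule lfp_induct[OF mono_consequences])
  let ?S = "lfp (consequences x) \<inter> Collect (sound x)"
  show "consequences x ?S \<subseteq> Collect (sound x)"
  proof
    fix z assume z: "z \<in> consequences x ?S"
    have "\<exists>u\<in>matches \<sigma> \<beta>. holds q f v w u"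
      if z': "z = (ACC q, map f [0..<n])" and q: "q \<le> \<sigma>" and A: "pattern_at x (f 0) \<beta>" and c: "wctx x q f v w" for q f \<beta> v w
    proof -
      let ?f = "env (map f [0..<n])"
      have sat: "sat x ?S ?f (acc_fm \<sigma> q)" and bd: "\<forall>i\<in>set (map f [0..<n]). i < B x"
        using z unfolding z' consequences_def by (auto simp: body_simps B_def)
      have fB: "?f i < B x" for i using bd by (auto simp: env_def B_def)
      have "acc_step x ?S q ?f" using sat_acc_fm[of ?f x ?S q, OF fB] sat by blast
      moreover have "pattern_at x (?f 0) \<beta>" using A env_map[of 0 f] by (simp add: arity_def)
      moreover have "wctx x q ?f v w" using c wctx_cong[of ?f f] env_map by simp
      ultimately obtain u where "u \<in> matches \<sigma> \<beta>" "holds q ?f v w u"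
        using acc_step_sound[of ?S x q ?f \<beta> v w] q fB unfolding meaning_def by blast
      moreover have "holds q ?f v w u = holds q f v w u" by (rule holds_cong) (simp add: env_map)
      ultimately show ?thesis by auto
    qed
    then show "z \<in> Collect (sound x)" unfolding sound_def by blast
  qed
qed

lemma acc_sound:
  "acc (meaning x) q f \<Longrightarrow> q \<le> \<sigma> \<Longrightarrow> pattern_at x (f 0) \<beta> \<Longrightarrow> wctx x q f v w \<Longrightarrow> \<exists>u\<in>matches \<sigma> \<beta>. holds q f v w u"
  using meaning_sound[of x] unfolding acc_def sound_def by blast

lemma acc_intro:
  assumes "acc_step x (meaning x) q f" "q \<le> \<sigma>" "\<And>i. f i < B x" "\<And>i. i \<ge> n \<Longrightarrow> f i = 0"
  shows "acc (meaning x) q f"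
proof -
  have "env (map f [0..<n]) = f" using assms(4) by (auto simp: fun_eq_iff env_def)
  then show ?thesis
    unfolding acc_def meaning_iff using assms sat_acc_fm[of f x "meaning x" q]
    by (simp add: body_simps B_def)
qed

text \<open>Each move of the automaton consumes a letter of \<open>u\<close> or an item of \<beta>,
  so the sum of their lengths decreases.\<close>

lemma acc_complete:
  assumes "q \<le> \<sigma>" "pattern_at x (f 0) \<beta>" "wctx x q f v w" "u \<in> matches \<sigma> \<beta>" "holds q f v w u"
    and "\<And>i. f i < B x" "\<And>i. i \<ge> n \<Longrightarrow> f i = 0"
  shows "acc (meaning x) q f"
  using assms
proof (induction "length u + length \<beta>" arbitrary: u \<beta> q f v w rule: less_induct)
  case less
  note q = less.prems(1) and A = less.prems(2) and ctx = less.prems(3) and u = less.prems(4)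
    and holds = less.prems(5) and f = less.prems(6) and f0 = less.prems(7)
  have read: "read_step x (meaning x) f q b y"
    if len: "length u' + length \<beta>' < length u + length \<beta>" and u': "u' \<in> matches \<sigma> \<beta>'" and A': "pattern_at x y \<beta>'"
      and eq: "u = b # u'" and b: "b \<in> terminals \<sigma>" for b u' \<beta>' y
  proof -
    have set: "set u' \<subseteq> terminals \<sigma>" by (rule matches_set[OF A' u'])
    obtain g v' where g: "pos_step x (meaning x) f b g" "\<And>a. a \<in> terminals \<sigma> \<Longrightarrow> word_at x (g (2 * a - 1)) (v' a)"
      "\<And>a. a \<in> terminals \<sigma> \<Longrightarrow> agree a u' (v' a) (g (2 * a))" "\<And>i. g i < B x"
      using pos_complete[where v = v and f = f, OF b set _ f] ctx holds unfolding wctx_def holds_def eq by blast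
    obtain q' h w' where h: "neg_step x (meaning x) f q b q' h" "q' \<noteq> 0 \<Longrightarrow> q' \<in> terminals \<sigma> \<and> word_at x (h (2 * \<sigma> + 1)) w'"
      "q' \<noteq> 0 \<Longrightarrow> \<not> agree q' u' w' (h (2 * \<sigma> + 2))" "\<And>i. h i < B x" "\<And>i. i \<ge> n \<Longrightarrow> h i = f i"
      using neg_complete[where q = q and w = w and f = f, OF b set _ f] ctx holds unfolding wctx_def holds_def eq by blast
    have y: "y < B x" using pattern_at_less[OF A'] by (simp add: B_def)
    have "acc (meaning x) q' (moved y g h)"
    proof (rule less.hyps[OF len neg_step_le[OF h(1) q] _ _ u'])
      show "pattern_at x (moved y g h 0) \<beta>'" using A' by (simp add: moved_simps)
      show "wctx x q' (moved y g h) v' w'" unfolding wctx_def using g(2) h(2) by (simp add: moved_simps del: One_nat_def)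
      show "holds q' (moved y g h) v' w' u'" unfolding holds_def using g(3) h(3) by (simp add: moved_simps)
      show "moved y g h i < B x" for i using y g(4) h(4) by (simp add: moved_def)
      show "i \<ge> n \<Longrightarrow> moved y g h i = 0" for i using h(5) f0 by (simp add: moved_def arity_def)
    qed
    then show ?thesis unfolding read_step_def using g(1) h(1) by blast
  qed
  have "acc_step x (meaning x) q f"
  proof (cases \<beta>)
    case Nil
    then have u0: "u = []" using u by simp
    have "cell x (f 0) = 1" using A pattern_at_Nil unfolding Nil by blast
    moreover have "f (2 * a) = 0 \<or> (NOA a, [f (2 * a - 1)]) \<in> meaning x" if a: "a \<in> terminals \<sigma>" for a
    proof -
      have "word_at x (f (2 * a - 1)) (v a)" "agree a [] (v a) (f (2 * a))"
        using ctx holds a unfolding wctx_def holds_def u0 by blast+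
      then show ?thesis using NOA_iff[OF terminals_le(1)[OF a]] unfolding agree_Nil by blast
    qed
    moreover have "f (2 * \<sigma> + 2) \<noteq> 0 \<and> (\<exists>J<B x. (NXT q, [f (2 * \<sigma> + 1), J]) \<in> meaning x)" if q0: "q \<noteq> 0"
    proof -
      have w: "word_at x (f (2 * \<sigma> + 1)) w" "f (2 * \<sigma> + 2) \<noteq> 0" "q \<in> set w"
      proof -
        show "word_at x (f (2 * \<sigma> + 1)) w" using ctx q0 unfolding wctx_def by blast
        have "\<not> agree q [] w (f (2 * \<sigma> + 2))" using holds q0 unfolding holds_def u0 by blast
        then show "f (2 * \<sigma> + 2) \<noteq> 0" "q \<in> set w" by (simp_all add: agree_Nil)
      qed
      obtain y w' where y: "w = y @ q # w'" "q \<notin> set y" using split_list_first[OF w(3)] by blast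
      obtain J where "(NXT q, [f (2 * \<sigma> + 1), J]) \<in> meaning x" "word_at x J w'"
        using NXT_complete[OF q _ y(2)] w(1) y(1) by blast
      then show ?thesis using w(2) word_at_less by (auto simp: B_def)
    qed
    ultimately show ?thesis unfolding acc_step_def by blast
  next
    case (Cons s \<beta>')
    show ?thesis
    proof (cases s)
      case (Const b)
      then obtain u' where u': "u = b # u'" "u' \<in> matches \<sigma> \<beta>'" using u Cons by auto
      obtain r where r: "at x (f 0) (True # False # enc_nat b) r" "pattern_at x r \<beta>'" "b \<in> terminals \<sigma>"
        using pattern_at_Const A Cons Const by blast
      have "read_step x (meaning x) f q b r"
        by (rule read[OF _ u'(2) r(2) u'(1) r(3)]) (simp add: u' Cons)
      moreover have "r < B x" using pattern_at_less[OF r(2)] by (simp add: B_def)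
      ultimately show ?thesis unfolding acc_step_def using r by blast
    next
      case (Var m)
      obtain y r where r: "at x (f 0) [True, True] y" "at x y (enc_nat m) r" "pattern_at x r \<beta>'"
        using pattern_at_Var A Cons Var by blast
      obtain u1 u2 where u12: "u = u1 @ u2" "u1 \<in> lists (terminals \<sigma>)" "u2 \<in> matches \<sigma> \<beta>'"
        using u unfolding Cons Var by auto
      show ?thesis
      proof (cases u1)
        case Nil
        have rB: "r < B x" "y < B x" using pattern_at_less[OF r(3)] at_less[OF r(1)] by (simp_all add: B_def)
        have "acc (meaning x) q (f(0 := r))"
        proof (rule less.hyps[OF _ q])
          show "length u + length \<beta>' < length u + length \<beta>" by (simp add: Cons)
          show "pattern_at x ((f(0 := r)) 0) \<beta>'" using r(3) by simp
          show "wctx x q (f(0 := r)) v w" using ctx by (auto simp: wctx_def terminals_def)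
          show "holds q (f(0 := r)) v w u" using holds by (auto simp: holds_def terminals_def)
          show "u \<in> matches \<sigma> \<beta>'" using u12 Nil by simp
          show "(f(0 := r)) i < B x" for i using f rB by simp
          show "i \<ge> n \<Longrightarrow> (f(0 := r)) i = 0" for i using f0 by (auto simp: arity_def)
        qed
        moreover have "(NAT, [y, r]) \<in> meaning x" using r(2) NAT_iff by blast
        ultimately show ?thesis unfolding acc_step_def using r(1) rB by blast
      next
        case u1: (Cons b u3)
        have b: "b \<in> terminals \<sigma>" "u3 \<in> lists (terminals \<sigma>)" using u12(2) u1 by auto
        have m: "u3 @ u2 \<in> matches \<sigma> \<beta>" unfolding Cons Var matches.simps using b(2) u12(3) by blast
        have "read_step x (meaning x) f q b (f 0)"
          by (rule read[OF _ m A _ b(1)]) (simp_all add: u12 u1)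
        moreover have "cell x (f 0) = 2" "cell x (f 0 + 1) = 2" using r(1) by (simp_all add: at.simps)
        ultimately show ?thesis unfolding acc_step_def using b(1) by blast
      qed
    qed
  qed
  then show ?case using acc_intro q f f0 by blast
qed

section \<open>The goal relation and the encoded language\<close>

lemma holds_const:
  assumes u: "set u \<subseteq> terminals \<sigma>" and w: "set w \<subseteq> terminals \<sigma>" and k: "\<And>a. a \<in> terminals \<sigma> \<Longrightarrow> f (2 * a) = k"
  shows "holds q f (\<lambda>_. w) w u \<longleftrightarrow> simon_congruent k u w \<and> (q \<noteq> 0 \<longrightarrow> \<not> agree q u w (f (2 * \<sigma> + 2)))"
  unfolding holds_def simon_congruent_agree_on[OF u w] using k by auto

definition start :: "nat \<Rightarrow> nat \<Rightarrow> nat \<Rightarrow> nat \<Rightarrow> nat" where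
  "start p k l i = (if n \<le> i then 0 else if i = 0 then 1 else if odd i then p else if i = 2 * \<sigma> + 2 then l else k)"

lemma start_simps:
  "start p k l 0 = 1" "a \<in> terminals \<sigma> \<Longrightarrow> start p k l (2 * a - 1) = p" "a \<in> terminals \<sigma> \<Longrightarrow> start p k l (2 * a) = k"
  "start p k l (2 * \<sigma> + 1) = p" "start p k l (2 * \<sigma> + 2) = l" "n \<le> i \<Longrightarrow> start p k l i = 0"
  by (auto simp: start_def terminals_def arity_def)

lemma acc_start:
  assumes q: "q \<le> \<sigma>" and A: "pattern_at x 1 \<alpha>" and W: "word_at x p w" and B: "p < B x" "k < B x" "l < B x"
  shows "acc (meaning x) q (start p k l) \<longleftrightarrow>
    (\<exists>u\<in>matches \<sigma> \<alpha>. simon_congruent k u w \<and> (q \<noteq> 0 \<longrightarrow> \<not> agree q u w l))"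
proof -
  have A': "pattern_at x (start p k l 0) \<alpha>" using A by (simp only: start_simps)
  have W': "wctx x q (start p k l) (\<lambda>_. w) w"
    using W q unfolding wctx_def by (auto simp: start_simps terminals_def simp del: One_nat_def)
  have B': "start p k l i < B x" for i
    using B by (simp add: start_def B_def)
  have "holds q (start p k l) (\<lambda>_. w) w u \<longleftrightarrow> simon_congruent k u w \<and> (q \<noteq> 0 \<longrightarrow> \<not> agree q u w l)"
    if "u \<in> matches \<sigma> \<alpha>" for u
    using holds_const[OF matches_set[OF A that] word_at_set[OF W], of "start p k l" k q] by (simp add: start_simps)
  moreover have "acc (meaning x) q (start p k l) \<longleftrightarrow> (\<exists>u\<in>matches \<sigma> \<alpha>. holds q (start p k l) (\<lambda>_. w) w u)"
    using acc_sound[OF _ q A' W'] acc_complete[OF q A' W' _ _ B' start_simps(6)] by blast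
  ultimately show ?thesis by blast
qed

definition accepts :: "bool list \<Rightarrow> nat \<Rightarrow> nat \<Rightarrow> bool" where
  "accepts x p k \<longleftrightarrow> (if strict then Suc k < B x \<and> (\<exists>q\<in>terminals \<sigma>. acc (meaning x) q (start p k (Suc k)))
     else acc (meaning x) 0 (start p k k))"

lemma goal_unfold:
  "(0, []) \<in> meaning x \<longleftrightarrow> (\<exists>p l k. (ALIST, [1, p]) \<in> meaning x \<and> (WLIST, [p, l, k]) \<in> meaning x \<and>
     (NAT, [l, length x + 1]) \<in> meaning x \<and> (\<exists>m. (VAL, [l, m]) \<in> meaning x \<and> 0 < m \<and> m \<le> k \<and> accepts x p m))"
  (is "_ \<longleftrightarrow> ?R")
proof -
  have e1: "acc S 0 (\<lambda>i. g (if i = 0 then 1 else if odd i then 2 else 5)) = acc S 0 (start p m m)"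
    if "g 1 = 1" "g 2 = p" "g 5 = m" for S g p m
    by (rule acc_cong) (use that in \<open>auto simp: start_def\<close>)
  have e2: "acc S q (\<lambda>i. g (if i = 0 then 1 else if odd i then 2 else if i = 2 * \<sigma> + 2 then 7 else 5)) = acc S q (start p m l)"
    if "g 1 = 1" "g 2 = p" "g 5 = m" "g 7 = l" for S q g p m l
    by (rule acc_cong) (use that in \<open>auto simp: start_def\<close>)
  have move: "sat x S e (move_fm \<sigma> q m) \<longleftrightarrow> acc S q (\<lambda>i. e (m i))" for S e q m
    by (simp add: move_fm_def acc_def o_def)
  \<comment> \<open>The seven quantified variables of \<open>goal_fm\<close>; \<open>z\<close>,
    \<open>one\<close> and \<open>d\<close> are forced to be 0, 1 and
    \<open>length x + 1\<close>.\<close>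
  let ?T = "\<lambda>z one p l k m d. z = 0 \<and> one = z + 1 \<and> (ALIST, [one, p]) \<in> meaning x \<and> (WLIST, [p, l, k]) \<in> meaning x \<and>
     (NAT, [l, d]) \<in> meaning x \<and> length x < d \<and> (VAL, [l, m]) \<in> meaning x \<and> z < m \<and> m \<le> k \<and> accepts x p m"
  let ?E = "\<exists>z<length x + 2. \<exists>one<length x + 2. \<exists>p<length x + 2. \<exists>l<length x + 2. \<exists>k<length x + 2.
      \<exists>m<length x + 2. \<exists>d<length x + 2. ?T z one p l k m d"
  have acc: "sat x (meaning x) (e(0 := 0, 1 := 1, 2 := p, 3 := l, 4 := k, 5 := m, 6 := d))
     (if strict then Ex 7 (And (Off 5 1 7) (Ors (map (\<lambda>q. move_fm \<sigma> q
       (\<lambda>i. if i = 0 then 1 else if odd i then 2 else if i = 2 * \<sigma> + 2 then 7 else 5)) (letters \<sigma>))))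
     else move_fm \<sigma> 0 (\<lambda>i. if i = 0 then 1 else if odd i then 2 else 5)) \<longleftrightarrow> accepts x p m" for e p l k m d
  proof (cases strict)
    case False
    then show ?thesis unfolding accepts_def
      by (simp only: if_False move) (rule e1, simp_all)
  next
    case True
    have "acc (meaning x) q (\<lambda>i. (e(0 := 0, 1 := 1, 2 := p, 3 := l, 4 := k, 5 := m, 6 := d, 7 := v))
        (if i = 0 then 1 else if odd i then 2 else if i = 2 * \<sigma> + 2 then 7 else 5)) = acc (meaning x) q (start p m v)" for q v
      by (rule e2) simp_all
    then show ?thesis unfolding accepts_def using True
      by (simp only: if_True sat.simps sat_Ors set_map set_letters bex_simps move) (auto simp: B_def)
  qed
  have parts: "sat x (meaning x) (e(0 := z, 1 := one, 2 := p, 3 := l, 4 := k, 5 := m, 6 := d)) (Ands [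
     Chr 0 0 3, Off 0 1 1, Rel ALIST [1, 2], Rel WLIST [2, 3, 4], Rel NAT [3, 6], Chr 6 0 0,
     Rel VAL [3, 5], Lt 0 5, Le 5 4, L]) \<longleftrightarrow>
     (z = 0 \<and> one = z + 1 \<and> (ALIST, [one, p]) \<in> meaning x \<and> (WLIST, [p, l, k]) \<in> meaning x \<and>
     (NAT, [l, d]) \<in> meaning x \<and> length x < d \<and> (VAL, [l, m]) \<in> meaning x \<and> z < m \<and> m \<le> k) \<and>
     sat x (meaning x) (e(0 := z, 1 := one, 2 := p, 3 := l, 4 := k, 5 := m, 6 := d)) L" for e z one p l k m d L
    by simp
  have inner: "sat x (meaning x) (e(0 := z, 1 := one, 2 := p, 3 := l, 4 := k, 5 := m, 6 := d)) (Ands [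
     Chr 0 0 3, Off 0 1 1, Rel ALIST [1, 2], Rel WLIST [2, 3, 4], Rel NAT [3, 6], Chr 6 0 0,
     Rel VAL [3, 5], Lt 0 5, Le 5 4,
     if strict then Ex 7 (And (Off 5 1 7) (Ors (map (\<lambda>q. move_fm \<sigma> q
       (\<lambda>i. if i = 0 then 1 else if odd i then 2 else if i = 2 * \<sigma> + 2 then 7 else 5)) (letters \<sigma>))))
     else move_fm \<sigma> 0 (\<lambda>i. if i = 0 then 1 else if odd i then 2 else 5)]) \<longleftrightarrow> ?T z one p l k m d" for e z one p l k m d
  proof (cases "z = 0 \<and> one = 1")
    case True
    then have "z = 0" "one = 1" by auto
    then show ?thesis unfolding parts by (simp only: acc conj_assoc)
  next
    case False
    then have "\<not> (z = 0 \<and> one = z + 1)" by auto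
    then show ?thesis unfolding parts by blast
  qed
  have "(0, []) \<in> meaning x \<longleftrightarrow> ?E"
  proof -
    have "(0, []) \<in> meaning x \<longleftrightarrow> sat x (meaning x) (env []) (goal_fm \<sigma> strict)"
      by (subst meaning_iff) (simp add: body_simps)
    also have "\<dots> \<longleftrightarrow> ?E"
      unfolding goal_fm_def sat.simps(7) by (intro ex_cong1 conj_cong refl inner)
    finally show ?thesis .
  qed
  also have "\<dots> \<longleftrightarrow> ?R"
  proof
    assume ?R
    then obtain p l k m where *: "(ALIST, [1, p]) \<in> meaning x" "(WLIST, [p, l, k]) \<in> meaning x"
      "(NAT, [l, length x + 1]) \<in> meaning x" "(VAL, [l, m]) \<in> meaning x" "0 < m" "m \<le> k" "accepts x p m" by blast
    have b: "p < length x + 2" "l < length x + 2" "k < length x + 2" "m < length x + 2"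
      using *(1,2,4) unfolding meaning_iff by simp_all
    show ?E
      by (rule exI[of _ 0], rule conjI, simp, rule exI[of _ 1], rule conjI, simp, rule exI[of _ p], rule conjI, rule b,
        rule exI[of _ l], rule conjI, rule b, rule exI[of _ k], rule conjI, rule b, rule exI[of _ m], rule conjI, rule b,
        rule exI[of _ "length x + 1"]) (use * in simp)
  next
    assume ?E
    then obtain z one p l k m d where d: "d < length x + 2" and T: "?T z one p l k m d" by blast
    then have eq: "d = length x + 1" "z = 0" "one = 1" by auto
    show ?R using T unfolding eq by blast
  qed
  finally show ?thesis .
qed

text \<open>The parameter \<open>P\<close> separates decoding from acceptance. The last numeral has
  to end at \<open>length x + 1\<close>, so the encoded instance is the whole input.\<close>

lemma regular_input_at:
  "(\<exists>p l k. (ALIST, [1, p]) \<in> meaning x \<and> (WLIST, [p, l, k]) \<in> meaning x \<and>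
     (NAT, [l, length x + 1]) \<in> meaning x \<and> (\<exists>m. (VAL, [l, m]) \<in> meaning x \<and> 0 < m \<and> m \<le> k \<and> P p m)) \<longleftrightarrow>
   (\<exists>\<alpha> w m p l. (\<alpha>, w, m) \<in> regular_inputs \<sigma> \<and> x = enc_inst (\<alpha>, w, m) \<and> at x 1 (enc_list enc_symbol \<alpha>) p \<and>
     at x p (enc_list enc_nat w) l \<and> P p m)"
  (is "?L \<longleftrightarrow> ?R")
proof
  assume ?L
  then obtain p l k m where *: "(ALIST, [1, p]) \<in> meaning x" "(WLIST, [p, l, k]) \<in> meaning x"
     "(NAT, [l, length x + 1]) \<in> meaning x" "(VAL, [l, m]) \<in> meaning x" "0 < m" "m \<le> k" "P p m" by blast
  obtain \<alpha> where \<alpha>: "\<alpha> \<in> lists (symbols \<sigma>)" "regular_pattern \<alpha>" "at x 1 (enc_list enc_symbol \<alpha>) p"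
    using *(1) ALIST_iff by blast
  obtain w where w: "w \<in> lists (terminals \<sigma>)" "at x p (enc_list enc_nat w) l" "length w = k"
    using *(2) WLIST_iff by blast
  obtain m' where m': "at x l (enc_nat m') (length x + 1)" using *(3) NAT_iff by blast
  have "m = m'" using *(4) VAL_iff[OF m'] by blast
  have "at x 1 (enc_list enc_symbol \<alpha> @ enc_list enc_nat w @ enc_nat m) (length x + 1)"
    using \<alpha>(3) w(2) m' at_append unfolding \<open>m = m'\<close> by blast
  then have "x = enc_inst (\<alpha>, w, m)" unfolding at_whole by simp
  moreover have "(\<alpha>, w, m) \<in> regular_inputs \<sigma>"
    using \<alpha> w *(5,6) by (simp add: regular_inputs_def inputs_def)
  ultimately show ?R using \<alpha>(3) w(2) *(7) by blast
next
  assume ?R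
  then obtain \<alpha> w m p l where i: "(\<alpha>, w, m) \<in> regular_inputs \<sigma>" and x: "x = enc_inst (\<alpha>, w, m)"
    and p: "at x 1 (enc_list enc_symbol \<alpha>) p" and l: "at x p (enc_list enc_nat w) l" and P: "P p m" by blast
  have a: "\<alpha> \<in> lists (symbols \<sigma>)" "regular_pattern \<alpha>" "w \<in> lists (terminals \<sigma>)" "0 < m" "m \<le> length w"
    using i by (auto simp: regular_inputs_def inputs_def)
  have "at x 1 (enc_list enc_symbol \<alpha> @ enc_list enc_nat w @ enc_nat m) (length x + 1)"
    unfolding at_whole using x by simp
  then obtain p' where p': "at x 1 (enc_list enc_symbol \<alpha>) p'" "at x p' (enc_list enc_nat w @ enc_nat m) (length x + 1)"
    using at_append by blast
  have "p' = p" using at_bounds[OF p] at_bounds[OF p'(1)] by simp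
  from p'(2) obtain l' where l': "at x p' (enc_list enc_nat w) l'" "at x l' (enc_nat m) (length x + 1)"
    using at_append by blast
  have "l' = l" using at_bounds[OF l] at_bounds[OF l'(1)] \<open>p' = p\<close> by simp
  have m: "at x l (enc_nat m) (length x + 1)" using l'(2) \<open>l' = l\<close> by simp
  have wl: "(WLIST, [p, l, length w]) \<in> meaning x" using WLIST_iff l a(3) by blast
  then have "length w < length x + 2" unfolding meaning_iff by simp
  then have "(VAL, [l, m]) \<in> meaning x" using VAL_iff[OF m] a(5) by simp
  moreover have "(ALIST, [1, p]) \<in> meaning x" using ALIST_iff p a(1,2) by blast
  moreover have "(NAT, [l, length x + 1]) \<in> meaning x" using NAT_iff m by blast
  ultimately show ?L
    using wl P a(4,5) by blast
qed

lemma accepts_iff: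
  assumes "(\<alpha>, w, m) \<in> regular_inputs \<sigma>" "at x 1 (enc_list enc_symbol \<alpha>) p" "at x p (enc_list enc_nat w) l"
  shows "accepts x p m \<longleftrightarrow> (\<exists>u\<in>matches \<sigma> \<alpha>. simon_congruent m u w \<and> (strict \<longrightarrow> \<not> simon_congruent (m + 1) u w))"
proof -
  have a: "\<alpha> \<in> lists (symbols \<sigma>)" "w \<in> lists (terminals \<sigma>)" "m \<le> length w"
    using assms(1) by (auto simp: regular_inputs_def inputs_def)
  have A: "pattern_at x 1 \<alpha>" using a(1) assms(2) by (auto simp: pattern_at_def)
  have W: "word_at x p w" using a(2) assms(3) by (auto simp: word_at_def)
  have len: "length w < length (enc_list enc_nat w)" for w by (induction w) auto
  \<comment> \<open>This leaves room for \<open>Suc m\<close> as a position, although only m \<le>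
    |w| is known.\<close>
  have "0 < p" "p + length w < length x + 1"
    using at_bounds[OF assms(3)] len[of w] by linarith+
  then have b: "p < B x" "m < B x" "Suc m < B x" using a(3) by (simp_all add: B_def)
  show ?thesis
  proof (cases strict)
    case False
    then show ?thesis unfolding accepts_def using acc_start[OF _ A W b(1,2,2), of 0] by simp
  next
    case True
    \<comment> \<open>The initial \<open>q\<close> guesses the first letter of a separating
      word.\<close>
    have "(\<exists>q\<in>terminals \<sigma>. acc (meaning x) q (start p m (Suc m))) \<longleftrightarrow>
      (\<exists>q\<in>terminals \<sigma>. \<exists>u\<in>matches \<sigma> \<alpha>. simon_congruent m u w \<and> \<not> agree q u w (Suc m))"
      by (rule bex_cong[OF refl]) (subst acc_start[OF terminals_le(1) A W b], auto simp: terminals_le)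
    also have "\<dots> \<longleftrightarrow> (\<exists>u\<in>matches \<sigma> \<alpha>. simon_congruent m u w \<and> \<not> simon_congruent (Suc m) u w)"
      using simon_congruent_agree_on[OF matches_set[OF A] word_at_set[OF W], of _ "Suc m"] by blast
    finally show ?thesis unfolding accepts_def using True b(3) by simp
  qed
qed

theorem goal_iff:
  "(0, []) \<in> meaning x \<longleftrightarrow> (\<exists>\<alpha> w k. x = enc_inst (\<alpha>, w, k) \<and> (\<alpha>, w, k) \<in> regular_inputs \<sigma> \<and>
     (\<exists>u\<in>matches \<sigma> \<alpha>. simon_congruent k u w \<and> (strict \<longrightarrow> \<not> simon_congruent (k + 1) u w)))"
proof -
  have ex: "\<exists>p l. at x 1 (enc_list enc_symbol \<alpha>) p \<and> at x p (enc_list enc_nat w) l" if "x = enc_inst (\<alpha>, w, k)" for \<alpha> w k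
  proof -
    have "at x 1 (enc_list enc_symbol \<alpha> @ enc_list enc_nat w @ enc_nat k) (length x + 1)"
      unfolding at_whole using that by simp
    then obtain p where p: "at x 1 (enc_list enc_symbol \<alpha>) p" "at x p (enc_list enc_nat w @ enc_nat k) (length x + 1)"
      using at_append by blast
    then obtain l where "at x p (enc_list enc_nat w) l" using at_append by blast
    with p(1) show ?thesis by blast
  qed
  show ?thesis
    unfolding goal_unfold regular_input_at using accepts_iff ex by blast
qed

theorem language_in_class_P:
  "enc_inst ` {(\<alpha>, w, k) \<in> regular_inputs \<sigma>. \<exists>u\<in>matches \<sigma> \<alpha>. simon_congruent k u w \<and>
     (strict \<longrightarrow> \<not> simon_congruent (k + 1) u w)} \<in> class_P"
proof -
  have "enc_inst ` {(\<alpha>, w, k) \<in> regular_inputs \<sigma>. \<exists>u\<in>matches \<sigma> \<alpha>. simon_congruent k u w \<and>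
     (strict \<longrightarrow> \<not> simon_congruent (k + 1) u w)} = {x. (0, []) \<in> meaning x}"
    unfolding goal_iff by (force simp del: enc_inst.simps)
  then show ?thesis using goal_in_class_P by simp
qed

end

theorem proposition3:
  fixes \<sigma> :: nat
  assumes "\<sigma> \<ge> 2"
  shows "enc_inst ` (MatchSimon \<sigma> \<inter> regular_inputs \<sigma>) \<in> class_P \<and>
    enc_inst ` (MatchStrictSimon \<sigma> \<inter> regular_inputs \<sigma>) \<in> class_P"
proof -
  \<comment> \<open>The constants \<open>False\<close> and \<open>True\<close> stand for the
    parameter \<open>strict\<close>, which makes both problems instances of one statement.\<close>
  have "MatchSimon \<sigma> \<inter> regular_inputs \<sigma> = {(\<alpha>, w, k) \<in> regular_inputs \<sigma>. \<exists>u\<in>matches \<sigma> \<alpha>. simon_congruent k u w \<and>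
     (False \<longrightarrow> \<not> simon_congruent (k + 1) u w)}"
    by (rule set_eqI) (simp only: split_paired_all MatchSimon_regular mem_Collect_eq case_prod_conv simp_thms)
  moreover have "MatchStrictSimon \<sigma> \<inter> regular_inputs \<sigma> = {(\<alpha>, w, k) \<in> regular_inputs \<sigma>. \<exists>u\<in>matches \<sigma> \<alpha>. simon_congruent k u w \<and>
     (True \<longrightarrow> \<not> simon_congruent (k + 1) u w)}"
    by (rule set_eqI) (simp only: split_paired_all MatchStrictSimon_regular mem_Collect_eq case_prod_conv simp_thms)
  ultimately show ?thesis
    using simon.language_in_class_P[of \<sigma> False] simon.language_in_class_P[of \<sigma> True] by (simp only:)
qed

end
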